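(* In the sequence-of-problems setting described in the context (hat matrices that are projections onto selected columns, model sizes at most $K$ with $K^2\log p=O(\sqrt n)$, and the accuracy condition on $\hat M$ with constant $\delta>0$), with $O$-constants not depending on $n$ or on $\alpha\in(0,\delta)$, $$\mathrm{Bias}\left[\frac1n\widehat{\mathrm{Err}}_\alpha\right]=O(\alpha),\qquad \mathrm{Var}\left[\frac1n\widehat{\mathrm{Err}}_\alpha\right]=O\left(\frac1{n\alpha^2}\right).$$ Furthermore, if $\alpha=n^{-1/4}$, then as $n\to\infty$ $$\mathbb{E}\left[\frac1{n^2}\left(\widehat{\mathrm{Err}}_\alpha-\mathrm{Err}\right)^2\right]=O\left(n^{-1/2}\right).$$
   Context: Setting: $\sigma^2>0$ and $\delta>0$ are fixed. For each $n$ there are: a number of features $p=p_n$, a fixed matrix $X\in\mathbb{R}^{n\times p}$, a fixed mean vector $\mu=\mu(X)\in\mathbb{R}^n$ (not necessarily linear in $X$), a response $y\sim N(\mu,\sigma^2 I_n)$, a collection $\mathcal{M}=\{M_1,\dots,M_{|\mathcal M|}\}\subseteq 2^{\{1,\dots,p\}}$, and a surjective selection map $\hat M:\mathbb{R}^n\to\mathcal{M}$. The sets $U_i=\hat M^{-1}(M_i)$ partition $\mathbb{R}^n$, and each $U_i$ has nonempty interior and boundary of Lebesgue measure $0$. Assumptions (all $O(\cdot)$ constants are independent of $n$): (1) For every $M\in\mathcal{M}$, $H_M=X_M(X_M^TX_M)^{-1}X_M^T$, where $X_M$ is the submatrix of $X$ with columns in $M$ ($H_\emptyset=0$); so $H_M$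 is symmetric and $H_M^2=H_M$. The data-dependent hat matrix is $H_{\hat M(y)}=\sum_i H_{M_i}\mathbf 1\{y\in U_i\}$. (2) There is $K=K_n$ such that $\mathrm{rank}(H_M)\le |M|\le K$ for every $M\in\mathcal{M}$, and $K^2\log p=O(\sqrt n)$. (3) $\mathbb{E}\big[\big(\|\mu-H_{\hat M(y')}\mu\|_2^2\big)^2\big]=O(n)$ for $y'\sim N(\mu,\tau I_n)$, uniformly over $\sigma^2\le\tau\le(1+\delta)\sigma^2$. Definitions: for $\alpha>0$, $\omega\sim N(0,\alpha\sigma^2I_n)$ is independent of $y$, $y^*=y+\omega$, $y^-=y-\frac1\alpha\omega$, and $$\widehat{\mathrm{Err}}_{\alpha}=\|y^- - H_{\hat M(y^* )}y\|_2^2+2\,\mathrm{tr}(H_{\hat M(y^* )})\sigma^2-\tfrac1\alpha n\sigma^2,\qquad \mathrm{Err}=\mathbb{E}\|y_{new}-H_{\hat M(y)}y\|_2^2,$$ with $y_{new}\sim N(\mu,\sigma^2I_n)$ independent of $y$. The bias is relative to $\frac1n\mathrm{Err}$: $\mathrm{Bias}[\frac1n\widehat{\mathrm{Err}}_\alpha]=\frac1n(\mathbb{E}[\widehat{\mathrm{Err}}_\alpha]-\mathrm{Err})$. *)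

theory Defs
  imports
    "HOL-Probability.Probability"
    "HOL-Library.Landau_Symbols"
    "Jordan_Normal_Form.Gauss_Jordan_Elimination"
    "Jordan_Normal_Form.DL_Rank"
    "Jordan_Normal_Form.DL_Submatrix"
begin

text \<open>
  Since the sample size \<open>n\<close> varies inside the statement, a point of \<open>\<real>\<^sup>n\<close> is an extensional
  function on \<open>{..<n}\<close>. This carries the product topology and the product measures of the library;
  \<open>Matrix.vec n\<close> turns such a function into a column vector. Columns of the design matrix,
  and hence elements of models, are numbered from 0.
\<close>

abbreviation Rn :: "nat \<Rightarrow> (nat \<Rightarrow> real) set" where
  "Rn n \<equiv> {..<n} \<rightarrow>\<^sub>E UNIV"

abbreviation Rn_topology :: "nat \<Rightarrow> (nat \<Rightarrow> real) topology" where
  "Rn_topology n \<equiv> product_topology (\<lambda>_. euclideanreal) {..<n}"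

abbreviation Rn_lebesgue :: "nat \<Rightarrow> (nat \<Rightarrow> real) measure" where
  "Rn_lebesgue n \<equiv> completion (\<Pi>\<^sub>M i\<in>{..<n}. lborel)"

text \<open>The law \<open>N(m, v I\<^sub>n)\<close>, on the Borel sets. Note that \<open>v\<close> is the variance, whereas
  \<^const>\<open>normal_density\<close> takes the standard deviation.\<close>

definition gauss :: "nat \<Rightarrow> (nat \<Rightarrow> real) \<Rightarrow> real \<Rightarrow> (nat \<Rightarrow> real) measure" where
  "gauss n m v =
     (\<Pi>\<^sub>M i\<in>{..<n}. density lborel (\<lambda>x. ennreal (normal_density (m i) (sqrt v) x)))"

definition sq_norm2 :: "real Matrix.vec \<Rightarrow> real" where
  "sq_norm2 v = scalar_prod v v"

definition mat_trace :: "real mat \<Rightarrow> real" where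
  "mat_trace A = (\<Sum>i<dim_row A. A $$ (i, i))"

definition col_submatrix :: "real mat \<Rightarrow> nat set \<Rightarrow> real mat" where
  "col_submatrix X M = submatrix X UNIV M"

text \<open>Only meaningful if \<open>X\<^sub>M\<^sup>T X\<^sub>M\<close> is invertible. For \<open>M = {}\<close> the matrix \<open>X\<^sub>M\<close> has no columns
  and the product is the zero matrix.\<close>

definition hat_matrix :: "real mat \<Rightarrow> nat set \<Rightarrow> real mat" where
  "hat_matrix X M =
     (let XM = col_submatrix X M
      in XM * the (mat_inverse (transpose_mat XM * XM)) * transpose_mat XM)"

definition selection_region :: "nat \<Rightarrow> ((nat \<Rightarrow> real) \<Rightarrow> nat set) \<Rightarrow> nat set \<Rightarrow> (nat \<Rightarrow> real) set" where
  "selection_region n Mhat M = {y \<in> Rn n. Mhat y = M}"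

text \<open>
  The boundaries of the selection regions are Lebesgue null, so the regions are Lebesgue measurable
  but not necessarily Borel. All expectations are therefore taken with respect to completed laws.

  In \<open>Err\<close> the pair \<open>(y, y\<^sub>n\<^sub>e\<^sub>w)\<close>, and below the pair \<open>(y, \<omega>)\<close>, is independent, i.e. distributed
  according to a product measure.
\<close>

definition Err ::
  "nat \<Rightarrow> real mat \<Rightarrow> (nat \<Rightarrow> real) \<Rightarrow> ((nat \<Rightarrow> real) \<Rightarrow> nat set) \<Rightarrow> real \<Rightarrow> real" where
  "Err n X \<mu> Mhat s2 =
     (\<integral>(y, ynew). sq_norm2 (Matrix.vec n ynew - hat_matrix X (Mhat y) *\<^sub>v Matrix.vec n y)
        \<partial>completion (gauss n \<mu> s2 \<Otimes>\<^sub>M gauss n \<mu> s2))"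

definition randomized_law ::
  "nat \<Rightarrow> (nat \<Rightarrow> real) \<Rightarrow> real \<Rightarrow> real \<Rightarrow> ((nat \<Rightarrow> real) \<times> (nat \<Rightarrow> real)) measure" where
  "randomized_law n \<mu> s2 \<alpha> = completion (gauss n \<mu> s2 \<Otimes>\<^sub>M gauss n (\<lambda>_. 0) (\<alpha> * s2))"

definition Err_hat ::
  "nat \<Rightarrow> real mat \<Rightarrow> ((nat \<Rightarrow> real) \<Rightarrow> nat set) \<Rightarrow> real \<Rightarrow> real \<Rightarrow> (nat \<Rightarrow> real) \<times> (nat \<Rightarrow> real) \<Rightarrow> real"
  where
  "Err_hat n X Mhat s2 \<alpha> = (\<lambda>(y, \<omega>).
     let ystar = (\<lambda>i\<in>{..<n}. y i + \<omega> i);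
         yminus = (\<lambda>i\<in>{..<n}. y i - \<omega> i / \<alpha>);
         H = hat_matrix X (Mhat ystar)
     in sq_norm2 (Matrix.vec n yminus - H *\<^sub>v Matrix.vec n y)
          + 2 * mat_trace H * s2 - real n * s2 / \<alpha>)"

definition Bias_scaled ::
  "nat \<Rightarrow> real mat \<Rightarrow> (nat \<Rightarrow> real) \<Rightarrow> ((nat \<Rightarrow> real) \<Rightarrow> nat set) \<Rightarrow> real \<Rightarrow> real \<Rightarrow> real" where
  "Bias_scaled n X \<mu> Mhat s2 \<alpha> =
     ((\<integral>z. Err_hat n X Mhat s2 \<alpha> z \<partial>randomized_law n \<mu> s2 \<alpha>) - Err n X \<mu> Mhat s2) / real n"

definition Var_scaled ::
  "nat \<Rightarrow> real mat \<Rightarrow> (nat \<Rightarrow> real) \<Rightarrow> ((nat \<Rightarrow> real) \<Rightarrow> nat set) \<Rightarrow> real \<Rightarrow> real \<Rightarrow> real" where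
  "Var_scaled n X \<mu> Mhat s2 \<alpha> =
     prob_space.variance (randomized_law n \<mu> s2 \<alpha>) (\<lambda>z. Err_hat n X Mhat s2 \<alpha> z / real n)"

definition MSE_scaled ::
  "nat \<Rightarrow> real mat \<Rightarrow> (nat \<Rightarrow> real) \<Rightarrow> ((nat \<Rightarrow> real) \<Rightarrow> nat set) \<Rightarrow> real \<Rightarrow> real \<Rightarrow> real" where
  "MSE_scaled n X \<mu> Mhat s2 \<alpha> =
     (\<integral>z. (Err_hat n X Mhat s2 \<alpha> z - Err n X \<mu> Mhat s2)\<^sup>2 / (real n)\<^sup>2
        \<partial>randomized_law n \<mu> s2 \<alpha>)"

end

theory Submission
  imports Defs
begin

text \<open>
  The variables \<open>u = y + \<omega>\<close> and \<open>v = y - \<omega> / \<alpha>\<close> are independent, with laws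
  \<open>N(\<mu>, (1 + \<alpha>) \<sigma>\<^sup>2 I)\<close> and \<open>N(\<mu>, (1 + 1 / \<alpha>) \<sigma>\<^sup>2 I)\<close>, and \<open>y = (u + \<alpha> v) / (1 + \<alpha>)\<close>. For fixed \<open>u\<close> the
  model is fixed and the estimator is quadratic in \<open>v\<close>. Integrating out \<open>v\<close> shows that it is
  unbiased for the risk \<open>n \<sigma>\<^sup>2 + E \<parallel>\<mu> - H y\<parallel>\<^sup>2\<close> with the model selected from \<open>u\<close> instead of \<open>y\<close>.

  The bias therefore compares the expectations of \<open>\<parallel>\<mu> - H \<mu>\<parallel>\<^sup>2 + \<parallel>H (u - \<mu>)\<parallel>\<^sup>2\<close> under two variances, up to
  terms of order \<open>n \<alpha>\<close>. The logarithmic derivative of the density in the variance has standard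
  deviation of order \<open>sqrt n\<close>, and both summands have second moments of order \<open>n\<close>: the first by the
  accuracy assumption, the second by a union bound over the at most \<open>(p + 1) ^ K\<close> models, using
  \<open>K\<^sup>2 log p = O(sqrt n)\<close>. The same moment bounds, with \<open>v\<close> of variance of order \<open>1 / \<alpha>\<close>, control the
  variance of the estimator.
\<close>

subsection \<open>Hat matrices\<close>

text \<open>The orders of magnitude fit as follows. The variable \<open>v\<close> has variance (1 +
  1/\<alpha>) \<sigma>^2, so the centred chi-square part of the estimator has variance of order
  n/\<alpha>^2, which becomes 1/(n \<alpha>^2) after division by n^2. Nothing larger appears,
  because every other quadratic term sees the noise only through a projection. The second moment of
  the projected noise is of order (k log |M|)^2 with |M| the number of models; since log |M| is at
  most k log(p + 1), this is the square of K^2 log p up to constants, hence O(n). For the bias, a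
  score of size sqrt n paired with a function of L2 norm sqrt n gives a Lipschitz constant of order
  n in the variance.

  Two obstacles shape the proof. The projection is selected by the same vector whose noise it
  projects, so formulas for a fixed projection do not apply and the noise must be dominated by an
  envelope valid for all models at once. The selection regions are only Lebesgue measurable, so the
  probabilistic core works with a Borel selection that agrees with the given one off the
  boundaries.\<close>

lemma mat_inverse_invertible:
  fixes G :: "real mat"
  assumes G: "G \<in> carrier_mat k k" and inv: "invertible_mat G"
  shows "the (mat_inverse G) \<in> carrier_mat k k"
    "G * the (mat_inverse G) = 1\<^sub>m k"
proof -
  obtain B where B: "G * B = 1\<^sub>m k" "B * G = 1\<^sub>m (dim_row B)"
    using inv G by (auto simp: invertible_mat_def inverts_mat_def)
  \<comment> \<open>\<open>inverts_mat\<close> does not fix the shape of \<open>B\<close>; both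
    dimensions are read off from the two product equations, and this makes \<open>G\<close> a unit
    of the matrix ring, as the specification of \<open>mat_inverse\<close> asks.\<close>
  have Bc: "B \<in> carrier_mat k k"
    using arg_cong[OF B(1), of dim_col] arg_cong[OF B(2), of dim_col] G by auto
  have "G \<in> Units (ring_mat TYPE(real) k undefined)"
    using G B Bc by (auto simp: Units_def ring_mat_def)
  then obtain C where "mat_inverse G = Some C"
    using mat_inverse(1)[OF G, of undefined] by (cases "mat_inverse G") auto
  then show "the (mat_inverse G) \<in> carrier_mat k k"
    "G * the (mat_inverse G) = 1\<^sub>m k"
    using mat_inverse(2)[OF G] by auto
qed

lemma mat_trace_mult_comm:
  assumes A: "A \<in> carrier_mat n m" and B: "B \<in> carrier_mat m n"
  shows "mat_trace (A * B) = mat_trace (B * A)"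
proof -
  have "mat_trace (A * B) = (\<Sum>i<n. \<Sum>j<m. A $$ (i, j) * B $$ (j, i))"
    using A B by (auto simp: mat_trace_def scalar_prod_def atLeast0LessThan intro!: sum.cong)
  also have "\<dots> = (\<Sum>j<m. \<Sum>i<n. B $$ (j, i) * A $$ (i, j))"
    by (subst sum.swap) (simp add: mult.commute)
  also have "\<dots> = mat_trace (B * A)"
    using A B by (auto simp: mat_trace_def scalar_prod_def atLeast0LessThan intro!: sum.cong)
  finally show ?thesis .
qed

lemma col_submatrix_carrier:
  assumes "X \<in> carrier_mat n p" and "M \<subseteq> {..<p}"
  shows "col_submatrix X M \<in> carrier_mat n (card M)"
proof -
  have "{j. j < p \<and> j \<in> M} = M" using assms(2) by auto
  with assms(1) show ?thesis
    by (intro carrier_matI) (simp_all add: col_submatrix_def dim_submatrix)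
qed

text \<open>All four facts come from \<open>G * B = 1\<^sub>m k\<close> for the Gram matrix
  \<open>G\<close> of the selected columns: symmetry of \<open>G\<close> passes to its inverse
  \<open>B\<close>, the identity A^T (A B A^T) = A^T gives idempotence, and cyclicity reduces the
  trace to that of the identity matrix of size \<open>card M\<close>.\<close>

lemma hat_matrix_projection:
  assumes X: "X \<in> carrier_mat n p" and M: "M \<subseteq> {..<p}"
    and inv: "invertible_mat (transpose_mat (col_submatrix X M) * col_submatrix X M)"
  shows "hat_matrix X M \<in> carrier_mat n n"
    and "transpose_mat (hat_matrix X M) = hat_matrix X M"
    and "hat_matrix X M * hat_matrix X M = hat_matrix X M"
    and "mat_trace (hat_matrix X M) = real (card M)"
proof -
  define k where "k = card M"
  define A where "A = col_submatrix X M"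
  define G where "G = transpose_mat A * A"
  define B where "B = the (mat_inverse G)"
  have A: "A \<in> carrier_mat n k"
    using col_submatrix_carrier[OF X M] by (simp add: A_def k_def)
  then have At: "transpose_mat A \<in> carrier_mat k n" by simp
  have G: "G \<in> carrier_mat k k" unfolding G_def by (rule mult_carrier_mat[OF At A])
  have B: "B \<in> carrier_mat k k" and GB: "G * B = 1\<^sub>m k"
    using mat_inverse_invertible[OF G] inv by (auto simp: B_def G_def A_def)
  have H: "hat_matrix X M = A * B * transpose_mat A"
    by (simp add: hat_matrix_def Let_def A_def B_def G_def)
  have AB: "A * B \<in> carrier_mat n k" by (rule mult_carrier_mat[OF A B])
  show "hat_matrix X M \<in> carrier_mat n n"
    unfolding H by (rule mult_carrier_mat[OF AB At])
  have Gt: "transpose_mat G = G"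
    unfolding G_def transpose_mult[OF At A] transpose_transpose ..
  have Bt: "transpose_mat B \<in> carrier_mat k k" using B by simp
  have "transpose_mat B = transpose_mat B * (G * B)"
    unfolding GB by (rule right_mult_one_mat[OF Bt, symmetric])
  also have "\<dots> = transpose_mat B * transpose_mat G * B"
    unfolding Gt by (rule assoc_mult_mat[OF Bt G B, symmetric])
  also have "transpose_mat B * transpose_mat G = transpose_mat (G * B)"
    by (rule transpose_mult[OF G B, symmetric])
  also have "\<dots> * B = B"
    unfolding GB transpose_one by (rule left_mult_one_mat[OF B])
  finally have Bsym: "transpose_mat B = B" .
  show "transpose_mat (hat_matrix X M) = hat_matrix X M"
    unfolding H transpose_mult[OF AB At] transpose_mult[OF A B] Bsym transpose_transpose
    by (rule assoc_mult_mat[OF A B At, symmetric])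
  have "transpose_mat A * (A * B) = 1\<^sub>m k"
    using GB unfolding G_def assoc_mult_mat[OF At A B] .
  then have AtH: "transpose_mat A * (A * B * transpose_mat A) = transpose_mat A"
    using assoc_mult_mat[OF At AB At] left_mult_one_mat[OF At] by simp
  show "hat_matrix X M * hat_matrix X M = hat_matrix X M"
    unfolding H assoc_mult_mat[OF AB At mult_carrier_mat[OF AB At]] AtH ..
  have "mat_trace (hat_matrix X M) = mat_trace (transpose_mat A * (A * B))"
    unfolding H by (rule mat_trace_mult_comm[OF AB At])
  also have "\<dots> = real k"
    unfolding \<open>transpose_mat A * (A * B) = 1\<^sub>m k\<close> by (simp add: mat_trace_def)
  finally show "mat_trace (hat_matrix X M) = real (card M)" by (simp add: k_def)
qed

subsection \<open>Normal distributions on the line\<close>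

abbreviation normal_law :: "real \<Rightarrow> real \<Rightarrow> real measure" where
  "normal_law m v \<equiv> density lborel (\<lambda>x. ennreal (normal_density m (sqrt v) x))"

lemma prob_space_normal_law: "0 < v \<Longrightarrow> prob_space (normal_law m v)"
  by (rule prob_space_normal_density) simp

lemma normal_density_sqrt:
  "0 < v \<Longrightarrow> normal_density m (sqrt v) x = exp (- (x - m)\<^sup>2 / (2 * v)) / sqrt (2 * pi * v)"
  by (simp add: normal_density_def)

lemma nn_integral_normal_density:
  "0 < v \<Longrightarrow> (\<integral>\<^sup>+x. ennreal (normal_density m (sqrt v) x) \<partial>lborel) = 1"
  by (subst nn_integral_eq_integral) auto

text \<open>The last value, 3 v^2 - 2 v^2 + v^2, is the variance of one squared deviation; summed
  over the coordinates it yields the leading term in the variance of the estimator.\<close>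

lemma normal_law_moments:
  assumes v: "0 < v"
  shows "integrable (normal_law m v) (\<lambda>x. (x - m) ^ k)"
    and "(\<integral>x. x - m \<partial>normal_law m v) = 0"
    and "(\<integral>x. (x - m)\<^sup>2 \<partial>normal_law m v) = v"
    and "(\<integral>x. ((x - m)\<^sup>2 - v)\<^sup>2 \<partial>normal_law m v) = 2 * v\<^sup>2"
proof -
  have s: "0 < sqrt v" using v by simp
  show int: "integrable (normal_law m v) (\<lambda>x. (x - m) ^ k)" for k
    by (subst integrable_density) (auto intro: integrable_normal_moment[OF s])
  have E: "(\<integral>x. (x - m) ^ k \<partial>normal_law m v)
      = (\<integral>x. normal_density m (sqrt v) x * (x - m) ^ k \<partial>lborel)" for k
    by (subst integral_density) auto
  show "(\<integral>x. x - m \<partial>normal_law m v) = 0"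
    using E[of 1] integral_normal_moment_odd[OF s, of m 0] by simp
  show 2: "(\<integral>x. (x - m)\<^sup>2 \<partial>normal_law m v) = v"
    using E[of 2] integral_normal_moment_even[OF s, of m 1] v by (simp add: fact_numeral)
  have 4: "(\<integral>x. (x - m) ^ 4 \<partial>normal_law m v) = 3 * v\<^sup>2"
    using E[of 4] integral_normal_moment_even[OF s, of m 2] v
    by (simp add: fact_numeral field_simps power2_eq_square)
  interpret prob_space "normal_law m v" by (rule prob_space_normal_law[OF v])
  have "(\<integral>x. ((x - m)\<^sup>2 - v)\<^sup>2 \<partial>normal_law m v)
      = (\<integral>x. (x - m) ^ 4 - 2 * v * (x - m)\<^sup>2 + v\<^sup>2 \<partial>normal_law m v)"
    by (intro Bochner_Integration.integral_cong) (auto simp: power4_eq_xxxx power2_eq_square algebra_simps)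
  also have "\<dots> = 3 * v\<^sup>2 - 2 * v * v + v\<^sup>2"
    using int[of 4] int[of 2] prob_space by (simp add: 2 4 del: space_density)
  finally show "(\<integral>x. ((x - m)\<^sup>2 - v)\<^sup>2 \<partial>normal_law m v) = 2 * v\<^sup>2"
    by (simp add: power2_eq_square)
qed

text \<open>Completing the square: the exponential factor moves the mean to \<open>m + v * a\<close>
  and leaves the constant on the right.\<close>

lemma nn_integral_normal_law_exp:
  assumes v: "0 < v"
  shows "(\<integral>\<^sup>+x. ennreal (exp (a * (x - m))) \<partial>normal_law m v) = ennreal (exp (v * a\<^sup>2 / 2))"
proof -
  have "normal_density m (sqrt v) x * exp (a * (x - m))
      = exp (v * a\<^sup>2 / 2) * normal_density (m + v * a) (sqrt v) x" for x
  proof -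
    have "- (x - m)\<^sup>2 / (2 * v) + a * (x - m) = v * a\<^sup>2 / 2 + - (x - (m + v * a))\<^sup>2 / (2 * v)"
      using v by (simp add: field_simps power2_eq_square)
    then show ?thesis
      unfolding normal_density_sqrt[OF v] by (simp add: exp_add[symmetric])
  qed
  then have "(\<integral>\<^sup>+x. ennreal (exp (a * (x - m))) \<partial>normal_law m v)
      = (\<integral>\<^sup>+x. ennreal (exp (v * a\<^sup>2 / 2)) * ennreal (normal_density (m + v * a) (sqrt v) x) \<partial>lborel)"
    by (subst nn_integral_density) (auto simp: ennreal_mult[symmetric] intro!: nn_integral_cong)
  then show ?thesis
    by (simp add: nn_integral_cmult nn_integral_normal_density[OF v])
qed

text \<open>The factor halves the precision and so turns the density of N(0, 1) into sqrt 2 times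
  that of N(0, 2). The exponent 1/4 is half the critical value 1/2 and is the origin of the
  \<open>4 * v\<close> in the later exponential bounds.\<close>

lemma nn_integral_normal_law_exp_square:
  "(\<integral>\<^sup>+x. ennreal (exp (x\<^sup>2 / 4)) \<partial>normal_law 0 1) = ennreal (sqrt 2)"
proof -
  have "normal_density 0 (sqrt 1) x * exp (x\<^sup>2 / 4) = sqrt 2 * normal_density 0 (sqrt 2) x" for x :: real
  proof -
    have n1: "normal_density 0 (sqrt 1) x = exp (- (x - 0)\<^sup>2 / (2 * 1)) * (1 / sqrt (2 * pi * 1))"
      and n2: "normal_density 0 (sqrt 2) x = exp (- (x - 0)\<^sup>2 / (2 * 2)) * (1 / sqrt (2 * pi * 2))"
      by (subst normal_density_sqrt; simp)+
    have "- (x - 0)\<^sup>2 / (2 * 1) + x\<^sup>2 / 4 = - (x - 0)\<^sup>2 / (2 * 2)" by (simp add: field_simps)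
    moreover have "1 / sqrt (2 * pi * 1) = sqrt 2 / sqrt (2 * pi * 2)"
      by (simp add: real_sqrt_mult field_simps)
    ultimately show ?thesis
      unfolding n1 n2 by (simp add: mult_exp_exp)
  qed
  then have "(\<integral>\<^sup>+x. ennreal (exp (x\<^sup>2 / 4)) \<partial>normal_law 0 1)
      = (\<integral>\<^sup>+x. ennreal (sqrt 2) * ennreal (normal_density 0 (sqrt 2) x) \<partial>lborel)"
    by (subst nn_integral_density) (auto simp: ennreal_mult[symmetric] intro!: nn_integral_cong)
  then show ?thesis
    by (simp add: nn_integral_cmult nn_integral_normal_density)
qed

definition normal_ratio :: "real \<Rightarrow> real \<Rightarrow> real \<Rightarrow> real \<Rightarrow> real" where
  "normal_ratio m v v' x = normal_density m (sqrt v') x / normal_density m (sqrt v) x"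

lemma normal_ratio_nonneg: "0 \<le> normal_ratio m v v' x"
  by (simp add: normal_ratio_def)

lemma borel_measurable_normal_ratio[measurable]: "normal_ratio m v v' \<in> borel_measurable borel"
  unfolding normal_ratio_def[abs_def] by measurable

lemma normal_law_ratio:
  assumes v: "0 < v"
  shows "density (normal_law m v) (\<lambda>x. ennreal (normal_ratio m v v' x)) = normal_law m v'"
proof -
  have "normal_density m (sqrt v) x * normal_ratio m v v' x = normal_density m (sqrt v') x" for x
    using normal_density_pos[of "sqrt v" m x] v by (simp add: normal_ratio_def)
  then show ?thesis
    by (subst density_density_eq) (auto simp: ennreal_mult[symmetric] normal_ratio_nonneg)
qed

text \<open>The squared new density divided by the old one is a multiple of a third Gaussian density
  as long as its precision stays positive; that is where \<open>b < 1\<close> enters. The second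
  moment is one plus the chi-square divergence of the two laws.\<close>

lemma normal_ratio_moments:
  assumes v: "0 < v" and b: "0 \<le> b" "b < 1"
  shows "integrable (normal_law m v) (normal_ratio m v (v * (1 + b)))"
    and "(\<integral>x. normal_ratio m v (v * (1 + b)) x \<partial>normal_law m v) = 1"
    and "integrable (normal_law m v) (\<lambda>x. (normal_ratio m v (v * (1 + b)) x)\<^sup>2)"
    and "(\<integral>x. (normal_ratio m v (v * (1 + b)) x)\<^sup>2 \<partial>normal_law m v) = 1 / sqrt (1 - b\<^sup>2)"
proof -
  let ?r = "normal_ratio m v (v * (1 + b))"
  have v': "0 < v * (1 + b)" using v b by simp
  have 1: "normal_density m (sqrt v) x * ?r x = normal_density m (sqrt (v * (1 + b))) x" for x
    using normal_density_pos[of "sqrt v" m x] v by (simp add: normal_ratio_def)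
  show "integrable (normal_law m v) ?r"
    using v' by (subst integrable_density) (auto simp: 1)
  show "(\<integral>x. ?r x \<partial>normal_law m v) = 1"
    using v' by (subst integral_density) (auto simp: 1)
  \<comment> \<open>The remaining precision: 1/w = 2/(v (1 + b)) - 1/v.\<close>
  define w where "w = v * (1 + b) / (1 - b)"
  have w: "0 < w" using v b by (simp add: w_def)
  have b2: "0 < 1 - b\<^sup>2" using b by (simp add: power_less_one_iff abs_square_less_1)
  have 2: "normal_density m (sqrt v) x * (?r x)\<^sup>2 = normal_density m (sqrt w) x * (1 / sqrt (1 - b\<^sup>2))" for x
  proof -
    have "normal_density m (sqrt v) x * (?r x)\<^sup>2
        = (normal_density m (sqrt (v * (1 + b))) x)\<^sup>2 / normal_density m (sqrt v) x"
      using normal_density_pos[of "sqrt v" m x] v by (simp add: normal_ratio_def power2_eq_square)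
    also have "\<dots> = (exp (- (x - m)\<^sup>2 / (2 * (v * (1 + b)))))\<^sup>2 / exp (- (x - m)\<^sup>2 / (2 * v))
        * (sqrt (2 * pi * v) / (sqrt (2 * pi * (v * (1 + b))))\<^sup>2)"
      unfolding normal_density_sqrt[OF v] normal_density_sqrt[OF v'] by (simp add: field_simps)
    also have "(exp (- (x - m)\<^sup>2 / (2 * (v * (1 + b)))))\<^sup>2 / exp (- (x - m)\<^sup>2 / (2 * v))
        = exp (- (x - m)\<^sup>2 / (2 * w))"
    proof -
      have "2 * (- (x - m)\<^sup>2 / (2 * (v * (1 + b)))) - - (x - m)\<^sup>2 / (2 * v) = - (x - m)\<^sup>2 / (2 * w)"
        using v b by (simp add: w_def divide_simps) (simp add: algebra_simps)
      then show ?thesis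
        by (simp only: exp_double[symmetric] exp_diff[symmetric])
    qed
    also have "sqrt (2 * pi * v) / (sqrt (2 * pi * (v * (1 + b))))\<^sup>2
        = 1 / sqrt (2 * pi * w) * (1 / sqrt (1 - b\<^sup>2))"
    proof (rule power2_eq_imp_eq)
      show "(sqrt (2 * pi * v) / (sqrt (2 * pi * (v * (1 + b))))\<^sup>2)\<^sup>2
          = (1 / sqrt (2 * pi * w) * (1 / sqrt (1 - b\<^sup>2)))\<^sup>2"
        using v b w b2 v' unfolding power_mult_distrib power_divide
        by (simp add: w_def divide_simps) (simp add: algebra_simps power2_eq_square)
    qed (use v b w b2 in auto)
    finally show ?thesis
      unfolding normal_density_sqrt[OF w] by simp
  qed
  show "integrable (normal_law m v) (\<lambda>x. (?r x)\<^sup>2)"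
    using w by (subst integrable_density) (auto simp: 2)
  show "(\<integral>x. (?r x)\<^sup>2 \<partial>normal_law m v) = 1 / sqrt (1 - b\<^sup>2)"
    using w by (subst integral_density) (auto simp: 2)
qed

text \<open>The two new variables are jointly Gaussian with covariance s - (\<alpha> s)/\<alpha> =
  0, hence independent. On densities: at fixed b the variable a is shifted to u = a + b, then at
  fixed u the variable b is replaced by v. Nonnegative integrands allow every exchange of
  integrals.\<close>

lemma normal_law_rotate:
  fixes f :: "real \<times> real \<Rightarrow> ennreal"
  assumes s: "0 < s" and \<alpha>: "0 < \<alpha>" and f[measurable]: "f \<in> borel_measurable (borel \<Otimes>\<^sub>M borel)"
  shows "(\<integral>\<^sup>+a. \<integral>\<^sup>+b. f (a + b, a - b / \<alpha>) \<partial>normal_law 0 (\<alpha> * s) \<partial>normal_law m s)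
    = (\<integral>\<^sup>+u. \<integral>\<^sup>+v. f (u, v) \<partial>normal_law m ((1 + 1 / \<alpha>) * s) \<partial>normal_law m ((1 + \<alpha>) * s))"
proof -
  let ?\<phi> = "\<lambda>m v x. ennreal (normal_density m (sqrt v) x)"
  \<comment> \<open>At fixed u the equation v = u - b - b/\<alpha> is solved by b = k u - k v, so
    \<open>k\<close> is the Jacobian of the second substitution.\<close>
  define k where "k = \<alpha> / (1 + \<alpha>)"
  have k: "0 < k" and k1: "k * (1 + \<alpha>) = \<alpha>" using \<alpha> by (simp_all add: k_def)
  have as: "0 < \<alpha> * s" and t: "0 < (1 + 1 / \<alpha>) * s" and \<tau>: "0 < (1 + \<alpha>) * s"
    using s \<alpha> by (simp_all add: add_pos_pos)
  have id: "k * (normal_density m (sqrt s) (u - (k * u + - k * v)) * normal_density 0 (sqrt (\<alpha> * s)) (k * u + - k * v))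
      = normal_density m (sqrt ((1 + \<alpha>) * s)) u * normal_density m (sqrt ((1 + 1 / \<alpha>) * s)) v" for u v
  proof -
    have e: "- (u - (k * u + - k * v) - m)\<^sup>2 / (2 * s) + - (k * u + - k * v - 0)\<^sup>2 / (2 * (\<alpha> * s))
        = - (u - m)\<^sup>2 / (2 * ((1 + \<alpha>) * s)) + - (v - m)\<^sup>2 / (2 * ((1 + 1 / \<alpha>) * s))"
    proof -
      define a b where "a = u - m" and "b = v - m"
      have "(u - (k * u + - k * v) - m) * (1 + \<alpha>) = (u - m) * (1 + \<alpha>) - (u - v) * (k * (1 + \<alpha>))"
        "(k * u + - k * v - 0) * (1 + \<alpha>) = (u - v) * (k * (1 + \<alpha>))"
        by (simp_all add: algebra_simps)
      then have "(u - (k * u + - k * v) - m) * (1 + \<alpha>) = a + \<alpha> * b"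
        "(k * u + - k * v - 0) * (1 + \<alpha>) = \<alpha> * (a - b)"
        unfolding k1 by (simp_all add: a_def b_def algebra_simps)
      then have "u - (k * u + - k * v) - m = (a + \<alpha> * b) / (1 + \<alpha>)" "k * u + - k * v - 0 = \<alpha> * (a - b) / (1 + \<alpha>)"
        using \<alpha> by (simp_all only: eq_divide_eq) auto
      moreover have "- ((a + \<alpha> * b) / (1 + \<alpha>))\<^sup>2 / (2 * s) + - (\<alpha> * (a - b) / (1 + \<alpha>))\<^sup>2 / (2 * (\<alpha> * s))
          = - a\<^sup>2 / (2 * ((1 + \<alpha>) * s)) + - b\<^sup>2 / (2 * ((1 + 1 / \<alpha>) * s))"
      proof -
        \<comment> \<open>The mixed terms in a b cancel. This is the independence of u and v at the
          level of exponents.\<close>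
        have "(a + \<alpha> * b)\<^sup>2 + \<alpha> * (a - b)\<^sup>2 = (1 + \<alpha>) * a\<^sup>2 + \<alpha> * (1 + \<alpha>) * b\<^sup>2"
          by (simp add: power2_eq_square algebra_simps)
        have "- ((a + \<alpha> * b) / (1 + \<alpha>))\<^sup>2 / (2 * s) + - (\<alpha> * (a - b) / (1 + \<alpha>))\<^sup>2 / (2 * (\<alpha> * s))
            = - ((a + \<alpha> * b)\<^sup>2 + \<alpha> * (a - b)\<^sup>2) / ((1 + \<alpha>)\<^sup>2 * (2 * s))"
        proof -
          have "- (\<alpha> * (a - b) / (1 + \<alpha>))\<^sup>2 / (2 * (\<alpha> * s)) = - (\<alpha> * (a - b)\<^sup>2) / ((1 + \<alpha>)\<^sup>2 * (2 * s))"
            using \<alpha> by (simp add: power_divide power_mult_distrib power2_eq_square ac_simps)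
          moreover have "- ((a + \<alpha> * b) / (1 + \<alpha>))\<^sup>2 / (2 * s) = - (a + \<alpha> * b)\<^sup>2 / ((1 + \<alpha>)\<^sup>2 * (2 * s))"
            by (simp add: power_divide)
          ultimately show ?thesis
            by (simp only: add_divide_distrib[symmetric]) simp
        qed
        also have "\<dots> = - ((1 + \<alpha>) * a\<^sup>2 + \<alpha> * (1 + \<alpha>) * b\<^sup>2) / ((1 + \<alpha>)\<^sup>2 * (2 * s))"
          by (simp only: \<open>(a + \<alpha> * b)\<^sup>2 + \<alpha> * (a - b)\<^sup>2 = _\<close>)
        also have "\<dots> = - (a\<^sup>2 + \<alpha> * b\<^sup>2) / ((1 + \<alpha>) * (2 * s))"
        proof -
          have e1: "- ((1 + \<alpha>) * a\<^sup>2 + \<alpha> * (1 + \<alpha>) * b\<^sup>2) = (1 + \<alpha>) * - (a\<^sup>2 + \<alpha> * b\<^sup>2)"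
            and e2: "(1 + \<alpha>)\<^sup>2 * (2 * s) = (1 + \<alpha>) * ((1 + \<alpha>) * (2 * s))"
            by (simp_all add: power2_eq_square algebra_simps)
          show ?thesis
            unfolding e1 e2 using \<alpha> by (intro mult_divide_mult_cancel_left) simp
        qed
        also have "\<dots> = - a\<^sup>2 / (2 * ((1 + \<alpha>) * s)) + - (\<alpha> * b\<^sup>2) / (2 * ((1 + \<alpha>) * s))"
          by (simp add: add_divide_distrib[symmetric] algebra_simps)
        also have "- (\<alpha> * b\<^sup>2) / (2 * ((1 + \<alpha>) * s)) = - b\<^sup>2 / (2 * ((1 + 1 / \<alpha>) * s))"
          using s \<alpha> by (simp add: divide_simps)
        finally show ?thesis .
      qed
      ultimately show ?thesis by (simp only: a_def b_def)
    qed
    have c: "k * (1 / sqrt (2 * pi * s) * (1 / sqrt (2 * pi * (\<alpha> * s))))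
        = 1 / sqrt (2 * pi * ((1 + \<alpha>) * s)) * (1 / sqrt (2 * pi * ((1 + 1 / \<alpha>) * s)))"
    proof (rule power2_eq_imp_eq)
      show "(k * (1 / sqrt (2 * pi * s) * (1 / sqrt (2 * pi * (\<alpha> * s)))))\<^sup>2
        = (1 / sqrt (2 * pi * ((1 + \<alpha>) * s)) * (1 / sqrt (2 * pi * ((1 + 1 / \<alpha>) * s))))\<^sup>2"
        using s \<alpha> as t \<tau> unfolding power_mult_distrib power_divide
        by (simp add: k_def divide_simps) (simp add: algebra_simps power2_eq_square)
    qed (use s \<alpha> k t \<tau> as in auto)
    have "k * (exp (- (u - (k * u + - k * v) - m)\<^sup>2 / (2 * s)) / sqrt (2 * pi * s)
          * (exp (- (k * u + - k * v - 0)\<^sup>2 / (2 * (\<alpha> * s))) / sqrt (2 * pi * (\<alpha> * s))))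
        = exp (- (u - (k * u + - k * v) - m)\<^sup>2 / (2 * s) + - (k * u + - k * v - 0)\<^sup>2 / (2 * (\<alpha> * s)))
          * (k * (1 / sqrt (2 * pi * s) * (1 / sqrt (2 * pi * (\<alpha> * s)))))"
      unfolding exp_add by simp
    then show ?thesis
      unfolding normal_density_sqrt[OF s] normal_density_sqrt[OF as] normal_density_sqrt[OF t]
        normal_density_sqrt[OF \<tau>] e c exp_add by simp
  qed
  have "(\<integral>\<^sup>+a. \<integral>\<^sup>+b. f (a + b, a - b / \<alpha>) \<partial>normal_law 0 (\<alpha> * s) \<partial>normal_law m s)
      = (\<integral>\<^sup>+a. \<integral>\<^sup>+b. ?\<phi> m s a * (?\<phi> 0 (\<alpha> * s) b * f (a + b, a - b / \<alpha>)) \<partial>lborel \<partial>lborel)"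
    by (simp add: nn_integral_density nn_integral_cmult)
  also have "\<dots> = (\<integral>\<^sup>+b. \<integral>\<^sup>+a. ?\<phi> m s a * (?\<phi> 0 (\<alpha> * s) b * f (a + b, a - b / \<alpha>)) \<partial>lborel \<partial>lborel)"
    by (rule lborel_pair.Fubini') measurable
  also have "\<dots> = (\<integral>\<^sup>+b. \<integral>\<^sup>+u. ?\<phi> m s (u - b) * (?\<phi> 0 (\<alpha> * s) b * f (u, u - b - b / \<alpha>)) \<partial>lborel \<partial>lborel)"
  proof (rule nn_integral_cong)
    fix b :: real
    show "(\<integral>\<^sup>+a. ?\<phi> m s a * (?\<phi> 0 (\<alpha> * s) b * f (a + b, a - b / \<alpha>)) \<partial>lborel)
      = (\<integral>\<^sup>+u. ?\<phi> m s (u - b) * (?\<phi> 0 (\<alpha> * s) b * f (u, u - b - b / \<alpha>)) \<partial>lborel)"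
      by (subst nn_integral_real_affine[where c = 1 and t = "- b"])
         (auto intro!: nn_integral_cong arg_cong2[where f = "(*)"] arg_cong[where f = f] arg_cong[where f = ennreal])
  qed
  also have "\<dots> = (\<integral>\<^sup>+u. \<integral>\<^sup>+b. ?\<phi> m s (u - b) * (?\<phi> 0 (\<alpha> * s) b * f (u, u - b - b / \<alpha>)) \<partial>lborel \<partial>lborel)"
    by (rule lborel_pair.Fubini'[symmetric]) measurable
  also have "\<dots> = (\<integral>\<^sup>+u. \<integral>\<^sup>+v. ?\<phi> m ((1 + \<alpha>) * s) u * (?\<phi> m ((1 + 1 / \<alpha>) * s) v * f (u, v)) \<partial>lborel \<partial>lborel)"
  proof (rule nn_integral_cong)
    fix u :: real
    have "(\<integral>\<^sup>+b. ?\<phi> m s (u - b) * (?\<phi> 0 (\<alpha> * s) b * f (u, u - b - b / \<alpha>)) \<partial>lborel)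
      = ennreal \<bar>- k\<bar> * (\<integral>\<^sup>+v. ?\<phi> m s (u - (k * u + - k * v)) * (?\<phi> 0 (\<alpha> * s) (k * u + - k * v)
          * f (u, u - (k * u + - k * v) - (k * u + - k * v) / \<alpha>)) \<partial>lborel)"
      using k by (subst nn_integral_real_affine[where c = "- k" and t = "k * u"]) auto
    also have "\<dots> = (\<integral>\<^sup>+v. ennreal k * (?\<phi> m s (u - (k * u + - k * v)) * (?\<phi> 0 (\<alpha> * s) (k * u + - k * v)
          * f (u, v))) \<partial>lborel)"
    proof -
      have "u - (k * u + - k * v) - (k * u + - k * v) / \<alpha> = v" for v
        using \<alpha> by (simp add: k_def divide_simps) (simp add: algebra_simps)
      then show ?thesis using k by (simp add: nn_integral_cmult)
    qed
    also have "\<dots> = (\<integral>\<^sup>+v. ?\<phi> m ((1 + \<alpha>) * s) u * (?\<phi> m ((1 + 1 / \<alpha>) * s) v * f (u, v)) \<partial>lborel)"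
    proof (rule nn_integral_cong)
      fix v :: real
      have "ennreal k * (?\<phi> m s (u - (k * u + - k * v)) * ?\<phi> 0 (\<alpha> * s) (k * u + - k * v))
          = ?\<phi> m ((1 + \<alpha>) * s) u * ?\<phi> m ((1 + 1 / \<alpha>) * s) v"
        using id[of u v] k by (simp add: ennreal_mult[symmetric])
      then show "ennreal k * (?\<phi> m s (u - (k * u + - k * v)) * (?\<phi> 0 (\<alpha> * s) (k * u + - k * v) * f (u, v)))
          = ?\<phi> m ((1 + \<alpha>) * s) u * (?\<phi> m ((1 + 1 / \<alpha>) * s) v * f (u, v))"
        by (simp only: mult.assoc[symmetric])
    qed
    finally show "(\<integral>\<^sup>+b. ?\<phi> m s (u - b) * (?\<phi> 0 (\<alpha> * s) b * f (u, u - b - b / \<alpha>)) \<partial>lborel)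
      = (\<integral>\<^sup>+v. ?\<phi> m ((1 + \<alpha>) * s) u * (?\<phi> m ((1 + 1 / \<alpha>) * s) v * f (u, v)) \<partial>lborel)" .
  qed
  also have "\<dots> = (\<integral>\<^sup>+u. \<integral>\<^sup>+v. f (u, v) \<partial>normal_law m ((1 + 1 / \<alpha>) * s) \<partial>normal_law m ((1 + \<alpha>) * s))"
    by (simp add: nn_integral_density nn_integral_cmult)
  finally show ?thesis .
qed

subsection \<open>Products of normal distributions\<close>

lemma sets_PiM_normal_law[measurable_cong]:
  "sets (Pi\<^sub>M I (\<lambda>i. normal_law (m i) (v i))) = sets (Pi\<^sub>M I (\<lambda>_. borel))"
  by (rule sets_PiM_cong) auto

lemma product_sigma_finite_normal_law: "0 < v \<Longrightarrow> product_sigma_finite (\<lambda>i. normal_law (m i) v)"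
  by (rule product_sigma_finite.intro) (intro prob_space_imp_sigma_finite prob_space_normal_law)

text \<open>The rotation acts on each coordinate separately, so induction splits off one coordinate,
  treats it by the one-dimensional lemma and the others by the induction hypothesis. Iterated
  nonnegative integrals keep Tonelli's theorem free of integrability conditions.\<close>

lemma PiM_normal_law_rotate:
  fixes f :: "('i \<Rightarrow> real) \<times> ('i \<Rightarrow> real) \<Rightarrow> ennreal"
  assumes "finite I" and s: "0 < s" and \<alpha>: "0 < \<alpha>"
    and "f \<in> borel_measurable (Pi\<^sub>M I (\<lambda>_. borel) \<Otimes>\<^sub>M Pi\<^sub>M I (\<lambda>_. borel))"
  shows "(\<integral>\<^sup>+y. \<integral>\<^sup>+w. f (\<lambda>i\<in>I. y i + w i, \<lambda>i\<in>I. y i - w i / \<alpha>)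
        \<partial>Pi\<^sub>M I (\<lambda>i. normal_law 0 (\<alpha> * s)) \<partial>Pi\<^sub>M I (\<lambda>i. normal_law (m i) s))
    = (\<integral>\<^sup>+u. \<integral>\<^sup>+v. f (u, v) \<partial>Pi\<^sub>M I (\<lambda>i. normal_law (m i) ((1 + 1 / \<alpha>) * s))
        \<partial>Pi\<^sub>M I (\<lambda>i. normal_law (m i) ((1 + \<alpha>) * s)))"
  using assms(1,4)
proof (induction I arbitrary: f rule: finite_induct)
  case empty
  then show ?case by (simp add: PiM_empty nn_integral_count_space_finite)
next
  case (insert i I)
  note [simp] = insert.hyps
  note [measurable] = insert.prems
  let ?B = "\<lambda>I. Pi\<^sub>M I (\<lambda>_. borel) :: ('i \<Rightarrow> real) measure"
  let ?P = "\<lambda>I. Pi\<^sub>M I (\<lambda>i. normal_law (m i) s)"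
  let ?W = "\<lambda>I. Pi\<^sub>M I (\<lambda>i::'i. normal_law 0 (\<alpha> * s))"
  let ?U = "\<lambda>I. Pi\<^sub>M I (\<lambda>i. normal_law (m i) ((1 + \<alpha>) * s))"
  let ?V = "\<lambda>I. Pi\<^sub>M I (\<lambda>i. normal_law (m i) ((1 + 1 / \<alpha>) * s))"
  have as: "0 < \<alpha> * s" and t: "0 < (1 + 1 / \<alpha>) * s" and \<tau>: "0 < (1 + \<alpha>) * s"
    using s \<alpha> by (simp_all add: add_pos_pos)
  interpret P: product_sigma_finite "\<lambda>i. normal_law (m i) s" by (rule product_sigma_finite_normal_law[OF s])
  interpret W: product_sigma_finite "\<lambda>i::'i. normal_law 0 (\<alpha> * s)" by (rule product_sigma_finite_normal_law[OF as])
  interpret U: product_sigma_finite "\<lambda>i. normal_law (m i) ((1 + \<alpha>) * s)" by (rule product_sigma_finite_normal_law[OF \<tau>])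
  interpret V: product_sigma_finite "\<lambda>i. normal_law (m i) ((1 + 1 / \<alpha>) * s)" by (rule product_sigma_finite_normal_law[OF t])
  have sf: "sigma_finite_measure (?P I)" "sigma_finite_measure (?W I)" "sigma_finite_measure (?U I)" "sigma_finite_measure (?V I)"
    by (rule P.sigma_finite W.sigma_finite U.sigma_finite V.sigma_finite; simp)+
  \<comment> \<open>\<open>h\<close> is \<open>f\<close> with the coordinate \<open>i\<close> of
    both vectors separated from the rest.\<close>
  define h where "h = (\<lambda>q. f ((fst (snd q))(i := fst (fst q)), (snd (snd q))(i := snd (fst q))))"
  have h[measurable]: "h \<in> borel_measurable ((borel \<Otimes>\<^sub>M borel) \<Otimes>\<^sub>M (?B I \<Otimes>\<^sub>M ?B I))"
  proof -
    have "(\<lambda>q. ((fst (snd q))(i := fst (fst q)), (snd (snd q))(i := snd (fst q))))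
      \<in> measurable ((borel \<Otimes>\<^sub>M borel) \<Otimes>\<^sub>M (?B I \<Otimes>\<^sub>M ?B I)) (?B (insert i I) \<Otimes>\<^sub>M ?B (insert i I))"
      by (intro measurable_Pair measurable_fun_upd[where J = I and M = "\<lambda>_. borel"]) auto
    then show ?thesis unfolding h_def by measurable
  qed
  have sums[measurable]: "(\<lambda>p. \<lambda>i\<in>J. fst p i + snd p i) \<in> measurable (?B J \<Otimes>\<^sub>M ?B J) (?B J)"
    "(\<lambda>p. \<lambda>i\<in>J. fst p i - snd p i / \<alpha>) \<in> measurable (?B J \<Otimes>\<^sub>M ?B J) (?B J)" for J
    by (intro measurable_restrict; measurable)+
  have F[measurable]: "(\<lambda>p. f (\<lambda>j\<in>insert i I. fst p j + snd p j, \<lambda>j\<in>insert i I. fst p j - snd p j / \<alpha>))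
      \<in> borel_measurable (?B (insert i I) \<Otimes>\<^sub>M ?B (insert i I))"
    by (rule measurable_compose[OF _ insert.prems]) measurable
  define g where "g = (\<lambda>c d. \<integral>\<^sup>+u. \<integral>\<^sup>+v. h ((c, d), (u, v)) \<partial>?V I \<partial>?U I)"
  have eq: "f (\<lambda>j\<in>insert i I. (y(i := a)) j + (w(i := b)) j, \<lambda>j\<in>insert i I. (y(i := a)) j - (w(i := b)) j / \<alpha>)
      = h ((a + b, a - b / \<alpha>), (\<lambda>j\<in>I. y j + w j, \<lambda>j\<in>I. y j - w j / \<alpha>))" for y w a b
    unfolding h_def by (auto intro!: arg_cong[where f = f])
  have "(\<integral>\<^sup>+y. \<integral>\<^sup>+w. f (\<lambda>j\<in>insert i I. y j + w j, \<lambda>j\<in>insert i I. y j - w j / \<alpha>) \<partial>?W (insert i I) \<partial>?P (insert i I))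
    = (\<integral>\<^sup>+a. \<integral>\<^sup>+y. \<integral>\<^sup>+b. \<integral>\<^sup>+w. h ((a + b, a - b / \<alpha>), (\<lambda>j\<in>I. y j + w j, \<lambda>j\<in>I. y j - w j / \<alpha>))
        \<partial>?W I \<partial>normal_law 0 (\<alpha> * s) \<partial>?P I \<partial>normal_law (m i) s)"
  proof (subst P.product_nn_integral_insert_rev, goal_cases)
    case 3
    interpret sigma_finite_measure "?W (insert i I)" by (rule W.sigma_finite) simp
    show ?case
      using F by (intro borel_measurable_nn_integral)
        (simp add: split_beta' measurable_cong_sets[OF sets_pair_measure_cong[OF sets_PiM_normal_law sets_PiM_normal_law] refl])
  next
    case 4
    show ?case
    proof (intro nn_integral_cong, subst W.product_nn_integral_insert_rev, goal_cases)
      case (3 a y)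
      have "y(i := a) \<in> space (?B (insert i I))"
        using 3 by (auto simp: space_PiM PiE_iff extensional_def)
      then show ?case by measurable
    next
      case (4 a y)
      show ?case unfolding eq ..
    qed simp_all
  qed simp_all
  \<comment> \<open>Both integrals over the coordinate \<open>i\<close> are moved outside, so that
    the induction hypothesis applies to the inner pair; the same exchange is undone after the
    rotation.\<close>
  also have "\<dots> = (\<integral>\<^sup>+a. \<integral>\<^sup>+b. \<integral>\<^sup>+y. \<integral>\<^sup>+w. h ((a + b, a - b / \<alpha>), (\<lambda>j\<in>I. y j + w j, \<lambda>j\<in>I. y j - w j / \<alpha>))
        \<partial>?W I \<partial>?P I \<partial>normal_law 0 (\<alpha> * s) \<partial>normal_law (m i) s)"
  proof (rule nn_integral_cong)
    fix a
    interpret pair_sigma_finite "normal_law 0 (\<alpha> * s)" "?P I"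
      by (intro pair_sigma_finite.intro sf prob_space_imp_sigma_finite prob_space_normal_law as)
    interpret W': sigma_finite_measure "?W I" by (rule sf)
    show "(\<integral>\<^sup>+y. \<integral>\<^sup>+b. \<integral>\<^sup>+w. h ((a + b, a - b / \<alpha>), (\<lambda>j\<in>I. y j + w j, \<lambda>j\<in>I. y j - w j / \<alpha>))
        \<partial>?W I \<partial>normal_law 0 (\<alpha> * s) \<partial>?P I)
      = (\<integral>\<^sup>+b. \<integral>\<^sup>+y. \<integral>\<^sup>+w. h ((a + b, a - b / \<alpha>), (\<lambda>j\<in>I. y j + w j, \<lambda>j\<in>I. y j - w j / \<alpha>))
        \<partial>?W I \<partial>?P I \<partial>normal_law 0 (\<alpha> * s))"
      by (rule Fubini') measurable
  qed
  also have "\<dots> = (\<integral>\<^sup>+a. \<integral>\<^sup>+b. g (a + b) (a - b / \<alpha>) \<partial>normal_law 0 (\<alpha> * s) \<partial>normal_law (m i) s)"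
    unfolding g_def
  proof (intro nn_integral_cong)
    fix a b :: real
    show "(\<integral>\<^sup>+y. \<integral>\<^sup>+w. h ((a + b, a - b / \<alpha>), (\<lambda>j\<in>I. y j + w j, \<lambda>j\<in>I. y j - w j / \<alpha>)) \<partial>?W I \<partial>?P I)
      = (\<integral>\<^sup>+u. \<integral>\<^sup>+v. h ((a + b, a - b / \<alpha>), (u, v)) \<partial>?V I \<partial>?U I)"
      by (rule insert.IH[of "\<lambda>p. h ((a + b, a - b / \<alpha>), p)"]) measurable
  qed
  also have "\<dots> = (\<integral>\<^sup>+c. \<integral>\<^sup>+d. g c d \<partial>normal_law (m i) ((1 + 1 / \<alpha>) * s) \<partial>normal_law (m i) ((1 + \<alpha>) * s))"
  proof -
    interpret U': sigma_finite_measure "?U I" by (rule sf)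
    interpret V': sigma_finite_measure "?V I" by (rule sf)
    have "(\<lambda>p. g (fst p) (snd p)) \<in> borel_measurable (borel \<Otimes>\<^sub>M borel)"
      unfolding g_def by measurable
    from normal_law_rotate[OF s \<alpha> this] show ?thesis by simp
  qed
  also have "\<dots> = (\<integral>\<^sup>+c. \<integral>\<^sup>+u. \<integral>\<^sup>+d. \<integral>\<^sup>+v. h ((c, d), (u, v)) \<partial>?V I
      \<partial>normal_law (m i) ((1 + 1 / \<alpha>) * s) \<partial>?U I \<partial>normal_law (m i) ((1 + \<alpha>) * s))"
    unfolding g_def
  proof (rule nn_integral_cong)
    fix c
    interpret pair_sigma_finite "?U I" "normal_law (m i) ((1 + 1 / \<alpha>) * s)"
      by (intro pair_sigma_finite.intro sf prob_space_imp_sigma_finite prob_space_normal_law t)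
    interpret V': sigma_finite_measure "?V I" by (rule sf)
    show "(\<integral>\<^sup>+d. \<integral>\<^sup>+u. \<integral>\<^sup>+v. h ((c, d), (u, v)) \<partial>?V I \<partial>?U I \<partial>normal_law (m i) ((1 + 1 / \<alpha>) * s))
      = (\<integral>\<^sup>+u. \<integral>\<^sup>+d. \<integral>\<^sup>+v. h ((c, d), (u, v)) \<partial>?V I \<partial>normal_law (m i) ((1 + 1 / \<alpha>) * s) \<partial>?U I)"
      by (rule Fubini') measurable
  qed
  also have "\<dots> = (\<integral>\<^sup>+u. \<integral>\<^sup>+v. f (u, v) \<partial>?V (insert i I) \<partial>?U (insert i I))"
  proof (rule sym, subst U.product_nn_integral_insert_rev, goal_cases)
    case 3
    interpret sigma_finite_measure "?V (insert i I)" by (rule V.sigma_finite) simp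
    show ?case by measurable
  next
    case 4
    show ?case
    proof (intro nn_integral_cong, subst V.product_nn_integral_insert_rev, goal_cases)
      case (3 a y)
      have "y(i := a) \<in> space (?B (insert i I))"
        using 3 by (auto simp: space_PiM PiE_iff extensional_def)
      then show ?case by measurable
    next
      case (4 a y)
      show ?case by (simp add: h_def)
    qed simp_all
  qed simp_all
  finally show ?case .
qed

section \<open>Moments of linear and quadratic forms in a Gaussian vector\<close>

lemma integral_double_sum:
  fixes f :: "nat \<Rightarrow> nat \<Rightarrow> 'a \<Rightarrow> real"
  assumes f: "\<And>i j. i < n \<Longrightarrow> j < n \<Longrightarrow> integrable M (f i j)"
  shows "integrable M (\<lambda>x. \<Sum>i<n. \<Sum>j<n. f i j x)"
    and "(\<integral>x. (\<Sum>i<n. \<Sum>j<n. f i j x) \<partial>M) = (\<Sum>i<n. \<Sum>j<n. \<integral>x. f i j x \<partial>M)"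
proof -
  have 1: "integrable M (\<lambda>x. \<Sum>j<n. f i j x)" if "i < n" for i
    by (rule Bochner_Integration.integrable_sum, rule f) (use that in auto)
  show "integrable M (\<lambda>x. \<Sum>i<n. \<Sum>j<n. f i j x)"
    by (rule Bochner_Integration.integrable_sum, rule 1) simp
  have "(\<integral>x. (\<Sum>i<n. \<Sum>j<n. f i j x) \<partial>M) = (\<Sum>i<n. \<integral>x. (\<Sum>j<n. f i j x) \<partial>M)"
    by (rule Bochner_Integration.integral_sum, rule 1) simp
  also have "\<dots> = (\<Sum>i<n. \<Sum>j<n. \<integral>x. f i j x \<partial>M)"
    using f by (intro sum.cong refl Bochner_Integration.integral_sum) auto
  finally show "(\<integral>x. (\<Sum>i<n. \<Sum>j<n. f i j x) \<partial>M) = (\<Sum>i<n. \<Sum>j<n. \<integral>x. f i j x \<partial>M)" .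
qed

text \<open>Each integrand is a product over all coordinates with the constant 1 in the remaining
  places, so its integral factorises; for distinct indices a factor of mean 0 appears. It is applied
  to x - m for linear and quadratic forms and to (x - m)^2 - v for the squared norm.\<close>

lemma PiM_centred_products:
  fixes f :: "'i \<Rightarrow> 'a \<Rightarrow> real"
  assumes I: "finite I" and M: "\<And>i. prob_space (M i)"
    and f: "\<And>i. i \<in> I \<Longrightarrow> integrable (M i) (f i)"
    and z: "\<And>i. i \<in> I \<Longrightarrow> (\<integral>x. f i x \<partial>M i) = 0"
    and q: "\<And>i. i \<in> I \<Longrightarrow> integrable (M i) (\<lambda>x. (f i x)\<^sup>2)"
    and ij: "i \<in> I" "j \<in> I"
  shows "integrable (Pi\<^sub>M I M) (\<lambda>x. f i (x i))" (is ?m1)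
    and "(\<integral>x. f i (x i) \<partial>Pi\<^sub>M I M) = 0" (is ?m2)
    and "integrable (Pi\<^sub>M I M) (\<lambda>x. f i (x i) * f j (x j))" (is ?c1)
    and "(\<integral>x. f i (x i) * f j (x j) \<partial>Pi\<^sub>M I M) = (if i = j then \<integral>x. (f i x)\<^sup>2 \<partial>M i else 0)" (is ?c2)
proof -
  interpret product_prob_space M I
    by (rule product_prob_spaceI) (rule M)
  have one: "integrable (M k) (\<lambda>_. 1 :: real)" "(\<integral>x. 1 \<partial>M k) = (1::real)" for k
    using prob_space.prob_space[OF M, of k] finite_measure.integrable_const[OF prob_space.finite_measure[OF M], of k "1::real"]
    by simp_all
  have single: "integrable (Pi\<^sub>M I M) (\<lambda>x. g (x i))" "(\<integral>x. g (x i) \<partial>Pi\<^sub>M I M) = (\<integral>x. g x \<partial>M i)"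
    if "integrable (M i) g" for g :: "'a \<Rightarrow> real"
  proof -
    have e: "(\<Prod>k\<in>I. (if k = i then g else (\<lambda>_. 1)) (x k)) = g (x i)" for x
    proof -
      have "(\<Prod>k\<in>I. (if k = i then g else (\<lambda>_. 1)) (x k)) = (\<Prod>k\<in>I. if k = i then g (x k) else 1)"
        by (intro prod.cong) auto
      also have "\<dots> = g (x i)" using I ij(1) by (subst prod.delta) auto
      finally show ?thesis .
    qed
    show "integrable (Pi\<^sub>M I M) (\<lambda>x. g (x i))"
      using product_integrable_prod[of I "\<lambda>k. if k = i then g else (\<lambda>_. 1)"] I that one unfolding e by auto
    have "(\<integral>x. g (x i) \<partial>Pi\<^sub>M I M) = (\<Prod>k\<in>I. integral\<^sup>L (M k) (if k = i then g else (\<lambda>_. 1)))"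
      using product_integral_prod[of I "\<lambda>k. if k = i then g else (\<lambda>_. 1)"] I that one unfolding e by auto
    also have "\<dots> = (\<Prod>k\<in>I. if k = i then \<integral>x. g x \<partial>M k else 1)"
      using one by (intro prod.cong) auto
    also have "\<dots> = (\<integral>x. g x \<partial>M i)"
      using I ij(1) by (subst prod.delta) auto
    finally show "(\<integral>x. g (x i) \<partial>Pi\<^sub>M I M) = (\<integral>x. g x \<partial>M i)" .
  qed
  show ?m1 ?m2 using single[OF f[OF ij(1)]] z[OF ij(1)] by auto
  show ?c1 ?c2
  proof -
    have "?c1 \<and> ?c2"
    proof (cases "i = j")
      case True
      then show ?thesis using single[OF q[OF ij(1)]] by (simp add: power2_eq_square)
    next
      case False
      let ?F = "\<lambda>k. if k = i then f i else if k = j then f j else (\<lambda>_. 1)"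
      have e: "(\<Prod>k\<in>I. ?F k (x k)) = f i (x i) * f j (x j)" for x
      proof -
        have "(\<Prod>k\<in>I. ?F k (x k))
            = (\<Prod>k\<in>I. (if k = i then f k (x k) else 1) * (if k = j then f k (x k) else 1))"
          using False by (intro prod.cong) auto
        also have "\<dots> = f i (x i) * f j (x j)"
          unfolding prod.distrib using I ij by (simp add: prod.delta)
        finally show ?thesis .
      qed
      have F: "integrable (M k) (?F k)" if "k \<in> I" for k using that f ij one by auto
      have 1: ?c1 using product_integrable_prod[of I ?F] I F unfolding e by auto
      have "(\<integral>x. f i (x i) * f j (x j) \<partial>Pi\<^sub>M I M) = (\<Prod>k\<in>I. integral\<^sup>L (M k) (?F k))"
        using product_integral_prod[of I ?F] I F unfolding e by auto
      also have "\<dots> = 0" using I ij z by (intro prod_zero) auto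
      finally show ?thesis using 1 False by simp
    qed
    then show ?c1 ?c2 by auto
  qed
qed

lemma sets_gauss[measurable_cong]: "sets (gauss n m v) = sets (Pi\<^sub>M {..<n} (\<lambda>_. borel))"
  by (simp add: gauss_def sets_PiM_normal_law)

lemma space_gauss: "space (gauss n m v) = Rn n"
  by (simp add: gauss_def space_PiM)

lemma prob_space_gauss: "0 < v \<Longrightarrow> prob_space (gauss n m v)"
  unfolding gauss_def by (intro prob_space_PiM prob_space_normal_law)

lemma gauss_products:
  assumes v: "0 < v" and ij: "i < n" "j < n"
  shows "integrable (gauss n m v) (\<lambda>x. x i - m i)"
    and "(\<integral>x. x i - m i \<partial>gauss n m v) = 0"
    and "integrable (gauss n m v) (\<lambda>x. (x i - m i) * (x j - m j))"
    and "(\<integral>x. (x i - m i) * (x j - m j) \<partial>gauss n m v) = (if i = j then v else 0)"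
  using PiM_centred_products[of "{..<n}" "\<lambda>i. normal_law (m i) v" "\<lambda>i x. x - m i" i j]
    normal_law_moments(1)[OF v, of _ 1] normal_law_moments(1)[OF v, of _ 2] normal_law_moments(2,3)[OF v] ij
  by (simp_all add: gauss_def prob_space_normal_law[OF v])

lemma gauss_linear:
  assumes v: "0 < v"
  shows "integrable (gauss n m v) (\<lambda>x. \<Sum>i<n. a i * (x i - m i))"
    and "(\<integral>x. (\<Sum>i<n. a i * (x i - m i)) \<partial>gauss n m v) = 0"
  using gauss_products(1,2)[OF v] by (auto intro!: sum.neutral)

lemma gauss_quadratic:
  assumes v: "0 < v"
  shows "integrable (gauss n m v) (\<lambda>x. \<Sum>i<n. \<Sum>j<n. A i j * ((x i - m i) * (x j - m j)))"
    and "(\<integral>x. (\<Sum>i<n. \<Sum>j<n. A i j * ((x i - m i) * (x j - m j))) \<partial>gauss n m v) = v * (\<Sum>i<n. A i i)"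
proof -
  show "integrable (gauss n m v) (\<lambda>x. \<Sum>i<n. \<Sum>j<n. A i j * ((x i - m i) * (x j - m j)))"
    using gauss_products(3)[OF v] by (intro integral_double_sum(1) integrable_mult_right) auto
  have "(\<integral>x. (\<Sum>i<n. \<Sum>j<n. A i j * ((x i - m i) * (x j - m j))) \<partial>gauss n m v)
      = (\<Sum>i<n. \<Sum>j<n. if i = j then v * A i i else 0)"
    using gauss_products(3,4)[OF v]
    by (subst integral_double_sum(2)) (simp, intro sum.cong refl, simp)
  also have "\<dots> = v * (\<Sum>i<n. A i i)"
    by (simp add: sum_distrib_left mult.commute)
  finally show "(\<integral>x. (\<Sum>i<n. \<Sum>j<n. A i j * ((x i - m i) * (x j - m j))) \<partial>gauss n m v) = v * (\<Sum>i<n. A i i)" .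
qed

lemma gauss_linear_sq:
  assumes v: "0 < v"
  shows "integrable (gauss n m v) (\<lambda>x. (\<Sum>i<n. a i * (x i - m i))\<^sup>2)"
    and "(\<integral>x. (\<Sum>i<n. a i * (x i - m i))\<^sup>2 \<partial>gauss n m v) = v * (\<Sum>i<n. (a i)\<^sup>2)"
proof -
  have "(\<Sum>i<n. a i * (x i - m i))\<^sup>2 = (\<Sum>i<n. \<Sum>j<n. (a i * a j) * ((x i - m i) * (x j - m j)))" for x
    by (simp add: power2_eq_square sum_product ac_simps)
  with gauss_quadratic[OF v, where A = "\<lambda>i j. a i * a j"]
  show "integrable (gauss n m v) (\<lambda>x. (\<Sum>i<n. a i * (x i - m i))\<^sup>2)"
    "(\<integral>x. (\<Sum>i<n. a i * (x i - m i))\<^sup>2 \<partial>gauss n m v) = v * (\<Sum>i<n. (a i)\<^sup>2)"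
    by (simp_all add: power2_eq_square)
qed

text \<open>A sum of n uncorrelated centred terms of variance 2 v^2. The growth linear in n, where
  the uncentred square would grow like n^2, is what makes the final variance bound possible.\<close>

lemma gauss_norm_variance:
  assumes v: "0 < v"
  shows "integrable (gauss n m v) (\<lambda>x. ((\<Sum>i<n. (x i - m i)\<^sup>2) - real n * v)\<^sup>2)"
    and "(\<integral>x. ((\<Sum>i<n. (x i - m i)\<^sup>2) - real n * v)\<^sup>2 \<partial>gauss n m v) = 2 * real n * v\<^sup>2"
proof -
  let ?f = "\<lambda>i x. (x - m i)\<^sup>2 - v"
  have e: "((\<Sum>i<n. (x i - m i)\<^sup>2) - real n * v)\<^sup>2 = (\<Sum>i<n. \<Sum>j<n. ?f i (x i) * ?f j (x j))" for x
  proof -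
    have "(\<Sum>i<n. (x i - m i)\<^sup>2) - real n * v = (\<Sum>i<n. ?f i (x i))" by (simp add: sum_subtractf)
    then show ?thesis by (simp add: power2_eq_square sum_product)
  qed
  have f: "integrable (normal_law (m i) v) (?f i)" "integrable (normal_law (m i) v) (\<lambda>x. (?f i x)\<^sup>2)"
    "(\<integral>x. ?f i x \<partial>normal_law (m i) v) = 0" for i
  proof -
    interpret prob_space "normal_law (m i) v" by (rule prob_space_normal_law[OF v])
    show 1: "integrable (normal_law (m i) v) (?f i)"
      using normal_law_moments(1)[OF v, of "m i" 2] by simp
    have "(\<lambda>x. (?f i x)\<^sup>2) = (\<lambda>x. (x - m i) ^ 4 - 2 * v * (x - m i)\<^sup>2 + v\<^sup>2)"
      by (auto simp: power4_eq_xxxx power2_eq_square algebra_simps)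
    then show "integrable (normal_law (m i) v) (\<lambda>x. (?f i x)\<^sup>2)"
      using normal_law_moments(1)[OF v, of "m i" 2] normal_law_moments(1)[OF v, of "m i" 4] by simp
    show "(\<integral>x. ?f i x \<partial>normal_law (m i) v) = 0"
      using normal_law_moments(1)[OF v, of "m i" 2] normal_law_moments(3)[OF v, of "m i"] prob_space
      by (simp del: space_density)
  qed
  have c: "integrable (gauss n m v) (\<lambda>x. ?f i (x i) * ?f j (x j))"
    "(\<integral>x. ?f i (x i) * ?f j (x j) \<partial>gauss n m v) = (if i = j then 2 * v\<^sup>2 else 0)" if "i < n" "j < n" for i j
    using PiM_centred_products(3,4)[of "{..<n}" "\<lambda>i. normal_law (m i) v" ?f i j] f that normal_law_moments(4)[OF v]
    by (simp_all add: gauss_def prob_space_normal_law[OF v])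
  show "integrable (gauss n m v) (\<lambda>x. ((\<Sum>i<n. (x i - m i)\<^sup>2) - real n * v)\<^sup>2)"
    unfolding e using c(1) by (intro integral_double_sum(1)) auto
  have "(\<integral>x. ((\<Sum>i<n. (x i - m i)\<^sup>2) - real n * v)\<^sup>2 \<partial>gauss n m v)
      = (\<Sum>i<n. \<Sum>j<n. if i = j then 2 * v\<^sup>2 else 0)"
    unfolding e using c by (subst integral_double_sum(2)) (auto intro!: sum.cong)
  then show "(\<integral>x. ((\<Sum>i<n. (x i - m i)\<^sup>2) - real n * v)\<^sup>2 \<partial>gauss n m v) = 2 * real n * v\<^sup>2"
    by simp
qed

lemma nn_integral_gauss_exp_linear:
  assumes v: "0 < v"
  shows "(\<integral>\<^sup>+x. ennreal (exp (\<Sum>i<n. a i * (x i - m i))) \<partial>gauss n m v) = ennreal (exp (v * (\<Sum>i<n. (a i)\<^sup>2) / 2))"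
proof -
  interpret product_sigma_finite "\<lambda>i. normal_law (m i) v" by (rule product_sigma_finite_normal_law[OF v])
  have "(\<integral>\<^sup>+x. ennreal (exp (\<Sum>i<n. a i * (x i - m i))) \<partial>gauss n m v)
      = (\<integral>\<^sup>+x. (\<Prod>i<n. ennreal (exp (a i * (x i - m i)))) \<partial>gauss n m v)"
    by (simp add: exp_sum prod_ennreal)
  also have "\<dots> = (\<Prod>i<n. ennreal (exp (v * (a i)\<^sup>2 / 2)))"
    unfolding gauss_def
    by (subst product_nn_integral_prod[of _ "\<lambda>i x. ennreal (exp (a i * (x - m i)))"])
       (auto simp: nn_integral_normal_law_exp[OF v])
  also have "\<dots> = ennreal (exp (v * (\<Sum>i<n. (a i)\<^sup>2) / 2))"
    by (simp add: prod_ennreal exp_sum[symmetric] sum_distrib_left sum_divide_distrib)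
  finally show ?thesis .
qed

text \<open>The square in the exponent is linearised by an auxiliary standard normal variable.\<close>

lemma nn_integral_gauss_exp_square:
  assumes v: "0 < v"
  shows "(\<integral>\<^sup>+x. ennreal (exp ((\<Sum>i<n. q i * (x i - m i))\<^sup>2 / (4 * v * (\<Sum>i<n. (q i)\<^sup>2)))) \<partial>gauss n m v) \<le> ennreal (sqrt 2)"
proof (cases "(\<Sum>i<n. (q i)\<^sup>2) = 0")
  case True
  interpret prob_space "gauss n m v" by (rule prob_space_gauss[OF v])
  \<comment> \<open>Division by zero makes the exponent 0, so the integrand is 1.\<close>
  show ?thesis unfolding True by (simp add: emeasure_space_1)
next
  case False
  define S where "S = (\<Sum>i<n. (q i)\<^sup>2)"
  have S: "0 < S" using False by (simp add: S_def less_le sum_nonneg)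
  \<comment> \<open>With Z the linear form, w^2 = 1/(2 v S) makes exp(w Z g) integrate over g to
    exp(Z^2/(4 v S)), and over x to exp(g^2/4).\<close>
  define w where "w = 1 / sqrt (2 * v * S)"
  have w: "w\<^sup>2 = 1 / (2 * v * S)" using v S by (simp add: w_def power_divide)
  interpret G: prob_space "gauss n m v" by (rule prob_space_gauss[OF v])
  interpret N: prob_space "normal_law 0 1" by (rule prob_space_normal_law) simp
  interpret pair_sigma_finite "normal_law 0 1" "gauss n m v" ..
  have "(\<integral>\<^sup>+x. ennreal (exp ((\<Sum>i<n. q i * (x i - m i))\<^sup>2 / (4 * v * S))) \<partial>gauss n m v)
      = (\<integral>\<^sup>+x. \<integral>\<^sup>+g. ennreal (exp (w * (\<Sum>i<n. q i * (x i - m i)) * (g - 0))) \<partial>normal_law 0 1 \<partial>gauss n m v)"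
    by (subst nn_integral_normal_law_exp) (auto simp: power_mult_distrib w ac_simps)
  also have "\<dots> = (\<integral>\<^sup>+g. \<integral>\<^sup>+x. ennreal (exp (w * (\<Sum>i<n. q i * (x i - m i)) * (g - 0))) \<partial>gauss n m v \<partial>normal_law 0 1)"
    by (rule Fubini') measurable
  also have "\<dots> = (\<integral>\<^sup>+g. \<integral>\<^sup>+x. ennreal (exp (\<Sum>i<n. (w * g * q i) * (x i - m i))) \<partial>gauss n m v \<partial>normal_law 0 1)"
    by (simp add: sum_distrib_left sum_distrib_right ac_simps)
  also have "\<dots> = (\<integral>\<^sup>+g. ennreal (exp (g\<^sup>2 / 4)) \<partial>normal_law 0 1)"
  proof (rule nn_integral_cong, subst nn_integral_gauss_exp_linear[OF v])
    fix g :: real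
    have "(\<Sum>i<n. (w * g * q i)\<^sup>2) = w\<^sup>2 * g\<^sup>2 * S"
      by (simp add: power_mult_distrib sum_distrib_left S_def)
    then show "ennreal (exp (v * (\<Sum>i<n. (w * g * q i)\<^sup>2) / 2)) = ennreal (exp (g\<^sup>2 / 4))"
      using v S by (simp add: w)
  qed
  also have "\<dots> = ennreal (sqrt 2)" by (rule nn_integral_normal_law_exp_square)
  finally show ?thesis by (simp add: S_def)
qed

section \<open>Projection kernels and the maximum of the projected noise\<close>

definition mul :: "nat \<Rightarrow> (nat \<Rightarrow> nat \<Rightarrow> real) \<Rightarrow> (nat \<Rightarrow> real) \<Rightarrow> nat \<Rightarrow> real" where
  "mul n h x i = (\<Sum>j<n. h i j * x j)"

definition nsq :: "nat \<Rightarrow> (nat \<Rightarrow> real) \<Rightarrow> real" where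
  "nsq n x = (\<Sum>i<n. (x i)\<^sup>2)"

definition tr :: "nat \<Rightarrow> (nat \<Rightarrow> nat \<Rightarrow> real) \<Rightarrow> real" where
  "tr n h = (\<Sum>i<n. h i i)"

text \<open>Orthogonal projections as symmetric idempotent kernels on the indices below
  \<open>n\<close>. In this form fitted values and norms are finite sums of coordinates, whose
  measurability and integrals are computed termwise.\<close>

definition projection :: "nat \<Rightarrow> (nat \<Rightarrow> nat \<Rightarrow> real) \<Rightarrow> bool" where
  "projection n h \<longleftrightarrow> (\<forall>i<n. \<forall>j<n. h i j = h j i) \<and> (\<forall>i<n. \<forall>j<n. (\<Sum>k<n. h i k * h k j) = h i j)"

lemma nsq_nonneg: "0 \<le> nsq n x"
  by (simp add: nsq_def sum_nonneg)

lemma projection_sym: "projection n h \<Longrightarrow> i < n \<Longrightarrow> j < n \<Longrightarrow> h i j = h j i"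
  by (simp add: projection_def)

lemma projection_idem: "projection n h \<Longrightarrow> i < n \<Longrightarrow> j < n \<Longrightarrow> (\<Sum>k<n. h i k * h k j) = h i j"
  unfolding projection_def by blast

text \<open>This is the diagonal of H H^T = H. Probabilistically, \<open>h i i\<close> times
  \<open>v\<close> is the variance of the i-th coordinate of the projected noise.\<close>

lemma projection_row:
  assumes "projection n h" "i < n"
  shows "(\<Sum>j<n. (h i j)\<^sup>2) = h i i"
proof -
  have "(\<Sum>j<n. (h i j)\<^sup>2) = (\<Sum>j<n. h i j * h j i)"
    unfolding power2_eq_square
    by (intro sum.cong refl arg_cong2[where f = "(*)"] projection_sym[OF assms]) simp
  then show ?thesis by (simp only: projection_idem[OF assms(1) assms(2) assms(2)])
qed

lemma projection_diag_nonneg: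
  assumes "projection n h" "i < n"
  shows "0 \<le> h i i"
  unfolding projection_row[OF assms, symmetric] by (simp add: sum_nonneg)

lemma projection_tr_nonneg: "projection n h \<Longrightarrow> 0 \<le> tr n h"
  unfolding tr_def by (rule sum_nonneg) (simp add: projection_diag_nonneg[of n h])

lemma projection_diag_zero:
  assumes "projection n h" "i < n" "j < n" "h i i = 0"
  shows "h i j = 0"
proof -
  have "(\<Sum>j<n. (h i j)\<^sup>2) = 0" using projection_row[OF assms(1,2)] assms(4) by simp
  then show ?thesis using assms(3) by (subst (asm) sum_nonneg_eq_0_iff) auto
qed

lemma projection_tr_zero:
  assumes "projection n h" "tr n h = 0" "i < n" "j < n"
  shows "h i j = 0"
proof (rule projection_diag_zero[OF assms(1,3,4)])
  show "h i i = 0"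
    using assms projection_diag_nonneg[OF assms(1)] unfolding tr_def
    by (subst (asm) sum_nonneg_eq_0_iff) auto
qed

lemma nn_integral_gauss_exp_projection:
  assumes v: "0 < v" and h: "projection n h" and k: "tr n h \<le> k" "0 < k"
  shows "(\<integral>\<^sup>+x. ennreal (exp (nsq n (mul n h (\<lambda>i. x i - m i)) / (4 * v * k))) \<partial>gauss n m v) \<le> ennreal (sqrt 2)"
proof (cases "tr n h = 0")
  case True
  interpret prob_space "gauss n m v" by (rule prob_space_gauss[OF v])
  have "nsq n (mul n h (\<lambda>i. x i - m i)) = 0" for x
    using projection_tr_zero[OF h True] by (simp add: nsq_def mul_def)
  then show ?thesis by (simp add: emeasure_space_1)
next
  case False
  define t where "t = tr n h"
  have t: "0 < t" using projection_tr_nonneg[OF h] False by (simp add: t_def)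
  have hn: "0 \<le> h i i" if "i < n" for i by (rule projection_diag_nonneg[OF h that])
  let ?y = "\<lambda>x i. (\<Sum>j<n. h i j * (x j - m j))\<^sup>2 / (4 * v * (\<Sum>j<n. (h i j)\<^sup>2))"
  have w: "(\<Sum>i<n. h i i / t) = 1"
    using t by (simp add: sum_divide_distrib[symmetric] t_def tr_def)
  have pt: "exp (nsq n (mul n h (\<lambda>i. x i - m i)) / (4 * v * k)) \<le> (\<Sum>i<n. h i i / t * exp (?y x i))" for x
  proof -
    have "nsq n (mul n h (\<lambda>i. x i - m i)) / (4 * v * k) \<le> nsq n (mul n h (\<lambda>i. x i - m i)) / (4 * v * t)"
      using k t v nsq_nonneg by (intro divide_left_mono) (auto simp: t_def)
    also have "\<dots> = (\<Sum>i<n. h i i / t * ?y x i)"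
      unfolding nsq_def mul_def sum_divide_distrib
    proof (intro sum.cong refl)
      fix i assume "i \<in> {..<n}"
      then have i: "i < n" by simp
      \<comment> \<open>A zero diagonal entry forces the whole row to vanish, so both sides are 0
        there.\<close>
      show "(\<Sum>j<n. h i j * (x j - m j))\<^sup>2 / (4 * v * t) = h i i / t * ?y x i"
        using projection_row[OF h i] projection_diag_zero[OF h i]
        by (cases "h i i = 0") auto
    qed
    finally have "exp (nsq n (mul n h (\<lambda>i. x i - m i)) / (4 * v * k)) \<le> exp (\<Sum>i<n. (h i i / t) *\<^sub>R ?y x i)"
      unfolding exp_le_cancel_iff real_scaleR_def .
    also have "\<dots> \<le> (\<Sum>i<n. h i i / t * exp (?y x i))"
    proof (rule convex_on_sum[OF _ _ exp_convex])
      show "{..<n} \<noteq> {}" using t by (auto simp: t_def tr_def)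
    qed (use w t hn in auto)
    finally show ?thesis .
  qed
  have "(\<integral>\<^sup>+x. ennreal (exp (nsq n (mul n h (\<lambda>i. x i - m i)) / (4 * v * k))) \<partial>gauss n m v)
      \<le> (\<integral>\<^sup>+x. (\<Sum>i<n. ennreal (h i i / t) * ennreal (exp (?y x i))) \<partial>gauss n m v)"
  proof (rule nn_integral_mono)
    fix x
    have "(\<Sum>i<n. ennreal (h i i / t) * ennreal (exp (?y x i))) = ennreal (\<Sum>i<n. h i i / t * exp (?y x i))"
    proof -
      have "(\<Sum>i<n. ennreal (h i i / t) * ennreal (exp (?y x i))) = (\<Sum>i<n. ennreal (h i i / t * exp (?y x i)))"
        by (intro sum.cong refl ennreal_mult'[symmetric]) (use hn t in auto)
      also have "\<dots> = ennreal (\<Sum>i<n. h i i / t * exp (?y x i))"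
        by (rule sum_ennreal) (use hn t in auto)
      finally show ?thesis .
    qed
    then show "ennreal (exp (nsq n (mul n h (\<lambda>i. x i - m i)) / (4 * v * k)))
        \<le> (\<Sum>i<n. ennreal (h i i / t) * ennreal (exp (?y x i)))"
      using pt by (simp add: ennreal_leI)
  qed
  also have "\<dots> = (\<Sum>i<n. ennreal (h i i / t) * (\<integral>\<^sup>+x. ennreal (exp (?y x i)) \<partial>gauss n m v))"
    by (subst nn_integral_sum) (auto simp: nn_integral_cmult)
  also have "\<dots> \<le> (\<Sum>i<n. ennreal (h i i / t) * ennreal (sqrt 2))"
    by (intro sum_mono mult_left_mono nn_integral_gauss_exp_square v) auto
  also have "\<dots> = ennreal (\<Sum>i<n. h i i / t) * ennreal (sqrt 2)"
    unfolding sum_distrib_right[symmetric] by (subst sum_ennreal) (use hn t in auto)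
  also have "\<dots> = ennreal (sqrt 2)" by (simp add: w)
  finally show ?thesis .
qed

text \<open>Above the threshold, x^2 is at most 2 L^2 + 2 (x - L)^2 and the quadratic Taylor bound
  of exp takes over. With L the logarithm of a bound on a sum of exponential moments, the factor
  exp(-L) cancels that sum, so a union bound costs only L^2.\<close>

lemma sq_le_exp:
  fixes x L :: real
  assumes "0 \<le> x" "0 \<le> L"
  shows "x\<^sup>2 \<le> 2 * L\<^sup>2 + 4 * exp (x - L)"
proof (cases "x \<le> L")
  case True
  then have "x\<^sup>2 \<le> L\<^sup>2" using assms by (intro power_mono) auto
  then show ?thesis by (smt (verit) exp_gt_zero zero_le_power2)
next
  case False
  have "2 * L\<^sup>2 + 2 * (x - L)\<^sup>2 - x\<^sup>2 = (x - 2 * L)\<^sup>2"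
    by (simp add: power2_eq_square algebra_simps)
  then have "x\<^sup>2 \<le> 2 * L\<^sup>2 + 2 * (x - L)\<^sup>2"
    using zero_le_power2[of "x - 2 * L"] by linarith
  moreover have "(x - L)\<^sup>2 / 2 \<le> exp (x - L)"
    using exp_lower_Taylor_quadratic[of "x - L"] False by simp
  ultimately show ?thesis by simp
qed

text \<open>The maximum over a finite family of projections is controlled by the sum of the exponential
  moments.\<close>

lemma projection_envelope:
  fixes h :: "'m \<Rightarrow> nat \<Rightarrow> nat \<Rightarrow> real"
  assumes v: "0 < v" and fin: "finite \<M>" "\<M> \<noteq> {}"
    and h: "\<And>M. M \<in> \<M> \<Longrightarrow> projection n (h M)" and k: "\<And>M. M \<in> \<M> \<Longrightarrow> tr n (h M) \<le> k"
  obtains R where "R \<in> borel_measurable (Pi\<^sub>M {..<n} (\<lambda>_. borel))" "\<And>x. 0 \<le> R x"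
    "\<And>x M. M \<in> \<M> \<Longrightarrow> (nsq n (mul n (h M) (\<lambda>i. x i - m i)))\<^sup>2 \<le> R x"
    "(\<integral>\<^sup>+x. ennreal (R x) \<partial>gauss n m v) \<le> ennreal ((4 * v * k)\<^sup>2 * (2 * (ln (sqrt 2 * card \<M>))\<^sup>2 + 4))"
proof (cases "k = 0")
  case True
  \<comment> \<open>With \<open>k = 0\<close> every kernel has trace 0 and vanishes; the other case
    divides by \<open>k\<close>.\<close>
  have "nsq n (mul n (h M) (\<lambda>i. x i - m i)) = 0" if "M \<in> \<M>" for x M
  proof -
    have "tr n (h M) = 0" using k[OF that] projection_tr_nonneg[OF h[OF that]] True by simp
    then show ?thesis
      using projection_tr_zero[OF h[OF that]] by (simp add: nsq_def mul_def)
  qed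
  then show thesis by (intro that[of "\<lambda>_. 0"]) (auto simp: True)
next
  case False
  obtain M0 where "M0 \<in> \<M>" using fin by auto
  with False have k0: "0 < k" using k[of M0] projection_tr_nonneg[OF h, of M0] by simp
  \<comment> \<open>The union bound for the exponential moments: each of the
    \<open>card \<M>\<close> models contributes at most sqrt 2. Taking L = ln N reduces their sum to
    at most 1.\<close>
  define N where "N = sqrt 2 * real (card \<M>)"
  have N: "1 \<le> N"
  proof -
    have "1 \<le> card \<M>" using fin by (simp add: Suc_leI card_gt_0_iff)
    then show ?thesis
      using mult_mono[of 1 "sqrt 2" 1 "real (card \<M>)"] by (simp add: N_def)
  qed
  define L where "L = ln N"
  have L: "0 \<le> L" using N by (simp add: L_def)
  define Q where "Q = (\<lambda>M x. nsq n (mul n (h M) (\<lambda>i. x i - m i)) / (4 * v * k))"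
  have Q: "0 \<le> Q M x" for M x using v k0 by (simp add: Q_def nsq_nonneg)
  have Qm[measurable]: "Q M \<in> borel_measurable (Pi\<^sub>M {..<n} (\<lambda>_. borel))" for M
    unfolding Q_def nsq_def mul_def by measurable
  define R where "R = (\<lambda>x. (4 * v * k)\<^sup>2 * (2 * L\<^sup>2 + 4 * (\<Sum>M\<in>\<M>. exp (Q M x - L))))"
  show thesis
  proof
    show "R \<in> borel_measurable (Pi\<^sub>M {..<n} (\<lambda>_. borel))" unfolding R_def by measurable
    show "0 \<le> R x" for x
      unfolding R_def by (intro mult_nonneg_nonneg add_nonneg_nonneg sum_nonneg) auto
    show "(nsq n (mul n (h M) (\<lambda>i. x i - m i)))\<^sup>2 \<le> R x" if M: "M \<in> \<M>" for x M
    proof -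
      have "(Q M x)\<^sup>2 \<le> 2 * L\<^sup>2 + 4 * exp (Q M x - L)" by (rule sq_le_exp[OF Q L])
      also have "exp (Q M x - L) \<le> (\<Sum>M\<in>\<M>. exp (Q M x - L))"
        using fin M by (intro member_le_sum) auto
      finally have "(4 * v * k)\<^sup>2 * (Q M x)\<^sup>2 \<le> R x"
        unfolding R_def by (intro mult_left_mono) auto
      then show ?thesis using v k0 by (simp add: Q_def power_divide)
    qed
    interpret prob_space "gauss n m v" by (rule prob_space_gauss[OF v])
    have "(\<integral>\<^sup>+x. ennreal (R x) \<partial>gauss n m v)
        = (\<integral>\<^sup>+x. ennreal ((4 * v * k)\<^sup>2 * (2 * L\<^sup>2)) + ennreal ((4 * v * k)\<^sup>2 * 4 / N) * (\<Sum>M\<in>\<M>. ennreal (exp (Q M x))) \<partial>gauss n m v)"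
    proof (intro nn_integral_cong)
      fix x
      have "R x = (4 * v * k)\<^sup>2 * (2 * L\<^sup>2) + (4 * v * k)\<^sup>2 * 4 / N * (\<Sum>M\<in>\<M>. exp (Q M x))"
        using N by (simp add: R_def L_def exp_diff sum_divide_distrib[symmetric] distrib_left)
      moreover have "0 \<le> (4 * v * k)\<^sup>2 * (2 * L\<^sup>2)" "0 \<le> (4 * v * k)\<^sup>2 * 4 / N"
        "0 \<le> (\<Sum>M\<in>\<M>. exp (Q M x))"
        using N by (auto intro: sum_nonneg)
      ultimately show "ennreal (R x) = ennreal ((4 * v * k)\<^sup>2 * (2 * L\<^sup>2)) + ennreal ((4 * v * k)\<^sup>2 * 4 / N) * (\<Sum>M\<in>\<M>. ennreal (exp (Q M x)))"
        by (simp only: ennreal_plus ennreal_mult mult_nonneg_nonneg sum_ennreal exp_ge_zero)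
    qed
    also have "\<dots> = ennreal ((4 * v * k)\<^sup>2 * (2 * L\<^sup>2)) + ennreal ((4 * v * k)\<^sup>2 * 4 / N)
        * (\<Sum>M\<in>\<M>. \<integral>\<^sup>+x. ennreal (exp (Q M x)) \<partial>gauss n m v)"
      by (subst nn_integral_add) (auto simp: nn_integral_cmult nn_integral_sum emeasure_space_1 simp del: sum_ennreal)
    also have "\<dots> \<le> ennreal ((4 * v * k)\<^sup>2 * (2 * L\<^sup>2)) + ennreal ((4 * v * k)\<^sup>2 * 4 / N) * (\<Sum>M\<in>\<M>. ennreal (sqrt 2))"
      unfolding Q_def using h k
      by (intro add_mono mult_left_mono sum_mono nn_integral_gauss_exp_projection v k0) auto
    also have "(\<Sum>M\<in>\<M>. ennreal (sqrt 2)) = ennreal N"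
      by (simp add: N_def ennreal_mult' ennreal_of_nat_eq_real_of_nat mult.commute)
    also have "ennreal ((4 * v * k)\<^sup>2 * (2 * L\<^sup>2)) + ennreal ((4 * v * k)\<^sup>2 * 4 / N) * ennreal N
        = ennreal ((4 * v * k)\<^sup>2 * (2 * (ln (sqrt 2 * card \<M>))\<^sup>2 + 4))"
    proof -
      have "(4 * v * k)\<^sup>2 * (2 * L\<^sup>2) + (4 * v * k)\<^sup>2 * 4 / N * N = (4 * v * k)\<^sup>2 * (2 * (ln (sqrt 2 * card \<M>))\<^sup>2 + 4)"
        using N by (simp add: L_def N_def[symmetric] distrib_left)
      moreover have "0 \<le> (4 * v * k)\<^sup>2 * (2 * L\<^sup>2)" "0 \<le> (4 * v * k)\<^sup>2 * 4 / N" "0 \<le> N"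
        using N by auto
      ultimately show ?thesis
        by (metis ennreal_plus ennreal_mult mult_nonneg_nonneg)
    qed
    finally show "(\<integral>\<^sup>+x. ennreal (R x) \<partial>gauss n m v) \<le> ennreal ((4 * v * k)\<^sup>2 * (2 * (ln (sqrt 2 * card \<M>))\<^sup>2 + 4))" .
  qed
qed

subsection \<open>Changing the variance\<close>

text \<open>It suffices to compare the two measures on boxes, where the indicator and hence the
  integral factorise.\<close>

lemma PiM_density:
  fixes f :: "'i \<Rightarrow> 'a \<Rightarrow> ennreal"
  assumes I: "finite I" and M: "product_sigma_finite M" and N: "product_sigma_finite (\<lambda>i. density (M i) (f i))"
    and f[measurable]: "\<And>i. f i \<in> borel_measurable (M i)"
  shows "density (Pi\<^sub>M I M) (\<lambda>x. \<Prod>i\<in>I. f i (x i)) = Pi\<^sub>M I (\<lambda>i. density (M i) (f i))"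
proof (rule product_sigma_finite.PiM_eqI[OF N I])
  interpret product_sigma_finite M by (rule M)
  show "sets (density (Pi\<^sub>M I M) (\<lambda>x. \<Prod>i\<in>I. f i (x i))) = sets (Pi\<^sub>M I (\<lambda>i. density (M i) (f i)))"
    by (simp cong: sets_PiM_cong)
  fix A assume A: "\<And>i. i \<in> I \<Longrightarrow> A i \<in> sets (density (M i) (f i))"
  have A'[measurable]: "i \<in> I \<Longrightarrow> A i \<in> sets (M i)" for i using A by simp
  have box: "Pi\<^sub>E I A \<in> sets (Pi\<^sub>M I M)" using I A' by (intro sets_PiM_I_finite) auto
  have "emeasure (density (Pi\<^sub>M I M) (\<lambda>x. \<Prod>i\<in>I. f i (x i))) (Pi\<^sub>E I A)
      = (\<integral>\<^sup>+x. (\<Prod>i\<in>I. f i (x i)) * indicator (Pi\<^sub>E I A) x \<partial>Pi\<^sub>M I M)"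
    using box I by (subst emeasure_density) auto
  also have "\<dots> = (\<integral>\<^sup>+x. (\<Prod>i\<in>I. f i (x i) * indicator (A i) (x i)) \<partial>Pi\<^sub>M I M)"
  proof (rule nn_integral_cong)
    fix x assume x: "x \<in> space (Pi\<^sub>M I M)"
    have "indicator (Pi\<^sub>E I A) x = (\<Prod>i\<in>I. indicator (A i) (x i) :: ennreal)"
    proof (cases "x \<in> Pi\<^sub>E I A")
      case True
      then show ?thesis by (auto simp: PiE_iff)
    next
      case False
      then obtain i where "i \<in> I" "x i \<notin> A i" using x by (auto simp: space_PiM PiE_iff)
      then have "(\<Prod>i\<in>I. indicator (A i) (x i) :: ennreal) = 0" using I by (intro prod_zero bexI[of _ i]) auto
      then show ?thesis using False by simp
    qed
    then show "(\<Prod>i\<in>I. f i (x i)) * indicator (Pi\<^sub>E I A) x = (\<Prod>i\<in>I. f i (x i) * indicator (A i) (x i))"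
      by (simp add: prod.distrib)
  qed
  also have "\<dots> = (\<Prod>i\<in>I. \<integral>\<^sup>+x. f i x * indicator (A i) x \<partial>M i)"
    by (rule product_nn_integral_prod[OF I]) measurable
  also have "\<dots> = (\<Prod>i\<in>I. emeasure (density (M i) (f i)) (A i))"
    using A' by (intro prod.cong refl) (simp add: emeasure_density)
  finally show "emeasure (density (Pi\<^sub>M I M) (\<lambda>x. \<Prod>i\<in>I. f i (x i))) (Pi\<^sub>E I A)
      = (\<Prod>i\<in>I. emeasure (density (M i) (f i)) (A i))" .
qed

text \<open>Absolute continuity of the Gaussian laws: the null boundaries of the selection regions
  can be discarded under every variance that occurs.\<close>

lemma null_sets_gauss:
  assumes v: "0 < v" and N: "N \<in> null_sets (Pi\<^sub>M {..<n} (\<lambda>_. lborel))"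
  shows "N \<in> null_sets (gauss n m v)"
proof -
  have "product_sigma_finite (\<lambda>_. lborel :: real measure)" by (rule product_sigma_finite.intro) (rule sigma_finite_lborel)
  from PiM_density[OF _ this product_sigma_finite_normal_law[OF v], where I = "{..<n}" and m1 = m]
  have "gauss n m v = density (Pi\<^sub>M {..<n} (\<lambda>_. lborel)) (\<lambda>x. \<Prod>i<n. ennreal (normal_density (m i) (sqrt v) (x i)))"
    by (simp add: gauss_def)
  moreover have "N \<in> null_sets (density (Pi\<^sub>M {..<n} (\<lambda>_. lborel)) (\<lambda>x. \<Prod>i<n. ennreal (normal_density (m i) (sqrt v) (x i))))"
    using N AE_not_in[OF N] by (subst null_sets_density_iff) (auto simp: null_sets_def)
  ultimately show ?thesis by simp
qed

definition gauss_ratio :: "nat \<Rightarrow> (nat \<Rightarrow> real) \<Rightarrow> real \<Rightarrow> real \<Rightarrow> (nat \<Rightarrow> real) \<Rightarrow> real" where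
  "gauss_ratio n m v v' x = (\<Prod>i<n. normal_ratio (m i) v v' (x i))"

lemma borel_measurable_gauss_ratio[measurable]:
  "gauss_ratio n m v v' \<in> borel_measurable (Pi\<^sub>M {..<n} (\<lambda>_. borel))"
  unfolding gauss_ratio_def[abs_def] by measurable

lemma gauss_ratio_nonneg: "0 \<le> gauss_ratio n m v v' x"
  by (auto simp: gauss_ratio_def intro!: prod_nonneg normal_ratio_nonneg)

lemma gauss_density_ratio:
  assumes "0 < v" "0 < v'"
  shows "gauss n m v' = density (gauss n m v) (\<lambda>x. ennreal (gauss_ratio n m v v' x))"
proof -
  have "density (gauss n m v) (\<lambda>x. \<Prod>i<n. ennreal (normal_ratio (m i) v v' (x i)))
      = Pi\<^sub>M {..<n} (\<lambda>i. density (normal_law (m i) v) (\<lambda>x. ennreal (normal_ratio (m i) v v' x)))"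
    unfolding gauss_def
    by (rule PiM_density[OF _ product_sigma_finite_normal_law])
       (use assms in \<open>auto simp: normal_law_ratio product_sigma_finite_normal_law\<close>)
  also have "\<dots> = gauss n m v'" using assms by (simp add: normal_law_ratio gauss_def)
  finally show ?thesis
    by (simp add: gauss_ratio_def prod_ennreal normal_ratio_nonneg)
qed

text \<open>By independence the chi-square divergence is exactly (1 - b^2)^(-n/2) - 1. It is
  exponential in n b^2 and becomes linear only under the restriction on
  \<open>real n * b\<^sup>2\<close>.\<close>

lemma gauss_ratio_moments:
  assumes v: "0 < v" and b: "0 \<le> b" "real n * b\<^sup>2 \<le> 1 / 2" "b < 1"
  shows "integrable (gauss n m v) (gauss_ratio n m v (v * (1 + b)))"
    and "integrable (gauss n m v) (\<lambda>x. (gauss_ratio n m v (v * (1 + b)) x)\<^sup>2)"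
    and "integrable (gauss n m v) (\<lambda>x. (gauss_ratio n m v (v * (1 + b)) x - 1)\<^sup>2)"
    and "(\<integral>x. (gauss_ratio n m v (v * (1 + b)) x - 1)\<^sup>2 \<partial>gauss n m v) \<le> real n * b\<^sup>2"
proof -
  let ?r = "gauss_ratio n m v (v * (1 + b))"
  interpret product_sigma_finite "\<lambda>i. normal_law (m i) v" by (rule product_sigma_finite_normal_law[OF v])
  note M = normal_ratio_moments[OF v b(1,3)]
  show 1: "integrable (gauss n m v) ?r"
    unfolding gauss_ratio_def[abs_def] gauss_def by (rule product_integrable_prod) (simp_all add: M)
  have E1: "(\<integral>x. ?r x \<partial>gauss n m v) = 1"
    unfolding gauss_ratio_def gauss_def by (subst product_integral_prod) (simp_all add: M)
  have sq: "(?r x)\<^sup>2 = (\<Prod>i<n. (normal_ratio (m i) v (v * (1 + b)) (x i))\<^sup>2)" for x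
    by (simp add: gauss_ratio_def prod_power_distrib)
  show 2: "integrable (gauss n m v) (\<lambda>x. (?r x)\<^sup>2)"
    unfolding sq gauss_def by (rule product_integrable_prod[where f = "\<lambda>i x. (normal_ratio (m i) v (v * (1 + b)) x)\<^sup>2"]) (simp_all add: M)
  have E2: "(\<integral>x. (?r x)\<^sup>2 \<partial>gauss n m v) = (1 / sqrt (1 - b\<^sup>2)) ^ n"
    unfolding sq gauss_def
    by (subst product_integral_prod[where f = "\<lambda>i x. (normal_ratio (m i) v (v * (1 + b)) x)\<^sup>2"]) (simp_all add: M)
  interpret G: prob_space "gauss n m v" by (rule prob_space_gauss[OF v])
  have exp: "(?r x - 1)\<^sup>2 = (?r x)\<^sup>2 - 2 * ?r x + 1" for x by (simp add: power2_eq_square algebra_simps)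
  show "integrable (gauss n m v) (\<lambda>x. (?r x - 1)\<^sup>2)" unfolding exp using 1 2 by simp
  have "(\<integral>x. (?r x - 1)\<^sup>2 \<partial>gauss n m v) = (1 / sqrt (1 - b\<^sup>2)) ^ n - 1"
    unfolding exp using 1 2 G.prob_space by (simp add: E1 E2)
  also have "\<dots> \<le> real n * b\<^sup>2"
  proof -
    let ?c = "real n * b\<^sup>2"
    have b2: "b\<^sup>2 < 1" using b by (simp add: power_less_one_iff abs_square_less_1)
    have c: "0 \<le> ?c" "?c \<le> 1 / 2" using b by auto
    have "1 - ?c \<le> (1 - b\<^sup>2) ^ n"
      using Bernoulli_inequality[of "- b\<^sup>2" n] b2 by simp
    \<comment> \<open>For 0 \<le> c \<le> 1/2 one has c + c^2 \<le> 3/4. Together with Bernoulli's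
      inequality this bounds the n-th power of 1/sqrt(1 - b^2) by 1 + c.\<close>
    have "1 \<le> (1 + ?c)\<^sup>2 * (1 - ?c)"
    proof -
      have "(1 + ?c)\<^sup>2 * (1 - ?c) = 1 + ?c * (1 - ?c - ?c * ?c)"
        by (simp add: power2_eq_square algebra_simps)
      moreover have "?c * ?c \<le> 1 / 2 * (1 / 2)" using c by (intro mult_mono) auto
      ultimately show ?thesis using c by simp
    qed
    also have "\<dots> \<le> (1 + ?c)\<^sup>2 * (1 - b\<^sup>2) ^ n"
      by (intro mult_left_mono) (use \<open>1 - ?c \<le> (1 - b\<^sup>2) ^ n\<close> in auto)
    also have "\<dots> = ((1 + ?c) * sqrt (1 - b\<^sup>2) ^ n)\<^sup>2"
    proof -
      have "(sqrt (1 - b\<^sup>2) ^ n)\<^sup>2 = (1 - b\<^sup>2) ^ n"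
        using b2 by (simp add: power_mult[symmetric] mult.commute[of n] power_mult)
      then show ?thesis by (simp add: power_mult_distrib)
    qed
    finally have "1 \<le> ((1 + ?c) * sqrt (1 - b\<^sup>2) ^ n)\<^sup>2" .
    then have "1 \<le> (1 + ?c) * sqrt (1 - b\<^sup>2) ^ n"
      using power2_le_imp_le[of 1 "(1 + ?c) * sqrt (1 - b\<^sup>2) ^ n"] c b2 by simp
    moreover have "0 < sqrt (1 - b\<^sup>2) ^ n" using b2 by simp
    ultimately have "1 / sqrt (1 - b\<^sup>2) ^ n \<le> 1 + ?c" by (simp only: divide_le_eq if_True)
    then show ?thesis by (simp add: power_divide)
  qed
  finally show "(\<integral>x. (?r x - 1)\<^sup>2 \<partial>gauss n m v) \<le> real n * b\<^sup>2" .
qed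

text \<open>The difference is the integral of g (r - 1) with r the likelihood ratio. Instead of
  Cauchy-Schwarz, the weighted inequality |g (r - 1)| \<le> (b/2) g^2 + (r - 1)^2/(2 b) is
  integrated; the weight b makes both parts of order n b, since the chi-square bound is n
  b^2.\<close>

lemma gauss_variance_step:
  assumes v: "0 < v" and b: "0 \<le> b" "real n * b\<^sup>2 \<le> 1 / 2" "b < 1"
    and g: "g \<in> borel_measurable (Pi\<^sub>M {..<n} (\<lambda>_. borel))"
    and g2: "integrable (gauss n m v) (\<lambda>x. (g x)\<^sup>2)" and A: "(\<integral>x. (g x)\<^sup>2 \<partial>gauss n m v) \<le> A * real n"
  shows "\<bar>(\<integral>x. g x \<partial>gauss n m (v * (1 + b))) - (\<integral>x. g x \<partial>gauss n m v)\<bar> \<le> (A + 1) / 2 * real n * b"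
proof (cases "b = 0")
  case False
  then have b0: "0 < b" using b by simp
  note [measurable] = g
  let ?r = "gauss_ratio n m v (v * (1 + b))"
  have v': "0 < v * (1 + b)" using v b by simp
  note R = gauss_ratio_moments[OF v b, of m]
  interpret G: prob_space "gauss n m v" by (rule prob_space_gauss[OF v])
  have young: "\<bar>x * y\<bar> \<le> x\<^sup>2 + y\<^sup>2" for x y :: real
    using sum_squares_bound[of "\<bar>x\<bar>" "\<bar>y\<bar>"] abs_ge_zero[of "x * y"] unfolding power2_abs abs_mult by linarith
  have ig: "integrable (gauss n m v) g"
    by (rule G.square_integrable_imp_integrable[OF _ g2]) measurable
  have irg: "integrable (gauss n m v) (\<lambda>x. ?r x * g x)"
    by (rule Bochner_Integration.integrable_bound[OF Bochner_Integration.integrable_add[OF R(2) g2]])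
       (measurable, use young in auto)
  have "(\<integral>x. g x \<partial>gauss n m (v * (1 + b))) = (\<integral>x. ?r x * g x \<partial>gauss n m v)"
    unfolding gauss_density_ratio[OF v v'] by (subst integral_density) (auto simp: gauss_ratio_nonneg)
  then have "\<bar>(\<integral>x. g x \<partial>gauss n m (v * (1 + b))) - (\<integral>x. g x \<partial>gauss n m v)\<bar>
      = \<bar>\<integral>x. ?r x * g x - g x \<partial>gauss n m v\<bar>"
    using ig irg by simp
  also have "\<dots> \<le> (\<integral>x. \<bar>?r x * g x - g x\<bar> \<partial>gauss n m v)"
    by (rule integral_abs_bound)
  also have "\<dots> \<le> (\<integral>x. b / 2 * (g x)\<^sup>2 + 1 / (2 * b) * (?r x - 1)\<^sup>2 \<partial>gauss n m v)"
  proof (rule integral_mono)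
    fix x
    have "0 \<le> (b * \<bar>g x\<bar> - \<bar>?r x - 1\<bar>)\<^sup>2" by simp
    then have "2 * b * (\<bar>g x\<bar> * \<bar>?r x - 1\<bar>) \<le> b\<^sup>2 * (g x)\<^sup>2 + (?r x - 1)\<^sup>2"
      by (simp add: power2_diff power_mult_distrib mult.assoc)
    then have "2 * b * (\<bar>g x\<bar> * \<bar>?r x - 1\<bar>) / (2 * b) \<le> (b\<^sup>2 * (g x)\<^sup>2 + (?r x - 1)\<^sup>2) / (2 * b)"
      using b0 by (intro divide_right_mono) auto
    moreover have "(b\<^sup>2 * (g x)\<^sup>2 + (?r x - 1)\<^sup>2) / (2 * b) = b / 2 * (g x)\<^sup>2 + 1 / (2 * b) * (?r x - 1)\<^sup>2"
      using b0 by (simp add: add_divide_distrib power2_eq_square[of b])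
    moreover have "\<bar>?r x * g x - g x\<bar> = \<bar>g x\<bar> * \<bar>?r x - 1\<bar>"
      by (simp add: abs_mult[symmetric] algebra_simps)
    ultimately show "\<bar>?r x * g x - g x\<bar> \<le> b / 2 * (g x)\<^sup>2 + 1 / (2 * b) * (?r x - 1)\<^sup>2"
      using b0 by simp
  qed (use ig irg g2 R(3) in auto)
  also have "\<dots> = b / 2 * (\<integral>x. (g x)\<^sup>2 \<partial>gauss n m v) + 1 / (2 * b) * (\<integral>x. (?r x - 1)\<^sup>2 \<partial>gauss n m v)"
    using g2 R(3) by simp
  also have "\<dots> \<le> b / 2 * (A * real n) + 1 / (2 * b) * (real n * b\<^sup>2)"
    by (intro add_mono mult_left_mono A R(4)) (use b0 in auto)
  also have "\<dots> = (A + 1) / 2 * real n * b"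
    using b0 by (simp add: field_simps power2_eq_square)
  finally show ?thesis .
qed simp

text \<open>The derivative in the variance of a Gaussian expectation is bounded by comparing nearby
  variances only, since the second moment of the likelihood ratio is exponential in \<open>n\<close> otherwise.\<close>

lemma gauss_variance_lipschitz:
  assumes s: "0 < s" and a: "0 \<le> a" and A: "0 \<le> A"
    and g: "g \<in> borel_measurable (Pi\<^sub>M {..<n} (\<lambda>_. borel))"
    and g2: "\<And>v. s \<le> v \<Longrightarrow> v \<le> (1 + a) * s \<Longrightarrow> integrable (gauss n m v) (\<lambda>x. (g x)\<^sup>2)"
      "\<And>v. s \<le> v \<Longrightarrow> v \<le> (1 + a) * s \<Longrightarrow> (\<integral>x. (g x)\<^sup>2 \<partial>gauss n m v) \<le> A * real n"
  shows "\<bar>(\<integral>x. g x \<partial>gauss n m ((1 + a) * s)) - (\<integral>x. g x \<partial>gauss n m s)\<bar> \<le> (A + 1) / 2 * real n * a"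
proof -
  \<comment> \<open>The number of steps, so large that c = a/k satisfies c^2 (2 n + 2) \<le> 1. The
    two summands give n c^2 \<le> 1/2 and c < 1, the two conditions for a single step. The number
    itself disappears, since the errors are proportional to the step length.\<close>
  obtain k :: nat where k: "a * sqrt (2 * real n + 2) < real k" using reals_Archimedean2 by blast
  moreover have "0 \<le> a * sqrt (2 * real n + 2)" using a by simp
  ultimately have "0 < real k" by linarith
  then have k0: "0 < k" by simp
  define c where "c = a / real k"
  have c: "0 \<le> c" using a by (simp add: c_def)
  have "(c * sqrt (2 * real n + 2))\<^sup>2 \<le> 1\<^sup>2"
    using k k0 a by (intro power_mono) (auto simp: c_def field_simps)
  then have cn: "c\<^sup>2 * (2 * real n + 2) \<le> 1" by (simp add: power_mult_distrib)
  have small: "real n * b\<^sup>2 \<le> 1 / 2" "b < 1" if "0 \<le> b" "b \<le> c" for b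
  proof -
    have "b\<^sup>2 \<le> c\<^sup>2" using that by (intro power_mono) auto
    then have *: "b\<^sup>2 * (2 * real n + 2) \<le> 1" using cn mult_right_mono[of "b\<^sup>2" "c\<^sup>2" "2 * real n + 2"] by linarith
    have e: "b\<^sup>2 * (2 * real n + 2) = 2 * (real n * b\<^sup>2) + 2 * b\<^sup>2" by (simp add: algebra_simps)
    then show "real n * b\<^sup>2 \<le> 1 / 2" using * zero_le_power2[of b] by linarith
    have "0 \<le> real n * b\<^sup>2" by simp
    then have "b\<^sup>2 < 1\<^sup>2" using * e unfolding one_power2 by linarith
    then show "b < 1" by (rule power2_less_imp_less) simp
  qed
  define t where "t = (\<lambda>j. (1 + real j * c) * s)"
  have "\<bar>(\<integral>x. g x \<partial>gauss n m (t j)) - (\<integral>x. g x \<partial>gauss n m s)\<bar> \<le> (A + 1) / 2 * real n * (real j * c)" if "j \<le> k" for j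
    using that
  proof (induction j)
    case 0
    then show ?case by (simp add: t_def)
  next
    case (Suc j)
    \<comment> \<open>The grid is arithmetic, whereas a step is measured relative to the current
      variance; the relative increment never exceeds \<open>c\<close>.\<close>
    define b where "b = c / (1 + real j * c)"
    have d: "1 \<le> 1 + real j * c" using c by simp
    then have d1: "0 < 1 + real j * c" and d0: "1 + real j * c \<noteq> 0" by linarith+
    have "c / (1 + real j * c) \<le> c / 1" using d1 by (intro divide_left_mono d c) simp
    then have b: "0 \<le> b" "b \<le> c" using c by (simp_all add: b_def)
    have "b * (1 + real j * c) = c" using d0 by (simp add: b_def)
    then have "(1 + real j * c) * (1 + b) = 1 + real (Suc j) * c"
      by (simp add: distrib_left distrib_right mult.commute)
    then have tb: "t (Suc j) = t j * (1 + b)"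
      by (simp add: t_def mult.commute mult.left_commute)
    have "real j * c \<le> real k * c" using Suc.prems c by (intro mult_right_mono) auto
    then have jc: "real j * c \<le> a" using k0 by (simp add: c_def)
    have t: "s \<le> t j" "t j \<le> (1 + a) * s"
      using mult_right_mono[OF d, of s] mult_right_mono[of "1 + real j * c" "1 + a" s] s jc
      unfolding t_def by simp_all
    have "\<bar>(\<integral>x. g x \<partial>gauss n m (t (Suc j))) - (\<integral>x. g x \<partial>gauss n m (t j))\<bar> \<le> (A + 1) / 2 * real n * b"
      unfolding tb
      by (rule gauss_variance_step[OF less_le_trans[OF s t(1)] b(1) small[OF b] g g2[OF t]])
    also have "\<dots> \<le> (A + 1) / 2 * real n * c" using A b by (intro mult_left_mono) auto
    finally have "\<bar>(\<integral>x. g x \<partial>gauss n m (t (Suc j))) - (\<integral>x. g x \<partial>gauss n m s)\<bar>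
        \<le> (A + 1) / 2 * real n * c + (A + 1) / 2 * real n * (real j * c)"
      using Suc.IH Suc.prems by linarith
    also have "\<dots> = (A + 1) / 2 * real n * (real (Suc j) * c)" by (simp add: distrib_left distrib_right)
    finally show ?case .
  qed
  from this[of k] show ?thesis using k0 by (simp add: t_def c_def)
qed

subsection \<open>Algebra of projection kernels\<close>

definition dot :: "nat \<Rightarrow> (nat \<Rightarrow> real) \<Rightarrow> (nat \<Rightarrow> real) \<Rightarrow> real" where
  "dot n x y = (\<Sum>i<n. x i * y i)"

lemma nsq_dot: "nsq n x = dot n x x"
  by (simp add: nsq_def dot_def power2_eq_square)

lemma dot_commute: "dot n x y = dot n y x"
  by (simp add: dot_def mult.commute)

lemma mul_add_cmult: "mul n h (\<lambda>j. a * x j + b * y j) i = a * mul n h x i + b * mul n h y i"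
  by (simp add: mul_def distrib_left sum.distrib sum_distrib_left ac_simps)

lemma mul_diff: "mul n h (\<lambda>j. x j - y j) i = mul n h x i - mul n h y i"
  using mul_add_cmult[of n h 1 x "-1" y i] by simp

lemma dot_mul: "dot n x (mul n h y) = (\<Sum>i<n. \<Sum>j<n. h i j * (x i * y j))"
  by (simp add: dot_def mul_def sum_distrib_left ac_simps)

lemma dot_mul_sym:
  assumes "projection n h"
  shows "dot n (mul n h x) y = dot n x (mul n h y)"
proof -
  have "dot n (mul n h x) y = (\<Sum>i<n. \<Sum>j<n. h i j * (y i * x j))"
    by (subst dot_commute) (rule dot_mul)
  also have "\<dots> = (\<Sum>j<n. \<Sum>i<n. h i j * (y i * x j))" by (rule sum.swap)
  also have "\<dots> = (\<Sum>j<n. \<Sum>i<n. h j i * (x j * y i))"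
    using projection_sym[OF assms] by (intro sum.cong refl) (simp add: mult.commute)
  also have "\<dots> = dot n x (mul n h y)" by (rule dot_mul[symmetric])
  finally show ?thesis .
qed

lemma mul_idem:
  assumes "projection n h" "i < n"
  shows "mul n h (mul n h x) i = mul n h x i"
proof -
  have "mul n h (mul n h x) i = (\<Sum>k<n. \<Sum>j<n. h i k * h k j * x j)"
    by (simp add: mul_def sum_distrib_left mult.assoc)
  also have "\<dots> = (\<Sum>j<n. (\<Sum>k<n. h i k * h k j) * x j)"
    by (subst sum.swap) (simp add: sum_distrib_right)
  also have "\<dots> = mul n h x i"
    using projection_idem[OF assms] by (simp add: mul_def)
  finally show ?thesis .
qed

lemma dot_mul_mul:
  assumes "projection n h"
  shows "dot n (mul n h x) (mul n h y) = dot n x (mul n h y)"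
  unfolding dot_mul_sym[OF assms] by (simp add: dot_def mul_idem[OF assms])

lemma dot_residual:
  assumes "projection n h"
  shows "dot n (\<lambda>i. x i - mul n h x i) (mul n h y) = 0"
  using dot_mul_mul[OF assms, of x y] by (simp add: dot_def left_diff_distrib sum_subtractf)

text \<open>Pythagoras for m - H y = (m - H m) - H (y - m): the first part is orthogonal to the
  range of H, the second lies in it.\<close>

lemma nsq_residual_fit:
  assumes h: "projection n h"
  shows "nsq n (\<lambda>i. m i - mul n h y i) = nsq n (\<lambda>i. m i - mul n h m i) + nsq n (mul n h (\<lambda>i. y i - m i))"
proof -
  let ?w = "\<lambda>i. m i - mul n h m i" and ?e = "mul n h (\<lambda>i. y i - m i)"
  have "nsq n (\<lambda>i. m i - mul n h y i) = (\<Sum>i<n. (?w i)\<^sup>2 + (?e i)\<^sup>2 - 2 * (?w i * ?e i))"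
    unfolding nsq_def by (intro sum.cong refl) (simp add: mul_diff power2_eq_square algebra_simps)
  also have "\<dots> = nsq n ?w + nsq n ?e - 2 * dot n ?w ?e"
    by (simp add: nsq_def dot_def sum.distrib sum_subtractf sum_distrib_left)
  finally show ?thesis using dot_residual[OF h] by simp
qed

text \<open>The coefficients are those of \<open>y = (u + \<alpha> v) / (1 + \<alpha>)\<close>, where \<open>u = y + \<omega>\<close> and \<open>v = y - \<omega> / \<alpha>\<close>.\<close>

lemma nsq_residual_rotated:
  fixes u v m :: "nat \<Rightarrow> real"
  assumes h: "projection n h" and \<alpha>: "0 < \<alpha>"
  defines "a \<equiv> (\<lambda>i. u i - m i)" and "b \<equiv> (\<lambda>i. v i - m i)" and "w \<equiv> (\<lambda>i. m i - mul n h m i)"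
    and "c \<equiv> 1 / (1 + \<alpha>)"
  shows "nsq n (\<lambda>i. v i - mul n h (\<lambda>j. (u j + \<alpha> * v j) / (1 + \<alpha>)) i)
    = nsq n b + 2 * dot n b w - 2 * c\<^sup>2 * dot n b (mul n h a) + nsq n w + c\<^sup>2 * nsq n (mul n h a)
      + (c\<^sup>2 - 1) * dot n b (mul n h b)"
proof -
  let ?A = "mul n h a" and ?B = "mul n h b"
  define d where "d = c * \<alpha>"
  have cd: "c + d = 1" using \<alpha> by (simp add: c_def d_def add_divide_distrib[symmetric])
  have "(\<lambda>j. (u j + \<alpha> * v j) / (1 + \<alpha>)) = (\<lambda>j. c * u j + d * v j)"
    by (auto simp: c_def d_def add_divide_distrib)
  then have e: "v i - mul n h (\<lambda>j. (u j + \<alpha> * v j) / (1 + \<alpha>)) i = b i + w i - c * ?A i - d * ?B i" for i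
  proof -
    have "m i - mul n h m i = m i - (c + d) * mul n h m i" by (simp add: cd)
    then show ?thesis
      unfolding \<open>(\<lambda>j. (u j + \<alpha> * v j) / (1 + \<alpha>)) = _\<close> mul_add_cmult a_def b_def w_def mul_diff
      by (simp add: algebra_simps)
  qed
  have "nsq n (\<lambda>i. v i - mul n h (\<lambda>j. (u j + \<alpha> * v j) / (1 + \<alpha>)) i)
      = (\<Sum>i<n. (b i)\<^sup>2 + (w i)\<^sup>2 + c\<^sup>2 * (?A i)\<^sup>2 + d\<^sup>2 * (?B i)\<^sup>2 + 2 * (b i * w i) + (- 2 * c) * (b i * ?A i)
        + (- 2 * d) * (b i * ?B i) + (- 2 * c) * (w i * ?A i) + (- 2 * d) * (w i * ?B i) + (2 * c * d) * (?A i * ?B i))"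
    unfolding nsq_def e by (intro sum.cong refl) (simp add: power2_eq_square algebra_simps)
  also have "\<dots> = nsq n b + nsq n w + c\<^sup>2 * nsq n ?A + d\<^sup>2 * nsq n ?B + 2 * dot n b w + (- 2 * c) * dot n b ?A
        + (- 2 * d) * dot n b ?B + (- 2 * c) * dot n w ?A + (- 2 * d) * dot n w ?B + (2 * c * d) * dot n ?A ?B"
    by (simp only: nsq_def dot_def sum.distrib sum_distrib_left)
  also have "dot n w ?A = 0" unfolding w_def by (rule dot_residual[OF h])
  also have "dot n w ?B = 0" unfolding w_def by (rule dot_residual[OF h])
  also have "nsq n ?B = dot n b ?B" unfolding nsq_dot by (rule dot_mul_mul[OF h])
  also have "dot n ?A ?B = dot n b ?A" by (subst dot_commute) (rule dot_mul_mul[OF h])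
  \<comment> \<open>Because c + d = 1, the coefficients collapse: d^2 - 2 d = c^2 - 1 and 2 c d - 2
    c = -2 c^2.\<close>
  also have d: "d = 1 - c" using cd by simp
  finally show ?thesis by (simp add: power2_eq_square algebra_simps)
qed

lemma gauss_nsq:
  assumes v: "0 < v"
  shows "integrable (gauss n m v) (\<lambda>x. nsq n (\<lambda>i. x i - m i))"
    and "(\<integral>x. nsq n (\<lambda>i. x i - m i) \<partial>gauss n m v) = real n * v"
  using gauss_products(3,4)[OF v] unfolding nsq_dot dot_def by auto

lemma gauss_dot:
  assumes v: "0 < v"
  shows "integrable (gauss n m v) (\<lambda>x. dot n (\<lambda>i. x i - m i) w)"
    and "(\<integral>x. dot n (\<lambda>i. x i - m i) w \<partial>gauss n m v) = 0"
    and "integrable (gauss n m v) (\<lambda>x. (dot n (\<lambda>i. x i - m i) w)\<^sup>2)"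
    and "(\<integral>x. (dot n (\<lambda>i. x i - m i) w)\<^sup>2 \<partial>gauss n m v) = v * nsq n w"
  using gauss_linear[OF v, where a = w] gauss_linear_sq[OF v, where a = w]
  by (simp_all add: dot_commute[of n _ w] dot_def[of n w] nsq_def)

lemma gauss_dot_mul:
  assumes v: "0 < v"
  shows "integrable (gauss n m v) (\<lambda>x. dot n (\<lambda>i. x i - m i) (mul n h (\<lambda>i. x i - m i)))"
    and "(\<integral>x. dot n (\<lambda>i. x i - m i) (mul n h (\<lambda>i. x i - m i)) \<partial>gauss n m v) = v * tr n h"
  using gauss_quadratic[OF v, where A = h] by (simp_all add: dot_mul tr_def)

lemma gauss_nsq_shift:
  assumes v: "0 < v"
  shows "integrable (gauss n m v) (\<lambda>x. nsq n (\<lambda>i. x i - z i))"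
    and "(\<integral>x. nsq n (\<lambda>i. x i - z i) \<partial>gauss n m v) = real n * v + nsq n (\<lambda>i. m i - z i)"
proof -
  interpret prob_space "gauss n m v" by (rule prob_space_gauss[OF v])
  have e: "(\<lambda>x. nsq n (\<lambda>i. x i - z i))
      = (\<lambda>x. nsq n (\<lambda>i. x i - m i) + 2 * dot n (\<lambda>i. x i - m i) (\<lambda>i. m i - z i) + nsq n (\<lambda>i. m i - z i))"
  proof
    fix x :: "nat \<Rightarrow> real"
    have "nsq n (\<lambda>i. x i - z i) = (\<Sum>i<n. (x i - m i)\<^sup>2 + 2 * ((x i - m i) * (m i - z i)) + (m i - z i)\<^sup>2)"
      unfolding nsq_def by (intro sum.cong refl) (simp add: power2_eq_square algebra_simps)
    then show "nsq n (\<lambda>i. x i - z i)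
      = nsq n (\<lambda>i. x i - m i) + 2 * dot n (\<lambda>i. x i - m i) (\<lambda>i. m i - z i) + nsq n (\<lambda>i. m i - z i)"
      by (simp add: nsq_def dot_def sum.distrib sum_distrib_left)
  qed
  show "integrable (gauss n m v) (\<lambda>x. nsq n (\<lambda>i. x i - z i))"
    unfolding e using gauss_nsq[OF v] gauss_dot[OF v] by simp
  show "(\<integral>x. nsq n (\<lambda>i. x i - z i) \<partial>gauss n m v) = real n * v + nsq n (\<lambda>i. m i - z i)"
    unfolding e using gauss_nsq[OF v] gauss_dot[OF v] prob_space by simp
qed

text \<open>Symmetry and idempotence replace b by its projection. Without this the bound would
  contain the full norm of b, whose second moment is of order n^2 and not n.\<close>

lemma abs_dot_mul_le:
  assumes h: "projection n h"
  shows "2 * \<bar>dot n b (mul n h a)\<bar> \<le> nsq n (mul n h a) + nsq n (mul n h b)"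
proof -
  let ?A = "mul n h a" and ?B = "mul n h b"
  have d: "dot n b ?A = dot n ?B ?A" by (rule dot_mul_mul[OF h, symmetric])
  have "2 * \<bar>dot n ?B ?A\<bar> \<le> 2 * (\<Sum>i<n. \<bar>?B i * ?A i\<bar>)"
    unfolding dot_def by (intro mult_left_mono sum_abs) simp
  also have "\<dots> \<le> (\<Sum>i<n. (?A i)\<^sup>2 + (?B i)\<^sup>2)"
    unfolding sum_distrib_left
  proof (rule sum_mono)
    fix i
    show "2 * \<bar>?B i * ?A i\<bar> \<le> (?A i)\<^sup>2 + (?B i)\<^sup>2"
      using sum_squares_bound[of "\<bar>?A i\<bar>" "\<bar>?B i\<bar>"] by (simp add: abs_mult ac_simps)
  qed
  finally show ?thesis by (simp add: d nsq_def sum.distrib)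
qed

subsection \<open>Risk of the randomised selection\<close>

lemma integrable_of_nn_integral_le:
  fixes f :: "'a \<Rightarrow> real"
  assumes "f \<in> borel_measurable M" "\<And>x. 0 \<le> f x" "0 \<le> c" "(\<integral>\<^sup>+x. ennreal (f x) \<partial>M) \<le> ennreal c"
  shows "integrable M f" "(\<integral>x. f x \<partial>M) \<le> c"
proof -
  show "integrable M f"
    using assms by (intro integrableI_nonneg) (auto simp: top_unique intro: le_less_trans)
  show "(\<integral>x. f x \<partial>M) \<le> c"
    using assms by (subst integral_eq_nn_integral) (auto intro: enn2real_leI)
qed

lemma square_sum3: "(x + y + z)\<^sup>2 \<le> 3 * (x\<^sup>2 + y\<^sup>2 + z\<^sup>2)" for x y z :: real
proof -
  have "3 * (x\<^sup>2 + y\<^sup>2 + z\<^sup>2) - (x + y + z)\<^sup>2 = (x - y)\<^sup>2 + (y - z)\<^sup>2 + (x - z)\<^sup>2"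
    by (simp add: power2_eq_square algebra_simps)
  then show ?thesis using zero_le_power2[of "x - y"] zero_le_power2[of "y - z"] zero_le_power2[of "x - z"] by linarith
qed

lemma square_sum2: "(x + y)\<^sup>2 \<le> 2 * (x\<^sup>2 + y\<^sup>2)" for x y :: real
proof -
  have "2 * (x\<^sup>2 + y\<^sup>2) - (x + y)\<^sup>2 = (x - y)\<^sup>2" by (simp add: power2_eq_square algebra_simps)
  then show ?thesis using zero_le_power2[of "x - y"] by linarith
qed

lemma square_sum4: "(x + y + z + w)\<^sup>2 \<le> 4 * (x\<^sup>2 + y\<^sup>2 + z\<^sup>2 + w\<^sup>2)" for x y z w :: real
  using square_sum2[of "x + y" "z + w"] square_sum2[of x y] square_sum2[of z w] by (simp add: add.assoc)

text \<open>The probabilistic core, with a selection \<open>S\<close> that is Borel measurable into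
  a finite set of models, so that all laws are ordinary product measures without completion.\<close>

locale projection_selection =
  fixes n :: nat and \<M> :: "'m set" and S :: "(nat \<Rightarrow> real) \<Rightarrow> 'm" and h :: "'m \<Rightarrow> nat \<Rightarrow> nat \<Rightarrow> real"
    and \<mu> :: "nat \<Rightarrow> real" and s k :: real
  assumes s_pos: "0 < s" and fin: "finite \<M>" and nonempty: "\<M> \<noteq> {}" and k_nonneg: "0 \<le> k"
    and S_meas: "S \<in> measurable (Pi\<^sub>M {..<n} (\<lambda>_. borel)) (count_space \<M>)"
    and proj: "\<And>M. M \<in> \<M> \<Longrightarrow> projection n (h M)" and tr_le: "\<And>M. M \<in> \<M> \<Longrightarrow> tr n (h M) \<le> k"
begin

definition bias_term :: "(nat \<Rightarrow> real) \<Rightarrow> real" where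
  "bias_term u = nsq n (\<lambda>i. \<mu> i - mul n (h (S u)) \<mu> i)"

definition fit_term :: "(nat \<Rightarrow> real) \<Rightarrow> real" where
  "fit_term u = nsq n (mul n (h (S u)) (\<lambda>i. u i - \<mu> i))"

text \<open>The conditional mean of ||\<mu> - H y||^2 given u, with H selected from u. Given u, the
  vector y = (u + \<alpha> v)/(1 + \<alpha>) has mean \<mu> + (u - \<mu>)/(1 + \<alpha>) and
  variance s \<alpha>/(1 + \<alpha>) per coordinate. At \<alpha> = 0 it is the loss with H selected
  from y itself.\<close>

definition risk :: "real \<Rightarrow> (nat \<Rightarrow> real) \<Rightarrow> real" where
  "risk \<alpha> u = bias_term u + (1 / (1 + \<alpha>))\<^sup>2 * fit_term u + s * (\<alpha> / (1 + \<alpha>)) * tr n (h (S u))"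

definition est :: "real \<Rightarrow> (nat \<Rightarrow> real) \<Rightarrow> (nat \<Rightarrow> real) \<Rightarrow> real" where
  "est \<alpha> u v = nsq n (\<lambda>i. v i - mul n (h (S u)) (\<lambda>j. (u j + \<alpha> * v j) / (1 + \<alpha>)) i)
     + 2 * tr n (h (S u)) * s - real n * s / \<alpha>"

text \<open>Centring at the irreducible noise n s, which \<open>Err\<close> also contains, leaves a
  quantity whose second moment is of order n/\<alpha>^2.\<close>

definition dev :: "real \<Rightarrow> (nat \<Rightarrow> real) \<Rightarrow> (nat \<Rightarrow> real) \<Rightarrow> real" where
  "dev \<alpha> u v = est \<alpha> u v - real n * s"

text \<open>The bound of \<open>projection_envelope\<close> at unit variance; for variance v it
  scales by v^2.\<close>

definition \<Lambda> :: real where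
  "\<Lambda> = (4 * k)\<^sup>2 * (2 * (ln (sqrt 2 * card \<M>))\<^sup>2 + 4)"

lemma \<Lambda>_nonneg: "0 \<le> \<Lambda>"
  by (simp add: \<Lambda>_def)

lemma S_in: "u \<in> Rn n \<Longrightarrow> S u \<in> \<M>"
  using measurable_space[OF S_meas, of u] by (simp add: space_PiM)

lemma hS_meas[measurable]: "(\<lambda>u. h (S u) i j) \<in> borel_measurable (Pi\<^sub>M {..<n} (\<lambda>_. borel))"
  by (rule measurable_compose[OF S_meas, of "\<lambda>M. h M i j"]) simp

lemma trS_meas[measurable]: "(\<lambda>u. tr n (h (S u))) \<in> borel_measurable (Pi\<^sub>M {..<n} (\<lambda>_. borel))"
  unfolding tr_def by measurable

lemma bias_term_meas[measurable]: "bias_term \<in> borel_measurable (Pi\<^sub>M {..<n} (\<lambda>_. borel))"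
  unfolding bias_term_def[abs_def] nsq_def mul_def by measurable

lemma fit_term_meas[measurable]: "fit_term \<in> borel_measurable (Pi\<^sub>M {..<n} (\<lambda>_. borel))"
  unfolding fit_term_def[abs_def] nsq_def mul_def by measurable

lemma est_meas:
  "(\<lambda>z. est \<alpha> (fst z) (snd z)) \<in> borel_measurable (Pi\<^sub>M {..<n} (\<lambda>_. borel) \<Otimes>\<^sub>M Pi\<^sub>M {..<n} (\<lambda>_. borel))"
  unfolding est_def nsq_def mul_def by measurable

lemma bias_term_nonneg: "0 \<le> bias_term u" and fit_term_nonneg: "0 \<le> fit_term u"
  by (simp_all add: bias_term_def fit_term_def nsq_nonneg)

lemma tr_bounds: "u \<in> Rn n \<Longrightarrow> 0 \<le> tr n (h (S u))" "u \<in> Rn n \<Longrightarrow> tr n (h (S u)) \<le> k"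
  using projection_tr_nonneg[OF proj] tr_le S_in by auto

text \<open>Finitely many models leave finitely many values, so the bias term is bounded. Only
  integrability is obtained in this way; quantitative bounds come from the accuracy
  condition.\<close>

lemma bias_term_integrable:
  assumes v: "0 < v"
  shows "integrable (gauss n m v) (\<lambda>u. (bias_term u)\<^sup>2)" "integrable (gauss n m v) bias_term"
proof -
  interpret prob_space "gauss n m v" by (rule prob_space_gauss[OF v])
  define C where "C = (\<Sum>M\<in>\<M>. nsq n (\<lambda>i. \<mu> i - mul n (h M) \<mu> i))"
  have C: "bias_term u \<le> C" if "u \<in> Rn n" for u
    unfolding C_def bias_term_def using S_in[OF that] fin by (intro member_le_sum) (auto simp: nsq_nonneg)
  show 2: "integrable (gauss n m v) (\<lambda>u. (bias_term u)\<^sup>2)"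
    by (rule integrable_const_bound[of _ "C\<^sup>2"])
       (auto intro!: AE_I2 power_mono C simp: space_gauss bias_term_nonneg)
  show "integrable (gauss n m v) bias_term"
    by (rule square_integrable_imp_integrable[OF _ 2]) measurable
qed

lemma envelope:
  assumes v: "0 < v"
  shows "\<exists>R. integrable (gauss n \<mu> v) R \<and> (\<forall>x. 0 \<le> R x) \<and> (\<integral>x. R x \<partial>gauss n \<mu> v) \<le> v\<^sup>2 * \<Lambda>
    \<and> (\<forall>x. \<forall>M\<in>\<M>. (nsq n (mul n (h M) (\<lambda>i. x i - \<mu> i)))\<^sup>2 \<le> R x)"
proof (rule projection_envelope[where m = \<mu> and h = h and n = n and k = k, OF v fin nonempty])
  fix R assume R: "R \<in> borel_measurable (Pi\<^sub>M {..<n} (\<lambda>_. borel))" "\<And>x. 0 \<le> R x"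
    "\<And>x M. M \<in> \<M> \<Longrightarrow> (nsq n (mul n (h M) (\<lambda>i. x i - \<mu> i)))\<^sup>2 \<le> R x"
    "(\<integral>\<^sup>+x. ennreal (R x) \<partial>gauss n \<mu> v) \<le> ennreal ((4 * v * k)\<^sup>2 * (2 * (ln (sqrt 2 * card \<M>))\<^sup>2 + 4))"
  have c: "(4 * v * k)\<^sup>2 * (2 * (ln (sqrt 2 * card \<M>))\<^sup>2 + 4) = v\<^sup>2 * \<Lambda>"
    by (simp add: \<Lambda>_def power_mult_distrib)
  have m: "R \<in> borel_measurable (gauss n \<mu> v)" using R(1) by (simp add: measurable_cong_sets[OF sets_gauss refl])
  have "0 \<le> v\<^sup>2 * \<Lambda>" using \<Lambda>_nonneg by simp
  from integrable_of_nn_integral_le[OF m R(2) this R(4)[unfolded c]] R(2,3)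
  show ?thesis by blast
qed (simp_all add: proj tr_le)

text \<open>\<open>S u\<close> depends on the same vector as the noise, so the moment of a fixed
  projection says nothing; the envelope dominates whichever model is selected.\<close>

lemma fit_term_moment:
  assumes v: "0 < v"
  shows "integrable (gauss n \<mu> v) (\<lambda>u. (fit_term u)\<^sup>2)" "integrable (gauss n \<mu> v) fit_term"
    and "(\<integral>u. (fit_term u)\<^sup>2 \<partial>gauss n \<mu> v) \<le> v\<^sup>2 * \<Lambda>"
proof -
  obtain R where R: "integrable (gauss n \<mu> v) R" "\<And>x. 0 \<le> R x" "(\<integral>x. R x \<partial>gauss n \<mu> v) \<le> v\<^sup>2 * \<Lambda>"
    "\<And>x M. M \<in> \<M> \<Longrightarrow> (nsq n (mul n (h M) (\<lambda>i. x i - \<mu> i)))\<^sup>2 \<le> R x"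
    using envelope[OF v] by metis
  interpret prob_space "gauss n \<mu> v" by (rule prob_space_gauss[OF v])
  have le: "(fit_term u)\<^sup>2 \<le> R u" if "u \<in> space (gauss n \<mu> v)" for u
    unfolding fit_term_def using that by (intro R S_in) (simp add: space_gauss)
  show 1: "integrable (gauss n \<mu> v) (\<lambda>u. (fit_term u)\<^sup>2)"
    by (rule Bochner_Integration.integrable_bound[OF R(1)]) (use le R(2) in \<open>auto intro!: AE_I2\<close>)
  show "integrable (gauss n \<mu> v) fit_term"
    by (rule square_integrable_imp_integrable[OF _ 1]) measurable
  have "(\<integral>u. (fit_term u)\<^sup>2 \<partial>gauss n \<mu> v) \<le> (\<integral>u. R u \<partial>gauss n \<mu> v)"
    by (rule integral_mono[OF 1 R(1) le])
  with R(3) show "(\<integral>u. (fit_term u)\<^sup>2 \<partial>gauss n \<mu> v) \<le> v\<^sup>2 * \<Lambda>" by simp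
qed

text \<open>The centring n s and the correction n s/\<alpha> add up to the mean of ||v - \<mu>||^2,
  so the first bracket is a centred chi-square term.\<close>

lemma dev_expand:
  assumes \<alpha>: "0 < \<alpha>" and u: "u \<in> Rn n"
  defines "a \<equiv> (\<lambda>i. u i - \<mu> i)" and "b \<equiv> (\<lambda>v i. v i - \<mu> i)" and "w \<equiv> (\<lambda>i. \<mu> i - mul n (h (S u)) \<mu> i)"
    and "c \<equiv> 1 / (1 + \<alpha>)"
  shows "dev \<alpha> u v = (nsq n (b v) - real n * ((1 + 1 / \<alpha>) * s)) + 2 * dot n (b v) w
    - 2 * c\<^sup>2 * dot n (b v) (mul n (h (S u)) a) + bias_term u + c\<^sup>2 * fit_term u
    + (c\<^sup>2 - 1) * dot n (b v) (mul n (h (S u)) (b v)) + 2 * s * tr n (h (S u))"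
proof -
  have "real n * ((1 + 1 / \<alpha>) * s) = real n * s + real n * s / \<alpha>"
    by (simp add: distrib_left distrib_right)
  then show ?thesis
    unfolding dev_def est_def nsq_residual_rotated[OF proj[OF S_in[OF u]] \<alpha>, where m = \<mu>] a_def b_def c_def w_def
      bias_term_def fit_term_def
    by (simp add: algebra_simps)
qed

lemma variance_pos: "0 < \<alpha> \<Longrightarrow> 0 < (1 + 1 / \<alpha>) * s" "0 \<le> \<alpha> \<Longrightarrow> 0 < (1 + \<alpha>) * s"
  using s_pos by (simp_all add: add_pos_nonneg)

text \<open>At fixed u the centred and linear terms in v - \<mu> integrate to 0 and the quadratic
  form leaves a multiple of the trace. Combined with the correction 2 s tr, exactly the trace term
  of \<open>risk\<close> remains, so the estimator is unbiased for every \<alpha> and not merely in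
  the limit.\<close>

lemma dev_mean:
  assumes \<alpha>: "0 < \<alpha>" and u: "u \<in> Rn n"
  shows "(\<integral>v. dev \<alpha> u v \<partial>gauss n \<mu> ((1 + 1 / \<alpha>) * s)) = risk \<alpha> u"
proof -
  define t where "t = (1 + 1 / \<alpha>) * s"
  have t: "0 < t" using variance_pos(1)[OF \<alpha>] by (simp add: t_def)
  interpret prob_space "gauss n \<mu> t" by (rule prob_space_gauss[OF t])
  let ?c = "1 / (1 + \<alpha>)" and ?b = "\<lambda>v i. v i - \<mu> i" and ?H = "h (S u)" and ?w = "\<lambda>i. \<mu> i - mul n (h (S u)) \<mu> i"
  define f1 where "f1 = (\<lambda>v. nsq n (?b v) - real n * t)"
  define f2 where "f2 = (\<lambda>v. 2 * dot n (?b v) ?w)"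
  define f3 where "f3 = (\<lambda>v. 2 * ?c\<^sup>2 * dot n (?b v) (mul n ?H (?b u)))"
  define f4 where "f4 = (\<lambda>v. (?c\<^sup>2 - 1) * dot n (?b v) (mul n ?H (?b v)))"
  have i: "integrable (gauss n \<mu> t) f1" "integrable (gauss n \<mu> t) f2"
    "integrable (gauss n \<mu> t) f3" "integrable (gauss n \<mu> t) f4"
    unfolding f1_def f2_def f3_def f4_def
    using gauss_nsq(1)[OF t] gauss_dot(1)[OF t] gauss_dot_mul(1)[OF t] by auto
  have E: "(\<integral>v. f1 v \<partial>gauss n \<mu> t) = 0" "(\<integral>v. f2 v \<partial>gauss n \<mu> t) = 0" "(\<integral>v. f3 v \<partial>gauss n \<mu> t) = 0"
    "(\<integral>v. f4 v \<partial>gauss n \<mu> t) = (?c\<^sup>2 - 1) * (t * tr n ?H)"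
    unfolding f1_def f2_def f3_def f4_def
    using gauss_nsq[OF t] gauss_dot[OF t] gauss_dot_mul[OF t] prob_space by simp_all
  define K where "K = bias_term u + ?c\<^sup>2 * fit_term u + 2 * s * tr n ?H"
  have "dev \<alpha> u v = f1 v + f2 v - f3 v + f4 v + K" for v
    unfolding dev_expand[OF \<alpha> u] t_def[symmetric] f1_def f2_def f3_def f4_def K_def by simp
  then have "(\<integral>v. dev \<alpha> u v \<partial>gauss n \<mu> t) = (?c\<^sup>2 - 1) * (t * tr n ?H) + K"
    using i E prob_space by simp
  then have "(\<integral>v. dev \<alpha> u v \<partial>gauss n \<mu> t)
      = bias_term u + ?c\<^sup>2 * fit_term u + (?c\<^sup>2 - 1) * (t * tr n ?H) + 2 * s * tr n ?H"
    by (simp add: K_def)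
  \<comment> \<open>With c = 1/(1 + \<alpha>) one has (1 - c) t = s, hence (c^2 - 1) t = -(1 + c)
    s.\<close>
  also have "(?c\<^sup>2 - 1) * t = s * (\<alpha> / (1 + \<alpha>)) - 2 * s"
  proof -
    have nz: "\<alpha> \<noteq> 0" "1 + \<alpha> \<noteq> 0" using \<alpha> by auto
    have q: "\<alpha> / (1 + \<alpha>) = 1 - ?c" using nz by (simp add: field_simps)
    have "1 + 1 / \<alpha> = (1 + \<alpha>) / \<alpha>" using nz by (simp add: field_simps)
    then have "\<alpha> / (1 + \<alpha>) * t = s" using nz by (simp add: t_def)
    then have "(1 - ?c) * t = s" by (simp only: q)
    moreover have "(x\<^sup>2 - 1) * t = - (1 + x) * ((1 - x) * t)" "s * (1 - x) - 2 * s = - (1 + x) * s" for x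
      by (simp_all add: power2_eq_square algebra_simps)
    ultimately show ?thesis by (simp only: q)
  qed
  then have "(?c\<^sup>2 - 1) * (t * tr n ?H) = (s * (\<alpha> / (1 + \<alpha>)) - 2 * s) * tr n ?H"
    by (simp only: mult.assoc[symmetric])
  finally show ?thesis by (simp add: risk_def t_def algebra_simps)
qed

text \<open>Three parts: the centred chi-square term, the cross term of the noise with the bias
  vector, and a remainder \<open>z\<close> that depends on noise only through projections. Squaring
  a sum of three, and \<open>z\<close> as a sum of four, gives the factors 12 = 3 * 4 and 48 = 3 *
  16.\<close>

lemma dev_square_le:
  assumes \<alpha>: "0 < \<alpha>" and u: "u \<in> Rn n"
  shows "(dev \<alpha> u v)\<^sup>2 \<le> 3 * (nsq n (\<lambda>i. v i - \<mu> i) - real n * ((1 + 1 / \<alpha>) * s))\<^sup>2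
    + 12 * (dot n (\<lambda>i. v i - \<mu> i) (\<lambda>i. \<mu> i - mul n (h (S u)) \<mu> i))\<^sup>2
    + 48 * (nsq n (mul n (h (S u)) (\<lambda>i. v i - \<mu> i)))\<^sup>2
    + (12 * (bias_term u)\<^sup>2 + 48 * (fit_term u)\<^sup>2 + 48 * (s * k)\<^sup>2)"
proof -
  let ?c = "1 / (1 + \<alpha>)" and ?b = "\<lambda>i. v i - \<mu> i" and ?a = "\<lambda>i. u i - \<mu> i" and ?H = "h (S u)"
    and ?w = "\<lambda>i. \<mu> i - mul n (h (S u)) \<mu> i"
  let ?Qb = "nsq n (mul n ?H ?b)"
  have P: "projection n ?H" by (rule proj[OF S_in[OF u]])
  have c: "0 \<le> ?c\<^sup>2" "?c\<^sup>2 \<le> 1" using \<alpha> by (auto simp: power_le_one_iff divide_le_eq)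
  define z where "z = - 2 * ?c\<^sup>2 * dot n ?b (mul n ?H ?a) + bias_term u + ?c\<^sup>2 * fit_term u
    + (?c\<^sup>2 - 1) * dot n ?b (mul n ?H ?b) + 2 * s * tr n ?H"
  have e: "dev \<alpha> u v = (nsq n ?b - real n * ((1 + 1 / \<alpha>) * s)) + 2 * dot n ?b ?w + z"
    unfolding dev_expand[OF \<alpha> u] z_def by simp
  have bb: "dot n ?b (mul n ?H ?b) = ?Qb" unfolding nsq_dot by (rule dot_mul_mul[OF P, symmetric])
  have aa: "fit_term u = nsq n (mul n ?H ?a)" by (simp add: fit_term_def)
  have "\<bar>2 * ?c\<^sup>2 * dot n ?b (mul n ?H ?a)\<bar> \<le> fit_term u + ?Qb"
  proof -
    have "\<bar>2 * ?c\<^sup>2 * dot n ?b (mul n ?H ?a)\<bar> = ?c\<^sup>2 * (2 * \<bar>dot n ?b (mul n ?H ?a)\<bar>)" by (simp add: abs_mult)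
    also have "\<dots> \<le> 1 * (fit_term u + ?Qb)"
      unfolding aa by (intro mult_mono c abs_dot_mul_le[OF P]) auto
    finally show ?thesis by simp
  qed
  moreover have "0 \<le> ?c\<^sup>2 * fit_term u" "?c\<^sup>2 * fit_term u \<le> fit_term u"
    using c fit_term_nonneg[of u] by (simp_all only: mult_nonneg_nonneg mult_left_le_one_le)
  moreover have "0 \<le> ?c\<^sup>2 * ?Qb" "?c\<^sup>2 * ?Qb \<le> ?Qb"
    using c nsq_nonneg[of n "mul n ?H ?b"] by (simp_all only: mult_nonneg_nonneg mult_left_le_one_le)
  moreover have "(?c\<^sup>2 - 1) * dot n ?b (mul n ?H ?b) = ?c\<^sup>2 * ?Qb - ?Qb" by (simp add: bb left_diff_distrib)
  moreover have "0 \<le> s * tr n ?H" "s * tr n ?H \<le> s * k"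
    using tr_bounds[OF u] s_pos by (simp_all add: mult_left_mono)
  ultimately have "\<bar>z\<bar> \<le> bias_term u + 2 * fit_term u + 2 * ?Qb + 2 * (s * k)"
    unfolding z_def using bias_term_nonneg[of u] by linarith
  then have "z\<^sup>2 \<le> (bias_term u + 2 * fit_term u + 2 * ?Qb + 2 * (s * k))\<^sup>2"
    by (metis abs_ge_zero power2_abs power_mono)
  also have "\<dots> \<le> 4 * ((bias_term u)\<^sup>2 + (2 * fit_term u)\<^sup>2 + (2 * ?Qb)\<^sup>2 + (2 * (s * k))\<^sup>2)"
    by (rule square_sum4)
  finally have z: "z\<^sup>2 \<le> 4 * (bias_term u)\<^sup>2 + 16 * (fit_term u)\<^sup>2 + 16 * ?Qb\<^sup>2 + 16 * (s * k)\<^sup>2"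
    by (simp only: power_mult_distrib) simp
  have "(dev \<alpha> u v)\<^sup>2 \<le> 3 * ((nsq n ?b - real n * ((1 + 1 / \<alpha>) * s))\<^sup>2 + (2 * dot n ?b ?w)\<^sup>2 + z\<^sup>2)"
    unfolding e by (rule square_sum3)
  moreover have "(2 * dot n ?b ?w)\<^sup>2 = 4 * (dot n ?b ?w)\<^sup>2" by (simp add: power_mult_distrib)
  moreover have "d \<le> 3 * p + 12 * x + 48 * y + (12 * a + 48 * b + 48 * e)"
    if "d \<le> 3 * (p + q + r)" "q = 4 * x" "r \<le> 4 * a + 16 * b + 16 * y + 16 * e" for d p q r x a b y e :: real
  proof -
    have "d \<le> 3 * (p + 4 * x + r)" using that(1,2) by simp
    also have "\<dots> \<le> 3 * (p + 4 * x + (4 * a + 16 * b + 16 * y + 16 * e))" using that(3) by simp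
    also have "\<dots> = 3 * p + 12 * x + 48 * y + (12 * a + 48 * b + 48 * e)" by simp
    finally show ?thesis .
  qed
  ultimately show ?thesis using z by blast
qed

lemma dev_second_moment:
  assumes \<alpha>: "0 < \<alpha>" and u: "u \<in> Rn n"
  defines "t \<equiv> (1 + 1 / \<alpha>) * s"
  shows "(\<integral>\<^sup>+v. ennreal ((dev \<alpha> u v)\<^sup>2) \<partial>gauss n \<mu> t)
    \<le> ennreal (6 * real n * t\<^sup>2 + 12 * t * bias_term u + 48 * (t\<^sup>2 * \<Lambda>)
        + (12 * (bias_term u)\<^sup>2 + 48 * (fit_term u)\<^sup>2 + 48 * (s * k)\<^sup>2))"
proof -
  have t: "0 < t" using variance_pos(1)[OF \<alpha>] by (simp add: t_def)
  obtain R where R: "integrable (gauss n \<mu> t) R" "\<And>x. 0 \<le> R x" "(\<integral>x. R x \<partial>gauss n \<mu> t) \<le> t\<^sup>2 * \<Lambda>"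
    "\<And>x M. M \<in> \<M> \<Longrightarrow> (nsq n (mul n (h M) (\<lambda>i. x i - \<mu> i)))\<^sup>2 \<le> R x"
    using envelope[OF t] by metis
  interpret prob_space "gauss n \<mu> t" by (rule prob_space_gauss[OF t])
  let ?w = "\<lambda>i. \<mu> i - mul n (h (S u)) \<mu> i"
  define K where "K = 12 * (bias_term u)\<^sup>2 + 48 * (fit_term u)\<^sup>2 + 48 * (s * k)\<^sup>2"
  define f where "f = (\<lambda>v. 3 * (nsq n (\<lambda>i. v i - \<mu> i) - real n * t)\<^sup>2
    + 12 * (dot n (\<lambda>i. v i - \<mu> i) ?w)\<^sup>2 + 48 * R v + K)"
  note I = gauss_norm_variance[OF t, of n \<mu>, folded nsq_def] gauss_dot(3,4)[OF t, of n \<mu> ?w]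
  have f: "integrable (gauss n \<mu> t) f" unfolding f_def using I R(1) by simp
  have "(dev \<alpha> u v)\<^sup>2 \<le> f v" for v
  proof -
    have "d \<le> p + 48 * r + e" if "d \<le> p + 48 * q + e" "q \<le> r" for d p q r e :: real
      using that by linarith
    from this[OF dev_square_le[OF \<alpha> u, of v] R(4)[OF S_in[OF u], of v]]
    show ?thesis unfolding f_def K_def t_def .
  qed
  then have "(\<integral>\<^sup>+v. ennreal ((dev \<alpha> u v)\<^sup>2) \<partial>gauss n \<mu> t) \<le> (\<integral>\<^sup>+v. ennreal (f v) \<partial>gauss n \<mu> t)"
    by (intro nn_integral_mono ennreal_leI)
  also have "\<dots> = ennreal (\<integral>v. f v \<partial>gauss n \<mu> t)"
    using f R(2) by (intro nn_integral_eq_integral) (auto simp: f_def K_def)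
  \<comment> \<open>The chi-square term contributes 3 times 2 n t^2. The cross term has variance t
    times the squared norm of the bias vector, which is \<open>bias_term u\<close>.\<close>
  also have "(\<integral>v. f v \<partial>gauss n \<mu> t) = 6 * real n * t\<^sup>2 + 12 * t * bias_term u + 48 * (\<integral>v. R v \<partial>gauss n \<mu> t) + K"
    unfolding f_def using I R(1) prob_space by (simp add: bias_term_def)
  also have "ennreal \<dots> \<le> ennreal (6 * real n * t\<^sup>2 + 12 * t * bias_term u + 48 * (t\<^sup>2 * \<Lambda>) + K)"
    using R(3) by (intro ennreal_leI) linarith
  finally show ?thesis by (simp only: K_def)
qed

definition rotated_law :: "real \<Rightarrow> ((nat \<Rightarrow> real) \<times> (nat \<Rightarrow> real)) measure" where
  "rotated_law \<alpha> = gauss n \<mu> ((1 + \<alpha>) * s) \<Otimes>\<^sub>M gauss n \<mu> ((1 + 1 / \<alpha>) * s)"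

lemma sets_rotated_law[measurable_cong]:
  "sets (rotated_law \<alpha>) = sets (Pi\<^sub>M {..<n} (\<lambda>_. borel) \<Otimes>\<^sub>M Pi\<^sub>M {..<n} (\<lambda>_. borel))"
  unfolding rotated_law_def by (intro sets_pair_measure_cong sets_gauss)

lemma dev_meas[measurable]: "(\<lambda>z. dev \<alpha> (fst z) (snd z)) \<in> borel_measurable (rotated_law \<alpha>)"
  using est_meas[of \<alpha>] unfolding dev_def by measurable

text \<open>Tonelli yields the second moment without prior integrability; square integrability then
  licenses Fubini for the mean, which becomes the expected risk at the inflated variance
  \<tau>.\<close>

lemma rotated_law_moments:
  assumes \<alpha>: "0 < \<alpha>"
  defines "\<tau> \<equiv> (1 + \<alpha>) * s" and "t \<equiv> (1 + 1 / \<alpha>) * s"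
  assumes A: "(\<integral>u. (bias_term u)\<^sup>2 \<partial>gauss n \<mu> \<tau>) \<le> A"
  shows "prob_space (rotated_law \<alpha>)"
    and "integrable (rotated_law \<alpha>) (\<lambda>z. (dev \<alpha> (fst z) (snd z))\<^sup>2)"
    and "integrable (rotated_law \<alpha>) (\<lambda>z. dev \<alpha> (fst z) (snd z))"
    and "(\<integral>z. dev \<alpha> (fst z) (snd z) \<partial>rotated_law \<alpha>) = (\<integral>u. risk \<alpha> u \<partial>gauss n \<mu> \<tau>)"
    and "(\<integral>z. (dev \<alpha> (fst z) (snd z))\<^sup>2 \<partial>rotated_law \<alpha>)
      \<le> 6 * real n * t\<^sup>2 + 12 * t * (1 + A) + 48 * (t\<^sup>2 * \<Lambda>) + (12 * A + 48 * (\<tau>\<^sup>2 * \<Lambda>) + 48 * (s * k)\<^sup>2)"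
proof -
  have t: "0 < t" and \<tau>: "0 < \<tau>" using variance_pos \<alpha> by (simp_all add: t_def \<tau>_def)
  interpret T: prob_space "gauss n \<mu> t" by (rule prob_space_gauss[OF t])
  interpret U: prob_space "gauss n \<mu> \<tau>" by (rule prob_space_gauss[OF \<tau>])
  interpret P: pair_prob_space "gauss n \<mu> \<tau>" "gauss n \<mu> t" ..
  have L: "rotated_law \<alpha> = gauss n \<mu> \<tau> \<Otimes>\<^sub>M gauss n \<mu> t" by (simp add: rotated_law_def \<tau>_def t_def)
  show prob: "prob_space (rotated_law \<alpha>)" unfolding L by (rule P.prob_space_axioms)
  have m: "(\<lambda>z. dev \<alpha> (fst z) (snd z)) \<in> borel_measurable (gauss n \<mu> \<tau> \<Otimes>\<^sub>M gauss n \<mu> t)"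
    using dev_meas[of \<alpha>] unfolding L .
  define \<phi> where "\<phi> = (\<lambda>u. 6 * real n * t\<^sup>2 + 12 * t * bias_term u + 48 * (t\<^sup>2 * \<Lambda>)
        + (12 * (bias_term u)\<^sup>2 + 48 * (fit_term u)\<^sup>2 + 48 * (s * k)\<^sup>2))"
  have \<phi>0: "0 \<le> \<phi> u" for u
    unfolding \<phi>_def using t bias_term_nonneg[of u] \<Lambda>_nonneg by (intro add_nonneg_nonneg mult_nonneg_nonneg) auto
  have \<phi>: "integrable (gauss n \<mu> \<tau>) \<phi>"
    unfolding \<phi>_def using bias_term_integrable[OF \<tau>, of \<mu>] fit_term_moment(1)[OF \<tau>] by simp
  have "(\<integral>u. bias_term u \<partial>gauss n \<mu> \<tau>) \<le> (\<integral>u. 1 + (bias_term u)\<^sup>2 \<partial>gauss n \<mu> \<tau>)"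
  proof (rule integral_mono)
    show "bias_term u \<le> 1 + (bias_term u)\<^sup>2" for u
      using zero_le_power2[of "bias_term u - 1"] bias_term_nonneg[of u] unfolding power2_diff by simp
  qed (use bias_term_integrable[OF \<tau>, of \<mu>] in auto)
  then have bA: "(\<integral>u. bias_term u \<partial>gauss n \<mu> \<tau>) \<le> 1 + A"
    using bias_term_integrable[OF \<tau>, of \<mu>] A U.prob_space by simp
  have "(\<integral>u. \<phi> u \<partial>gauss n \<mu> \<tau>) = 6 * real n * t\<^sup>2 + 12 * t * (\<integral>u. bias_term u \<partial>gauss n \<mu> \<tau>) + 48 * (t\<^sup>2 * \<Lambda>)
        + (12 * (\<integral>u. (bias_term u)\<^sup>2 \<partial>gauss n \<mu> \<tau>) + 48 * (\<integral>u. (fit_term u)\<^sup>2 \<partial>gauss n \<mu> \<tau>) + 48 * (s * k)\<^sup>2)"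
    unfolding \<phi>_def using bias_term_integrable[OF \<tau>, of \<mu>] fit_term_moment(1)[OF \<tau>] U.prob_space by simp
  moreover have "12 * t * (\<integral>u. bias_term u \<partial>gauss n \<mu> \<tau>) \<le> 12 * t * (1 + A)"
    using bA t by (intro mult_left_mono) auto
  ultimately have \<phi>le: "(\<integral>u. \<phi> u \<partial>gauss n \<mu> \<tau>)
      \<le> 6 * real n * t\<^sup>2 + 12 * t * (1 + A) + 48 * (t\<^sup>2 * \<Lambda>) + (12 * A + 48 * (\<tau>\<^sup>2 * \<Lambda>) + 48 * (s * k)\<^sup>2)"
    (is "_ \<le> ?C") using A fit_term_moment(3)[OF \<tau>] by linarith
  have "(\<integral>\<^sup>+z. ennreal ((dev \<alpha> (fst z) (snd z))\<^sup>2) \<partial>rotated_law \<alpha>)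
      = (\<integral>\<^sup>+u. \<integral>\<^sup>+v. ennreal ((dev \<alpha> u v)\<^sup>2) \<partial>gauss n \<mu> t \<partial>gauss n \<mu> \<tau>)"
    unfolding L using m by (subst T.nn_integral_fst[symmetric]) auto
  also have "\<dots> \<le> (\<integral>\<^sup>+u. ennreal (\<phi> u) \<partial>gauss n \<mu> \<tau>)"
    unfolding \<phi>_def t_def by (intro nn_integral_mono dev_second_moment[OF \<alpha>]) (simp add: space_gauss)
  also have "\<dots> = ennreal (\<integral>u. \<phi> u \<partial>gauss n \<mu> \<tau>)"
    using \<phi> \<phi>0 by (intro nn_integral_eq_integral) auto
  also have "\<dots> \<le> ennreal ?C" using \<phi>le by (intro ennreal_leI)
  finally have le: "(\<integral>\<^sup>+z. ennreal ((dev \<alpha> (fst z) (snd z))\<^sup>2) \<partial>rotated_law \<alpha>) \<le> ennreal ?C" .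
  have "0 \<le> (\<integral>u. \<phi> u \<partial>gauss n \<mu> \<tau>)" using \<phi>0 by (intro integral_nonneg_AE) auto
  then have C0: "0 \<le> ?C" using \<phi>le by linarith
  show 2: "integrable (rotated_law \<alpha>) (\<lambda>z. (dev \<alpha> (fst z) (snd z))\<^sup>2)"
    and "(\<integral>z. (dev \<alpha> (fst z) (snd z))\<^sup>2 \<partial>rotated_law \<alpha>) \<le> ?C"
    using integrable_of_nn_integral_le[OF _ _ C0 le] by auto
  show 1: "integrable (rotated_law \<alpha>) (\<lambda>z. dev \<alpha> (fst z) (snd z))"
    using finite_measure.square_integrable_imp_integrable[OF prob_space.finite_measure[OF prob] dev_meas 2] .
  have "(\<integral>z. dev \<alpha> (fst z) (snd z) \<partial>rotated_law \<alpha>) = (\<integral>u. \<integral>v. dev \<alpha> u v \<partial>gauss n \<mu> t \<partial>gauss n \<mu> \<tau>)"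
    using P.integral_fst'[OF 1[unfolded L]] unfolding L by simp
  also have "\<dots> = (\<integral>u. risk \<alpha> u \<partial>gauss n \<mu> \<tau>)"
    unfolding t_def by (intro Bochner_Integration.integral_cong refl dev_mean[OF \<alpha>]) (simp add: space_gauss)
  finally show "(\<integral>z. dev \<alpha> (fst z) (snd z) \<partial>rotated_law \<alpha>) = (\<integral>u. risk \<alpha> u \<partial>gauss n \<mu> \<tau>)" .
qed

text \<open>The risk is split as g + q. The part g does not involve \<alpha> and feels it only
  through the variance of u, where the Lipschitz estimate applies; q carries explicit coefficients
  of order \<alpha>. The three summands of the constant belong to g, to the fit coefficient and to
  the trace coefficient.\<close>

lemma risk_variance_lipschitz:
  assumes \<alpha>: "0 \<le> \<alpha>" and \<delta>: "\<alpha> \<le> \<delta>" and A: "0 \<le> A"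
    and bA: "\<And>v. s \<le> v \<Longrightarrow> v \<le> (1 + \<alpha>) * s \<Longrightarrow> (\<integral>u. (bias_term u)\<^sup>2 \<partial>gauss n \<mu> v) \<le> A * real n"
    and \<Lambda>A: "\<Lambda> \<le> A * real n" and kA: "k\<^sup>2 \<le> A * real n" and n: "1 \<le> n"
  defines "A' \<equiv> 2 * A + 2 * ((1 + \<delta>) * s)\<^sup>2 * A"
  shows "\<bar>(\<integral>u. risk \<alpha> u \<partial>gauss n \<mu> ((1 + \<alpha>) * s)) - (\<integral>u. risk 0 u \<partial>gauss n \<mu> s)\<bar>
    \<le> ((A' + 1) / 2 + 2 * (A' + 1) + s * (1 + A)) * real n * \<alpha>"
proof -
  define g where "g = (\<lambda>u. bias_term u + fit_term u)"
  have gm: "g \<in> borel_measurable (Pi\<^sub>M {..<n} (\<lambda>_. borel))" unfolding g_def by measurable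
  have A': "0 \<le> A'" using A by (simp add: A'_def)
  define \<tau> where "\<tau> = (1 + \<alpha>) * s"
  have \<tau>: "0 < \<tau>" "s \<le> \<tau>" using variance_pos(2)[OF \<alpha>] s_pos \<alpha> by (simp_all add: \<tau>_def distrib_right)
  have moment: "integrable (gauss n \<mu> v) (\<lambda>u. (g u)\<^sup>2)" "(\<integral>u. (g u)\<^sup>2 \<partial>gauss n \<mu> v) \<le> A' * real n"
    "(\<integral>u. (fit_term u)\<^sup>2 \<partial>gauss n \<mu> v) \<le> A' * real n"
    if v: "s \<le> v" "v \<le> \<tau>" for v
  proof -
    have v0: "0 < v" using v s_pos by simp
    note I = bias_term_integrable(1)[OF v0, of \<mu>] fit_term_moment(1)[OF v0]
    have le: "(g u)\<^sup>2 \<le> 2 * ((bias_term u)\<^sup>2 + (fit_term u)\<^sup>2)" for u unfolding g_def by (rule square_sum2)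
    show i: "integrable (gauss n \<mu> v) (\<lambda>u. (g u)\<^sup>2)"
    proof (rule Bochner_Integration.integrable_bound)
      show "integrable (gauss n \<mu> v) (\<lambda>u. 2 * ((bias_term u)\<^sup>2 + (fit_term u)\<^sup>2))" using I by simp
      show "(\<lambda>u. (g u)\<^sup>2) \<in> borel_measurable (gauss n \<mu> v)" using gm by measurable
    qed (use le in \<open>auto intro!: AE_I2\<close>)
    have "v \<le> (1 + \<delta>) * s" using v \<delta> s_pos unfolding \<tau>_def by (meson add_left_mono less_imp_le mult_right_mono order_trans)
    then have "v\<^sup>2 * \<Lambda> \<le> ((1 + \<delta>) * s)\<^sup>2 * (A * real n)"
      using v0 \<Lambda>_nonneg \<Lambda>A by (intro mult_mono power_mono) auto
    then have f: "(\<integral>u. (fit_term u)\<^sup>2 \<partial>gauss n \<mu> v) \<le> ((1 + \<delta>) * s)\<^sup>2 * (A * real n)"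
      using fit_term_moment(3)[OF v0] by linarith
    have "(\<integral>u. (g u)\<^sup>2 \<partial>gauss n \<mu> v) \<le> (\<integral>u. 2 * ((bias_term u)\<^sup>2 + (fit_term u)\<^sup>2) \<partial>gauss n \<mu> v)"
      using i I le by (intro integral_mono) auto
    also have "\<dots> = 2 * ((\<integral>u. (bias_term u)\<^sup>2 \<partial>gauss n \<mu> v) + (\<integral>u. (fit_term u)\<^sup>2 \<partial>gauss n \<mu> v))"
      using I by simp
    also have "\<dots> \<le> 2 * (A * real n + ((1 + \<delta>) * s)\<^sup>2 * (A * real n))"
      using bA[OF v[unfolded \<tau>_def]] f by (intro mult_left_mono add_mono) auto
    also have "\<dots> = A' * real n" by (simp add: A'_def algebra_simps)
    finally show "(\<integral>u. (g u)\<^sup>2 \<partial>gauss n \<mu> v) \<le> A' * real n" .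
    have "((1 + \<delta>) * s)\<^sup>2 * (A * real n) \<le> A' * real n"
      using A by (simp add: A'_def distrib_right mult.assoc)
    then show "(\<integral>u. (fit_term u)\<^sup>2 \<partial>gauss n \<mu> v) \<le> A' * real n" using f by linarith
  qed
  have lip: "\<bar>(\<integral>u. g u \<partial>gauss n \<mu> \<tau>) - (\<integral>u. g u \<partial>gauss n \<mu> s)\<bar> \<le> (A' + 1) / 2 * real n * \<alpha>"
    unfolding \<tau>_def using moment unfolding \<tau>_def by (intro gauss_variance_lipschitz[OF s_pos \<alpha> A' gm]) auto
  interpret U: prob_space "gauss n \<mu> \<tau>" by (rule prob_space_gauss[OF \<tau>(1)])
  note [measurable] = gm
  have gi: "integrable (gauss n \<mu> \<tau>) g"
    by (rule U.square_integrable_imp_integrable[OF _ moment(1)[OF \<tau>(2) order_refl]]) measurable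
  define q where "q = (\<lambda>u. ((1 / (1 + \<alpha>))\<^sup>2 - 1) * fit_term u + s * (\<alpha> / (1 + \<alpha>)) * tr n (h (S u)))"
  have split: "risk \<alpha> u = g u + q u" for u by (simp add: risk_def g_def q_def algebra_simps)
  have split0: "risk 0 u = g u" for u by (simp add: risk_def g_def)
  have tri: "integrable (gauss n \<mu> \<tau>) (\<lambda>u. tr n (h (S u)))"
  proof (rule U.integrable_const_bound[of _ k])
    have "\<bar>tr n (h (S u))\<bar> \<le> k" if "u \<in> Rn n" for u using tr_bounds[OF that] by simp
    then show "AE u in gauss n \<mu> \<tau>. norm (tr n (h (S u))) \<le> k" by (intro AE_I2) (simp add: space_gauss)
  qed measurable
  have qi: "integrable (gauss n \<mu> \<tau>) q"
    unfolding q_def using fit_term_moment(2)[OF \<tau>(1)] tri by simp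
  have N: "1 \<le> real n" using n by simp
  have coef: "\<bar>(1 / (1 + \<alpha>))\<^sup>2 - 1\<bar> \<le> 2 * \<alpha>" "0 \<le> \<alpha> / (1 + \<alpha>)" "\<alpha> / (1 + \<alpha>) \<le> \<alpha>"
  proof -
    show a: "0 \<le> \<alpha> / (1 + \<alpha>)" "\<alpha> / (1 + \<alpha>) \<le> \<alpha>" using \<alpha> by (simp_all add: divide_le_eq mult_le_cancel_left1)
    \<comment> \<open>With x = \<alpha>/(1 + \<alpha>) in [0, 1] the coefficient is -x (2 - x), of
      absolute value at most 2 x.\<close>
    have "(1 / (1 + \<alpha>))\<^sup>2 - 1 = - (\<alpha> / (1 + \<alpha>) * (2 - \<alpha> / (1 + \<alpha>)))"
    proof -
      have "1 / (1 + \<alpha>) = 1 - \<alpha> / (1 + \<alpha>)" using \<alpha> by (simp add: field_simps)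
      moreover have "(1 - x)\<^sup>2 - 1 = - (x * (2 - x))" for x :: real
        by (simp add: power2_eq_square algebra_simps)
      ultimately show ?thesis by (simp only:)
    qed
    moreover have "\<bar>- (x * (2 - x))\<bar> \<le> 2 * \<alpha>" if x: "0 \<le> x" "x \<le> \<alpha>" "x \<le> 1" for x
    proof -
      have "0 \<le> x * (2 - x)" using x by (intro mult_nonneg_nonneg) linarith+
      moreover have "x * (2 - x) \<le> \<alpha> * 2" using x by (intro mult_mono) linarith+
      ultimately show ?thesis by simp
    qed
    moreover have "\<alpha> / (1 + \<alpha>) \<le> 1" using \<alpha> by (simp add: divide_le_eq)
    ultimately show "\<bar>(1 / (1 + \<alpha>))\<^sup>2 - 1\<bar> \<le> 2 * \<alpha>" using a by presburger
  qed
  have "\<bar>\<integral>u. q u \<partial>gauss n \<mu> \<tau>\<bar> \<le> (\<integral>u. \<bar>q u\<bar> \<partial>gauss n \<mu> \<tau>)" by (rule integral_abs_bound)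
  also have "\<dots> \<le> (\<integral>u. 2 * \<alpha> * (1 + (fit_term u)\<^sup>2) + s * \<alpha> * (1 + k\<^sup>2) \<partial>gauss n \<mu> \<tau>)"
  proof (rule integral_mono)
    fix u assume "u \<in> space (gauss n \<mu> \<tau>)"
    then have u: "u \<in> Rn n" by (simp add: space_gauss)
    have sq: "x \<le> 1 + x\<^sup>2" if "0 \<le> x" for x :: real
      using zero_le_power2[of "x - 1"] that unfolding power2_diff by simp
    have "\<bar>((1 / (1 + \<alpha>))\<^sup>2 - 1) * fit_term u\<bar> \<le> 2 * \<alpha> * (1 + (fit_term u)\<^sup>2)"
      unfolding abs_mult using coef(1) sq[OF fit_term_nonneg] fit_term_nonneg[of u] \<alpha> by (intro mult_mono) auto
    moreover have "\<bar>s * (\<alpha> / (1 + \<alpha>)) * tr n (h (S u))\<bar> \<le> s * \<alpha> * (1 + k\<^sup>2)"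
    proof -
      have "s * (\<alpha> / (1 + \<alpha>)) * tr n (h (S u)) \<le> s * \<alpha> * (1 + k\<^sup>2)"
        using coef tr_bounds[OF u] sq[OF k_nonneg] s_pos \<alpha> by (intro mult_mono) auto
      moreover have "0 \<le> s * (\<alpha> / (1 + \<alpha>)) * tr n (h (S u))"
        using coef tr_bounds[OF u] s_pos by (intro mult_nonneg_nonneg) auto
      ultimately show ?thesis by (simp only: abs_of_nonneg)
    qed
    ultimately show "\<bar>q u\<bar> \<le> 2 * \<alpha> * (1 + (fit_term u)\<^sup>2) + s * \<alpha> * (1 + k\<^sup>2)"
      unfolding q_def by (rule order_trans[OF abs_triangle_ineq add_mono])
  qed (use qi fit_term_moment(1)[OF \<tau>(1)] in auto)
  also have "\<dots> = 2 * \<alpha> * (1 + (\<integral>u. (fit_term u)\<^sup>2 \<partial>gauss n \<mu> \<tau>)) + s * \<alpha> * (1 + k\<^sup>2)"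
    using fit_term_moment(1)[OF \<tau>(1)] U.prob_space by simp
  \<comment> \<open>The constants 1, which come from x \<le> 1 + x^2, are absorbed using 1 \<le>
    n.\<close>
  also have "\<dots> \<le> 2 * \<alpha> * (real n + A' * real n) + s * \<alpha> * (real n + A * real n)"
    using moment(3)[OF \<tau>(2) order_refl] kA N \<alpha> s_pos by (intro add_mono mult_left_mono) auto
  finally have q: "\<bar>\<integral>u. q u \<partial>gauss n \<mu> \<tau>\<bar> \<le> 2 * \<alpha> * (real n + A' * real n) + s * \<alpha> * (real n + A * real n)" .
  have "(\<integral>u. risk \<alpha> u \<partial>gauss n \<mu> \<tau>) = (\<integral>u. g u \<partial>gauss n \<mu> \<tau>) + (\<integral>u. q u \<partial>gauss n \<mu> \<tau>)"
    unfolding split using gi qi by simp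
  then have "\<bar>(\<integral>u. risk \<alpha> u \<partial>gauss n \<mu> \<tau>) - (\<integral>u. risk 0 u \<partial>gauss n \<mu> s)\<bar>
      \<le> (A' + 1) / 2 * real n * \<alpha> + (2 * \<alpha> * (real n + A' * real n) + s * \<alpha> * (real n + A * real n))"
    unfolding split0 using lip q by linarith
  also have "\<dots> = ((A' + 1) / 2 + 2 * (A' + 1) + s * (1 + A)) * real n * \<alpha>" by (simp add: algebra_simps)
  finally show ?thesis by (simp only: \<tau>_def)
qed

end

subsection \<open>Transfer to completed laws\<close>

context projection_selection
begin

text \<open>Integrating the new response first gives n s + ||\<mu> - H y||^2; by Pythagoras the norm
  is the risk at \<alpha> = 0.\<close>

lemma err_eq:
  "(\<integral>z. nsq n (\<lambda>i. snd z i - mul n (h (S (fst z))) (fst z) i) \<partial>(gauss n \<mu> s \<Otimes>\<^sub>M gauss n \<mu> s))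
    = real n * s + (\<integral>u. risk 0 u \<partial>gauss n \<mu> s)"
proof -
  interpret U: prob_space "gauss n \<mu> s" by (rule prob_space_gauss[OF s_pos])
  let ?F = "\<lambda>z. nsq n (\<lambda>i. snd z i - mul n (h (S (fst z))) (fst z) i)"
  have F: "?F \<in> borel_measurable (gauss n \<mu> s \<Otimes>\<^sub>M gauss n \<mu> s)" unfolding nsq_def mul_def by measurable
  have r: "risk 0 y = bias_term y + fit_term y" for y by (simp add: risk_def)
  have r0: "0 \<le> risk 0 y" for y using bias_term_nonneg[of y] fit_term_nonneg[of y] by (simp add: r)
  have ri: "integrable (gauss n \<mu> s) (risk 0)"
    unfolding r using bias_term_integrable(2)[OF s_pos, of \<mu>] fit_term_moment(2)[OF s_pos] by simp
  have inner: "(\<integral>\<^sup>+x. ennreal (?F (y, x)) \<partial>gauss n \<mu> s) = ennreal (real n * s + risk 0 y)" if y: "y \<in> Rn n" for y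
  proof -
    note I = gauss_nsq_shift[OF s_pos, of n \<mu> "mul n (h (S y)) y"]
    have "(\<integral>\<^sup>+x. ennreal (?F (y, x)) \<partial>gauss n \<mu> s) = ennreal (\<integral>x. ?F (y, x) \<partial>gauss n \<mu> s)"
      using I(1) by (intro nn_integral_eq_integral) (auto simp: nsq_nonneg)
    also have "(\<integral>x. ?F (y, x) \<partial>gauss n \<mu> s) = real n * s + risk 0 y"
      using I(2) nsq_residual_fit[OF proj[OF S_in[OF y]], of \<mu> y] by (simp add: r bias_term_def fit_term_def)
    finally show ?thesis .
  qed
  have "(\<integral>\<^sup>+z. ennreal (?F z) \<partial>(gauss n \<mu> s \<Otimes>\<^sub>M gauss n \<mu> s))
      = (\<integral>\<^sup>+y. \<integral>\<^sup>+x. ennreal (?F (y, x)) \<partial>gauss n \<mu> s \<partial>gauss n \<mu> s)"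
    using F by (subst U.nn_integral_fst[symmetric]) auto
  also have "\<dots> = (\<integral>\<^sup>+y. ennreal (real n * s + risk 0 y) \<partial>gauss n \<mu> s)"
    by (intro nn_integral_cong inner) (simp add: space_gauss)
  also have "\<dots> = ennreal (\<integral>y. real n * s + risk 0 y \<partial>gauss n \<mu> s)"
    using ri s_pos r0 by (intro nn_integral_eq_integral) auto
  finally have e: "(\<integral>\<^sup>+z. ennreal (?F z) \<partial>(gauss n \<mu> s \<Otimes>\<^sub>M gauss n \<mu> s)) = ennreal (\<integral>y. real n * s + risk 0 y \<partial>gauss n \<mu> s)" .
  have "(\<integral>z. ?F z \<partial>(gauss n \<mu> s \<Otimes>\<^sub>M gauss n \<mu> s)) = enn2real (\<integral>\<^sup>+z. ennreal (?F z) \<partial>(gauss n \<mu> s \<Otimes>\<^sub>M gauss n \<mu> s))"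
    using F by (intro integral_eq_nn_integral) (auto simp: nsq_nonneg)
  also have "\<dots> = (\<integral>y. real n * s + risk 0 y \<partial>gauss n \<mu> s)"
    unfolding e using s_pos r0 by (intro enn2real_ennreal integral_nonneg_AE AE_I2) auto
  also have "\<dots> = real n * s + (\<integral>u. risk 0 u \<partial>gauss n \<mu> s)"
    using ri U.prob_space by simp
  finally show ?thesis .
qed

text \<open>Here t = \<tau>/\<alpha> is at most T/\<alpha>, so terms in t^2 have the right order.
  The term linear in t and the terms free of t are raised to order 1/\<alpha>^2 by \<alpha> \<le>
  \<delta>, which is where powers of \<delta> enter the constant.\<close>

lemma rotated_second_moment:
  assumes \<alpha>: "0 < \<alpha>" and \<delta>: "\<alpha> \<le> \<delta>" and A: "0 \<le> A"
    and bA: "(\<integral>u. (bias_term u)\<^sup>2 \<partial>gauss n \<mu> ((1 + \<alpha>) * s)) \<le> A * real n"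
    and \<Lambda>A: "\<Lambda> \<le> A * real n" and kA: "k\<^sup>2 \<le> A * real n" and n: "1 \<le> n"
  defines "T \<equiv> (1 + \<delta>) * s"
  shows "(\<integral>z. (dev \<alpha> (fst z) (snd z))\<^sup>2 \<partial>rotated_law \<alpha>)
    \<le> (6 * T\<^sup>2 + 12 * T * \<delta> * (1 + A) + 48 * T\<^sup>2 * A + \<delta>\<^sup>2 * (12 * A + 48 * T\<^sup>2 * A + 48 * s\<^sup>2 * A)) * (real n / \<alpha>\<^sup>2)"
proof -
  define t \<tau> where "t = (1 + 1 / \<alpha>) * s" and "\<tau> = (1 + \<alpha>) * s"
  have T0: "0 < T" using \<alpha> \<delta> s_pos by (simp add: T_def)
  have t0: "0 < t" and \<tau>0: "0 < \<tau>" using variance_pos \<alpha> by (simp_all add: t_def \<tau>_def)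
  have \<tau>T: "\<tau> \<le> T" using \<delta> s_pos by (simp add: \<tau>_def T_def)
  have "t = \<tau> / \<alpha>" using \<alpha> by (simp add: t_def \<tau>_def field_simps)
  then have tT: "t \<le> T / \<alpha>" using \<tau>T \<alpha> by (simp add: divide_right_mono)
  have "t\<^sup>2 \<le> (T / \<alpha>)\<^sup>2" using tT t0 by (intro power_mono) auto
  then have t2: "t\<^sup>2 \<le> T\<^sup>2 / \<alpha>\<^sup>2" by (simp add: power_divide)
  have \<tau>2: "\<tau>\<^sup>2 \<le> T\<^sup>2" using \<tau>T \<tau>0 by (intro power_mono) auto
  have \<delta>2: "1 \<le> \<delta>\<^sup>2 / \<alpha>\<^sup>2" using \<alpha> \<delta> by (simp add: power_mono)
  have t1: "t \<le> T * \<delta> / \<alpha>\<^sup>2"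
  proof -
    have "T / \<alpha> = T * \<alpha> / \<alpha>\<^sup>2" using \<alpha> by (simp add: power2_eq_square)
    also have "\<dots> \<le> T * \<delta> / \<alpha>\<^sup>2" using T0 \<delta> by (intro divide_right_mono mult_left_mono) auto
    finally show ?thesis using tT by simp
  qed
  have N: "1 \<le> real n" using n by simp
  have AN: "0 \<le> A * real n" using A by simp
  have "6 * real n * t\<^sup>2 \<le> 6 * real n * (T\<^sup>2 / \<alpha>\<^sup>2)" by (intro mult_left_mono t2) auto
  moreover have "12 * t * (1 + A * real n) \<le> 12 * (T * \<delta> / \<alpha>\<^sup>2) * (real n + A * real n)"
    using t1 t0 N AN T0 \<alpha> \<delta> by (intro mult_mono) auto
  moreover have "48 * (t\<^sup>2 * \<Lambda>) \<le> 48 * (T\<^sup>2 / \<alpha>\<^sup>2 * (A * real n))"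
    using t2 \<Lambda>A \<Lambda>_nonneg by (intro mult_left_mono mult_mono) auto
  moreover have "12 * (A * real n) + 48 * (\<tau>\<^sup>2 * \<Lambda>) + 48 * (s * k)\<^sup>2
      \<le> \<delta>\<^sup>2 / \<alpha>\<^sup>2 * (12 * (A * real n) + 48 * (T\<^sup>2 * (A * real n)) + 48 * (s\<^sup>2 * (A * real n)))"
  proof -
    have "12 * (A * real n) + 48 * (\<tau>\<^sup>2 * \<Lambda>) + 48 * (s * k)\<^sup>2
      \<le> 12 * (A * real n) + 48 * (T\<^sup>2 * (A * real n)) + 48 * (s\<^sup>2 * (A * real n))"
      unfolding power_mult_distrib using \<tau>2 \<Lambda>A \<Lambda>_nonneg kA A by (intro add_mono mult_left_mono mult_mono) auto
    also have "\<dots> = 1 * \<dots>" by simp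
    also have "\<dots> \<le> \<delta>\<^sup>2 / \<alpha>\<^sup>2 * (12 * (A * real n) + 48 * (T\<^sup>2 * (A * real n)) + 48 * (s\<^sup>2 * (A * real n)))"
      using AN A by (intro mult_right_mono \<delta>2 add_nonneg_nonneg mult_nonneg_nonneg) auto
    finally show ?thesis .
  qed
  ultimately have "6 * real n * t\<^sup>2 + 12 * t * (1 + A * real n) + 48 * (t\<^sup>2 * \<Lambda>)
      + (12 * (A * real n) + 48 * (\<tau>\<^sup>2 * \<Lambda>) + 48 * (s * k)\<^sup>2)
    \<le> 6 * real n * (T\<^sup>2 / \<alpha>\<^sup>2) + 12 * (T * \<delta> / \<alpha>\<^sup>2) * (real n + A * real n) + 48 * (T\<^sup>2 / \<alpha>\<^sup>2 * (A * real n))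
      + \<delta>\<^sup>2 / \<alpha>\<^sup>2 * (12 * (A * real n) + 48 * (T\<^sup>2 * (A * real n)) + 48 * (s\<^sup>2 * (A * real n)))"
    by linarith
  also have "\<dots> = (6 * T\<^sup>2 + 12 * T * \<delta> * (1 + A) + 48 * T\<^sup>2 * A + \<delta>\<^sup>2 * (12 * A + 48 * T\<^sup>2 * A + 48 * s\<^sup>2 * A)) * (real n / \<alpha>\<^sup>2)"
    by (simp add: divide_inverse algebra_simps)
  finally show ?thesis
    using rotated_law_moments(5)[OF \<alpha> bA] unfolding t_def \<tau>_def by linarith
qed

end

section \<open>Completed laws and Borel versions of the selection map\<close>

lemma integral_completion_AE_eq:
  fixes f g :: "'a \<Rightarrow> real"
  assumes f: "f \<in> borel_measurable M" and ae: "AE x in M. g x = f x"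
  shows "(\<integral>x. g x \<partial>completion M) = (\<integral>x. f x \<partial>M)"
proof -
  \<comment> \<open>No measurability of \<open>g\<close> is assumed. Each of its preimages differs
    from one of \<open>f\<close> by subsets of a null set, and these are measurable in the
    completion.\<close>
  have g: "g \<in> borel_measurable (completion M)"
  proof (rule measurableI)
    fix A :: "real set" assume A: "A \<in> sets borel"
    have 1: "Measurable.pred (completion M) (\<lambda>x. g x \<in> A \<and> f x \<notin> A)"
      "Measurable.pred (completion M) (\<lambda>x. f x \<in> A \<and> g x \<notin> A)"
      using ae by (intro sets_completion_AE; auto elim: eventually_mono)+
    have fA: "Measurable.pred (completion M) (\<lambda>x. f x \<in> A)"
      using measurable_completion[OF f] A by measurable
    have "Measurable.pred (completion M) (\<lambda>x. (f x \<in> A \<and> \<not> (f x \<in> A \<and> g x \<notin> A)) \<or> (g x \<in> A \<and> f x \<notin> A))"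
      using 1 fA by measurable
    then have "Measurable.pred (completion M) (\<lambda>x. g x \<in> A)"
      by (rule measurable_cong[THEN iffD1, rotated]) auto
    then show "g -` A \<inter> space (completion M) \<in> sets (completion M)"
      by (simp add: pred_def vimage_def Int_def conj_commute)
  qed simp
  have "(\<integral>x. g x \<partial>completion M) = (\<integral>x. f x \<partial>completion M)"
    using ae by (intro integral_cong_AE g measurable_completion[OF f] AE_completion)
  then show ?thesis by (simp add: integral_completion[OF f])
qed

text \<open>The iterated integral identity at indicators gives an equality of laws, which then
  serves for signed integrands as well.\<close>

lemma gauss_rotate:
  fixes m :: "nat \<Rightarrow> real" and n :: nat
  assumes s: "0 < s" and \<alpha>: "0 < \<alpha>"
  defines "T \<equiv> (\<lambda>z. (\<lambda>i\<in>{..<n}. fst z i + snd z i, \<lambda>i\<in>{..<n}. fst z i - snd z i / \<alpha>))"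
    and "B \<equiv> Pi\<^sub>M {..<n} (\<lambda>_. borel) \<Otimes>\<^sub>M Pi\<^sub>M {..<n} (\<lambda>_. borel)"
  shows "T \<in> measurable (gauss n m s \<Otimes>\<^sub>M gauss n (\<lambda>_. 0) (\<alpha> * s)) B"
    and "distr (gauss n m s \<Otimes>\<^sub>M gauss n (\<lambda>_. 0) (\<alpha> * s)) B T
      = gauss n m ((1 + \<alpha>) * s) \<Otimes>\<^sub>M gauss n m ((1 + 1 / \<alpha>) * s)"
proof -
  let ?P = "gauss n m s \<Otimes>\<^sub>M gauss n (\<lambda>_. 0) (\<alpha> * s)"
  let ?R = "gauss n m ((1 + \<alpha>) * s) \<Otimes>\<^sub>M gauss n m ((1 + 1 / \<alpha>) * s)"
  have as: "0 < \<alpha> * s" and t: "0 < (1 + 1 / \<alpha>) * s" using s \<alpha> by (simp_all add: add_pos_pos)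
  interpret W: prob_space "gauss n (\<lambda>_. 0) (\<alpha> * s)" by (rule prob_space_gauss[OF as])
  interpret V: prob_space "gauss n m ((1 + 1 / \<alpha>) * s)" by (rule prob_space_gauss[OF t])
  show T: "T \<in> measurable ?P B"
    unfolding T_def B_def by (intro measurable_Pair measurable_restrict) measurable
  show "distr ?P B T = ?R"
  proof (rule measure_eqI)
    show "sets (distr ?P B T) = sets ?R" by (simp add: B_def cong: sets_pair_measure_cong) (simp add: sets_gauss cong: sets_pair_measure_cong)
    fix A assume "A \<in> sets (distr ?P B T)"
    then have A: "A \<in> sets B" by simp
    then have A': "A \<in> sets ?R" by (simp add: B_def sets_gauss cong: sets_pair_measure_cong)
    have "emeasure (distr ?P B T) A = (\<integral>\<^sup>+z. indicator A (T z) \<partial>?P)"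
      using A T by (simp add: nn_integral_distr[symmetric])
    also have "\<dots> = (\<integral>\<^sup>+y. \<integral>\<^sup>+w. indicator A (T (y, w)) \<partial>gauss n (\<lambda>_. 0) (\<alpha> * s) \<partial>gauss n m s)"
      using measurable_compose[OF T borel_measurable_indicator[OF A]] by (rule W.nn_integral_fst[symmetric])
    also have "\<dots> = (\<integral>\<^sup>+u. \<integral>\<^sup>+v. indicator A (u, v) \<partial>gauss n m ((1 + 1 / \<alpha>) * s) \<partial>gauss n m ((1 + \<alpha>) * s))"
      using PiM_normal_law_rotate[OF _ s \<alpha>, of "{..<n}" "indicator A" m] A
      by (simp add: T_def gauss_def B_def)
    also have "\<dots> = emeasure ?R A"
      using A' V.nn_integral_fst[of "indicator A" "gauss n m ((1 + \<alpha>) * s)"] by simp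
    finally show "emeasure (distr ?P B T) A = emeasure ?R A" .
  qed
qed

text \<open>The exceptional set concerns only u = y + w. It is null for the law of u by absolute
  continuity, and its preimage under the rotation is null for the law of (y, w).\<close>

lemma integral_randomized_law:
  fixes F :: "(nat \<Rightarrow> real) \<times> (nat \<Rightarrow> real) \<Rightarrow> real"
  assumes s: "0 < s" and \<alpha>: "0 < \<alpha>" and N: "N \<in> null_sets (Pi\<^sub>M {..<n} (\<lambda>_. lborel))"
    and F: "F \<in> borel_measurable (Pi\<^sub>M {..<n} (\<lambda>_. borel) \<Otimes>\<^sub>M Pi\<^sub>M {..<n} (\<lambda>_. borel))"
    and eq: "\<And>y w. y \<in> Rn n \<Longrightarrow> w \<in> Rn n \<Longrightarrow> (\<lambda>i\<in>{..<n}. y i + w i) \<notin> N \<Longrightarrow>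
      g (y, w) = F (\<lambda>i\<in>{..<n}. y i + w i, \<lambda>i\<in>{..<n}. y i - w i / \<alpha>)"
  shows "(\<integral>z. g z \<partial>randomized_law n m s \<alpha>) = (\<integral>z. F z \<partial>(gauss n m ((1 + \<alpha>) * s) \<Otimes>\<^sub>M gauss n m ((1 + 1 / \<alpha>) * s)))"
proof -
  let ?P = "gauss n m s \<Otimes>\<^sub>M gauss n (\<lambda>_. 0) (\<alpha> * s)"
  let ?R = "gauss n m ((1 + \<alpha>) * s) \<Otimes>\<^sub>M gauss n m ((1 + 1 / \<alpha>) * s)"
  let ?B = "Pi\<^sub>M {..<n} (\<lambda>_. borel) \<Otimes>\<^sub>M Pi\<^sub>M {..<n} (\<lambda>_. borel) :: ((nat \<Rightarrow> real) \<times> (nat \<Rightarrow> real)) measure"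
  define T where "T = (\<lambda>z::(nat \<Rightarrow> real) \<times> (nat \<Rightarrow> real). (\<lambda>i\<in>{..<n}. fst z i + snd z i, \<lambda>i\<in>{..<n}. fst z i - snd z i / \<alpha>))"
  note T = gauss_rotate(1)[OF s \<alpha>, where n = n and m = m, folded T_def] and D = gauss_rotate(2)[OF s \<alpha>, where n = n and m = m, folded T_def]
  have \<tau>: "0 < (1 + \<alpha>) * s" and t: "0 < (1 + 1 / \<alpha>) * s" using s \<alpha> by (simp_all add: add_pos_pos)
  interpret U: prob_space "gauss n m ((1 + \<alpha>) * s)" by (rule prob_space_gauss[OF \<tau>])
  interpret V: prob_space "gauss n m ((1 + 1 / \<alpha>) * s)" by (rule prob_space_gauss[OF t])
  interpret R: pair_prob_space "gauss n m ((1 + \<alpha>) * s)" "gauss n m ((1 + 1 / \<alpha>) * s)" ..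
  have N': "N \<in> null_sets (gauss n m ((1 + \<alpha>) * s))" by (rule null_sets_gauss[OF \<tau> N])
  then have Ns[measurable]: "N \<in> sets (Pi\<^sub>M {..<n} (\<lambda>_. borel))" by (auto simp: null_sets_def sets_gauss)
  have "AE z in ?R. fst z \<notin> N"
  proof (rule R.AE_pair_measure)
    show "{x \<in> space ?R. fst x \<notin> N} \<in> sets ?R" by measurable
    show "AE x in gauss n m ((1 + \<alpha>) * s). AE y in gauss n m ((1 + 1 / \<alpha>) * s). fst (x, y) \<notin> N"
      using AE_not_in[OF N'] by (auto elim: eventually_mono)
  qed
  then have "AE z in distr ?P ?B T. fst z \<notin> N" unfolding D .
  moreover have "{x \<in> space ?B. fst x \<notin> N} \<in> sets ?B" by measurable
  ultimately have "AE z in ?P. fst (T z) \<notin> N"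
    using T by (simp add: AE_distr_iff)
  moreover have "AE z in ?P. z \<in> space ?P" by (rule AE_space)
  ultimately have "AE z in ?P. g z = F (T z)"
  proof eventually_elim
    case (elim z)
    then show ?case
      using eq[of "fst z" "snd z"] by (simp add: space_pair_measure space_gauss T_def mem_Times_iff)
  qed
  then have "(\<integral>z. g z \<partial>randomized_law n m s \<alpha>) = (\<integral>z. F (T z) \<partial>?P)"
    unfolding randomized_law_def using measurable_compose[OF T F] by (intro integral_completion_AE_eq) auto
  also have "\<dots> = (\<integral>z. F z \<partial>distr ?P ?B T)"
    using T F by (rule integral_distr[symmetric])
  finally show ?thesis unfolding D .
qed

text \<open>Open sets of the product topology are known to be product measurable for functions on
  the whole index type. Restriction pulls \<open>U\<close> back to such a set, and extension by zero
  brings it back to the finite index set.\<close>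

lemma sets_PiM_openin:
  assumes U: "openin (Rn_topology n) U"
  shows "U \<in> sets (Pi\<^sub>M {..<n} (\<lambda>_. borel))"
proof -
  let ?r = "\<lambda>f. restrict f {..<n}" and ?e = "\<lambda>f i. if i < n then f i else (0::real)"
  have "continuous_map (product_topology (\<lambda>_. euclideanreal) (UNIV :: nat set)) (Rn_topology n) ?r"
    unfolding continuous_map_componentwise
    by (auto intro!: continuous_map_product_coordinates)
  from openin_continuous_map_preimage[OF this U]
  have "open {f. ?r f \<in> U}" by (simp add: euclidean_product_topology)
  then have op: "{f. ?r f \<in> U} \<in> sets (Pi\<^sub>M UNIV (\<lambda>_. borel))"
    by (simp add: sets_PiM_equal_borel borel_open)
  have e: "?e \<in> measurable (Pi\<^sub>M {..<n} (\<lambda>_. borel)) (Pi\<^sub>M UNIV (\<lambda>_. borel))"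
  proof (rule measurable_PiM_single')
    fix i :: nat
    show "(\<lambda>f. ?e f i) \<in> measurable (Pi\<^sub>M {..<n} (\<lambda>_. borel)) borel"
      by (cases "i < n") auto
  qed auto
  have sub: "U \<subseteq> Rn n" using openin_subset[OF U] by simp
  have "?r (?e f) = f" if "f \<in> Rn n" for f
    using that by (auto simp: PiE_iff extensional_def fun_eq_iff)
  then have "U = ?e -` {f. ?r f \<in> U} \<inter> space (Pi\<^sub>M {..<n} (\<lambda>_. borel))"
    using sub by (auto simp: space_PiM)
  then show ?thesis using measurable_sets[OF e op] by simp
qed

text \<open>Interiors of the regions are open, hence Borel, and on them the map is kept; elsewhere
  an arbitrary model \<open>M0\<close> is chosen. A disagreement can only occur on a
  frontier.\<close>

lemma borel_selection:
  fixes Mhat :: "(nat \<Rightarrow> real) \<Rightarrow> nat set"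
  assumes fin: "finite \<M>" and img: "Mhat ` Rn n = \<M>"
    and null: "\<And>M. M \<in> \<M> \<Longrightarrow> Rn_topology n frontier_of selection_region n Mhat M \<in> null_sets (Rn_lebesgue n)"
  obtains S N where "S \<in> measurable (Pi\<^sub>M {..<n} (\<lambda>_. borel)) (count_space \<M>)"
    "N \<in> null_sets (Pi\<^sub>M {..<n} (\<lambda>_. lborel))" "\<And>y. y \<in> Rn n \<Longrightarrow> y \<notin> N \<Longrightarrow> S y = Mhat y"
proof -
  let ?B = "Pi\<^sub>M {..<n} (\<lambda>_. borel) :: (nat \<Rightarrow> real) measure"
  have "Rn n \<noteq> {}" by (simp add: PiE_eq_empty_iff)
  then obtain M0 where M0: "M0 \<in> \<M>" using img by auto
  define U where "U = (\<lambda>M. selection_region n Mhat M)"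
  define I where "I = (\<lambda>M. Rn_topology n interior_of U M)"
  have I: "I M \<in> sets ?B" for M unfolding I_def by (intro sets_PiM_openin openin_interior_of)
  have IU: "I M \<subseteq> U M" for M unfolding I_def by (rule interior_of_subset)
  define N where "N = (\<Union>M\<in>\<M>. Rn_topology n frontier_of U M)"
  define S where "S = (\<lambda>y. if y \<in> (\<Union>M\<in>\<M>. I M) then Mhat y else M0)"
  show thesis
  proof
    show "S \<in> measurable ?B (count_space \<M>)"
      unfolding measurable_count_space_eq2[OF fin]
    proof (intro conjI ballI)
      show "S \<in> space ?B \<rightarrow> \<M>" using img M0 by (auto simp: S_def space_PiM)
      fix M assume M: "M \<in> \<M>"
      have "S -` {M} \<inter> space ?B = I M \<union> (if M = M0 then space ?B - (\<Union>M\<in>\<M>. I M) else {})"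
      proof -
        have "I M \<subseteq> space ?B" for M using sets.sets_into_space[OF I] .
        moreover have "Mhat y = M'" if "y \<in> I M'" for y M' using that IU by (auto simp: U_def selection_region_def)
        ultimately show ?thesis using M unfolding S_def by (auto split: if_splits)
      qed
      also have "\<dots> \<in> sets ?B" using I fin by auto
      finally show "S -` {M} \<inter> space ?B \<in> sets ?B" .
    qed
    show "N \<in> null_sets (Pi\<^sub>M {..<n} (\<lambda>_. lborel))"
      unfolding N_def
    proof (rule null_sets_UN')
      fix M assume M: "M \<in> \<M>"
      let ?F = "Rn_topology n frontier_of U M"
      \<comment> \<open>A frontier is closed, hence Borel; being null for the completed measure it
        is therefore null for the product measure itself.\<close>
      have "openin (Rn_topology n) (topspace (Rn_topology n) - ?F)"
        by (intro openin_diff openin_topspace closedin_frontier_of)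
      then have "Rn n - ?F \<in> sets ?B" using sets_PiM_openin by simp
      then have "space ?B - (Rn n - ?F) \<in> sets ?B" by (rule sets.compl_sets)
      moreover have "space ?B - (Rn n - ?F) = ?F"
        using frontier_of_subset_topspace[of "Rn_topology n" "U M"] by (auto simp: space_PiM)
      moreover have "sets ?B = sets (Pi\<^sub>M {..<n} (\<lambda>_. lborel))" by (intro sets_PiM_cong) auto
      ultimately have "?F \<in> sets (Pi\<^sub>M {..<n} (\<lambda>_. lborel))" by simp
      then show "?F \<in> null_sets (Pi\<^sub>M {..<n} (\<lambda>_. lborel))"
        using null[OF M] unfolding U_def by (simp add: null_sets_completion_iff)
    qed (simp add: fin countable_finite)
    fix y assume y: "y \<in> Rn n" "y \<notin> N"
    then have M: "Mhat y \<in> \<M>" using img by auto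
    \<comment> \<open>A point of its own region lies in the closure; off the frontier it lies in the
      interior.\<close>
    have "y \<in> U (Mhat y)" using y by (simp add: U_def selection_region_def)
    moreover have "U (Mhat y) \<subseteq> Rn_topology n closure_of U (Mhat y)"
      by (intro closure_of_subset) (auto simp: U_def selection_region_def)
    ultimately have "y \<in> I (Mhat y)"
      using y(2) M unfolding N_def I_def frontier_of_def by auto
    with M show "S y = Mhat y" unfolding S_def by auto
  qed
qed

subsection \<open>Bounds for a fixed sample size\<close>

lemma sq_norm2_residual:
  assumes "H \<in> carrier_mat n n"
  shows "sq_norm2 (Matrix.vec n v - H *\<^sub>v Matrix.vec n y) = nsq n (\<lambda>i. v i - mul n (\<lambda>i j. H $$ (i, j)) y i)"
proof -
  have "(Matrix.vec n v - H *\<^sub>v Matrix.vec n y) $ i = v i - mul n (\<lambda>i j. H $$ (i, j)) y i" if "i < n" for i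
    using that assms by (simp add: mul_def scalar_prod_def atLeast0LessThan)
  then show ?thesis
    using assms by (simp add: sq_norm2_def scalar_prod_def nsq_def power2_eq_square atLeast0LessThan)
qed

lemma projection_of_mat:
  assumes H: "H \<in> carrier_mat n n" and sym: "transpose_mat H = H" and idem: "H * H = H"
  shows "projection n (\<lambda>i j. H $$ (i, j))"
  unfolding projection_def
proof (intro conjI allI impI)
  fix i j assume ij: "i < n" "j < n"
  have "H $$ (i, j) = transpose_mat H $$ (i, j)" by (simp only: sym)
  then show "H $$ (i, j) = H $$ (j, i)" using ij H by simp
  have "H $$ (i, j) = (H * H) $$ (i, j)" by (simp only: idem)
  then show "(\<Sum>k<n. H $$ (i, k) * H $$ (k, j)) = H $$ (i, j)"
    using ij H by (simp add: scalar_prod_def atLeast0LessThan)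
qed

text \<open>Subsets of size at most \<open>k\<close> are images of words of length \<open>k\<close>, with \<open>p\<close> as a padding letter.\<close>

lemma card_bounded_subsets:
  assumes "\<M> \<subseteq> Pow {..<p}" and "\<And>M. M \<in> \<M> \<Longrightarrow> card M \<le> k"
  shows "card \<M> \<le> (p + 1) ^ k"
proof -
  let ?W = "{xs. set xs \<subseteq> {..p} \<and> length xs = k}"
  have "\<M> \<subseteq> (\<lambda>xs. set xs - {p}) ` ?W"
  proof
    fix M assume M: "M \<in> \<M>"
    then have sub: "M \<subseteq> {..<p}" and fin: "finite M" using assms(1) by (auto intro: finite_subset)
    obtain xs where xs: "set xs = M" "distinct xs" using finite_distinct_list[OF fin] by auto
    have len: "length xs \<le> k" using assms(2)[OF M] distinct_card[OF xs(2)] xs(1) by simp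
    let ?ys = "xs @ replicate (k - length xs) p"
    have "?ys \<in> ?W" using len xs sub by (auto simp: set_replicate_conv_if split: if_splits)
    moreover have "set ?ys - {p} = M" using xs sub by (auto simp: set_replicate_conv_if split: if_splits)
    ultimately show "M \<in> (\<lambda>xs. set xs - {p}) ` ?W" by (metis (no_types, lifting) imageI)
  qed
  moreover have "finite ?W" by (rule finite_lists_length_eq) simp
  ultimately have "card \<M> \<le> card ?W" by (rule surj_card_le[rotated])
  also have "\<dots> = (p + 1) ^ k" by (simp add: card_lists_length_eq)
  finally show ?thesis .
qed

text \<open>Only the variance, \<delta> and the common moment constant enter; this is the uniformity
  in n and \<alpha> required of the O-constants.\<close>

definition bias_const :: "real \<Rightarrow> real \<Rightarrow> real \<Rightarrow> real" where
  "bias_const s \<delta> A = (let A' = 2 * A + 2 * ((1 + \<delta>) * s)\<^sup>2 * A in (A' + 1) / 2 + 2 * (A' + 1) + s * (1 + A))"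

definition var_const :: "real \<Rightarrow> real \<Rightarrow> real \<Rightarrow> real" where
  "var_const s \<delta> A = (let T = (1 + \<delta>) * s in
     6 * T\<^sup>2 + 12 * T * \<delta> * (1 + A) + 48 * T\<^sup>2 * A + \<delta>\<^sup>2 * (12 * A + 48 * T\<^sup>2 * A + 48 * s\<^sup>2 * A))"

text \<open>One constant \<open>A\<close> dominates the moments of the bias term, the envelope and
  the squared model size, so that the estimates for the Borel selection combine into three bounds
  for the given one.\<close>

lemma fixed_sample_bounds:
  fixes X :: "real mat" and \<mu> :: "nat \<Rightarrow> real" and Mhat :: "(nat \<Rightarrow> real) \<Rightarrow> nat set"
  assumes n: "1 \<le> n" and s: "0 < s" and X: "X \<in> carrier_mat n p" and M: "\<M> \<subseteq> Pow {..<p}"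
    and img: "Mhat ` Rn n = \<M>"
    and null: "\<And>M. M \<in> \<M> \<Longrightarrow> Rn_topology n frontier_of selection_region n Mhat M \<in> null_sets (Rn_lebesgue n)"
    and inv: "\<And>M. M \<in> \<M> \<Longrightarrow> invertible_mat (transpose_mat (col_submatrix X M) * col_submatrix X M)"
    and card: "\<And>M. M \<in> \<M> \<Longrightarrow> card M \<le> k"
    and A: "0 \<le> A"
    and acc: "\<And>\<tau>. \<tau> \<in> {s..(1 + \<delta>) * s} \<Longrightarrow>
      (\<integral>y. (sq_norm2 (Matrix.vec n \<mu> - hat_matrix X (Mhat y) *\<^sub>v Matrix.vec n \<mu>))\<^sup>2 \<partial>completion (gauss n \<mu> \<tau>)) \<le> A * real n"
    and envelope_le: "(4 * real k)\<^sup>2 * (2 * (ln (sqrt 2 * card \<M>))\<^sup>2 + 4) \<le> A * real n"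
    and k_le: "(real k)\<^sup>2 \<le> A * real n"
    and \<alpha>: "0 < \<alpha>" "\<alpha> < \<delta>"
  shows "\<bar>Bias_scaled n X \<mu> Mhat s \<alpha>\<bar> \<le> bias_const s \<delta> A * \<alpha>"
    and "Var_scaled n X \<mu> Mhat s \<alpha> \<le> var_const s \<delta> A / (real n * \<alpha>\<^sup>2)"
    and "MSE_scaled n X \<mu> Mhat s \<alpha> \<le> var_const s \<delta> A / (real n * \<alpha>\<^sup>2) + (bias_const s \<delta> A)\<^sup>2 * \<alpha>\<^sup>2"
proof -
  have fin: "finite \<M>" using M by (rule finite_subset) simp
  obtain S N where S: "S \<in> measurable (Pi\<^sub>M {..<n} (\<lambda>_. borel)) (count_space \<M>)"
    and N: "N \<in> null_sets (Pi\<^sub>M {..<n} (\<lambda>_. lborel))" and SM: "\<And>y. y \<in> Rn n \<Longrightarrow> y \<notin> N \<Longrightarrow> S y = Mhat y"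
    using borel_selection[OF fin img null] by metis
  define h where "h = (\<lambda>M i j. hat_matrix X M $$ (i, j))"
  have H: "hat_matrix X M \<in> carrier_mat n n" "projection n (h M)" "tr n (h M) = real (card M)"
    "mat_trace (hat_matrix X M) = tr n (h M)" if "M \<in> \<M>" for M
  proof -
    have "M \<subseteq> {..<p}" using that M by auto
    note P = hat_matrix_projection[OF X this inv[OF that]]
    show "hat_matrix X M \<in> carrier_mat n n" by (rule P)
    show "projection n (h M)" unfolding h_def by (rule projection_of_mat[OF P(1-3)])
    show "mat_trace (hat_matrix X M) = tr n (h M)" using P(1) by (simp add: mat_trace_def tr_def h_def)
    then show "tr n (h M) = real (card M)" using P(4) by simp
  qed
  have "Rn n \<noteq> {}" by (simp add: PiE_eq_empty_iff)
  then interpret projection_selection n \<M> S h \<mu> s "real k"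
    using s fin img S H card by unfold_locales auto
  have residual: "sq_norm2 (Matrix.vec n v - hat_matrix X (Mhat y) *\<^sub>v Matrix.vec n x)
      = nsq n (\<lambda>i. v i - mul n (h (S y)) x i)" if "y \<in> Rn n" "y \<notin> N" for v x y
    using sq_norm2_residual[OF H(1)[OF S_in[OF that(1)]], of v x] SM[OF that] by (simp add: h_def)
  have nullN: "AE y in gauss n \<mu> v. y \<notin> N" if "0 < v" for v
    by (rule AE_not_in[OF null_sets_gauss[OF that N]])
  have moment: "(\<integral>u. (bias_term u)\<^sup>2 \<partial>gauss n \<mu> v) \<le> A * real n" if "s \<le> v" "v \<le> (1 + \<delta>) * s" for v
  proof -
    have v: "0 < v" using that s by simp
    have "AE y in gauss n \<mu> v. (sq_norm2 (Matrix.vec n \<mu> - hat_matrix X (Mhat y) *\<^sub>v Matrix.vec n \<mu>))\<^sup>2 = (bias_term y)\<^sup>2"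
      using nullN[OF v] AE_space
    proof eventually_elim
      case (elim y)
      then show ?case by (simp add: residual space_gauss bias_term_def)
    qed
    then have "(\<integral>y. (sq_norm2 (Matrix.vec n \<mu> - hat_matrix X (Mhat y) *\<^sub>v Matrix.vec n \<mu>))\<^sup>2 \<partial>completion (gauss n \<mu> v))
        = (\<integral>u. (bias_term u)\<^sup>2 \<partial>gauss n \<mu> v)"
      by (intro integral_completion_AE_eq) measurable
    with acc[of v] that show ?thesis by simp
  qed
  define d0 where "d0 = (\<integral>u. risk 0 u \<partial>gauss n \<mu> s)"
  have Err: "Err n X \<mu> Mhat s = real n * s + d0"
  proof -
    interpret U: prob_space "gauss n \<mu> s" by (rule prob_space_gauss[OF s])
    interpret UU: pair_prob_space "gauss n \<mu> s" "gauss n \<mu> s" ..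
    have Nm[measurable]: "N \<in> sets (Pi\<^sub>M {..<n} (\<lambda>_. borel))"
      using null_sets_gauss[OF s N, of \<mu>] by (auto simp: null_sets_def sets_gauss)
    have "AE z in gauss n \<mu> s \<Otimes>\<^sub>M gauss n \<mu> s. fst z \<notin> N"
    proof (rule UU.AE_pair_measure)
      show "{x \<in> space (gauss n \<mu> s \<Otimes>\<^sub>M gauss n \<mu> s). fst x \<notin> N} \<in> sets (gauss n \<mu> s \<Otimes>\<^sub>M gauss n \<mu> s)"
        by measurable
      show "AE x in gauss n \<mu> s. AE y in gauss n \<mu> s. fst (x, y) \<notin> N"
        using nullN[OF s] by (auto elim: eventually_mono)
    qed
    then have "AE z in gauss n \<mu> s \<Otimes>\<^sub>M gauss n \<mu> s.
        (case z of (y, ynew) \<Rightarrow> sq_norm2 (Matrix.vec n ynew - hat_matrix X (Mhat y) *\<^sub>v Matrix.vec n y))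
        = nsq n (\<lambda>i. snd z i - mul n (h (S (fst z))) (fst z) i)"
      using AE_space
    proof eventually_elim
      case (elim z)
      then have "fst z \<in> Rn n" by (simp add: space_pair_measure space_gauss mem_Times_iff)
      from residual[OF this elim(1), of "snd z" "fst z"] show ?case by (simp only: split_beta)
    qed
    then have "Err n X \<mu> Mhat s = (\<integral>z. nsq n (\<lambda>i. snd z i - mul n (h (S (fst z))) (fst z) i) \<partial>(gauss n \<mu> s \<Otimes>\<^sub>M gauss n \<mu> s))"
      unfolding Err_def by (intro integral_completion_AE_eq) (simp_all add: nsq_def mul_def)
    then show ?thesis by (simp add: err_eq d0_def)
  qed
  \<comment> \<open>A general test function covers the mean (identity), the variance and the mean
    squared error (shifted squares) at once.\<close>
  have Err_hat: "(\<integral>z. \<phi> (Err_hat n X Mhat s \<alpha> z) \<partial>randomized_law n \<mu> s \<alpha>)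
      = (\<integral>z. \<phi> (dev \<alpha> (fst z) (snd z) + real n * s) \<partial>rotated_law \<alpha>)"
    if \<phi>: "\<phi> \<in> borel_measurable borel" for \<phi> :: "real \<Rightarrow> real"
  proof -
    have "(\<integral>z. \<phi> (Err_hat n X Mhat s \<alpha> z) \<partial>randomized_law n \<mu> s \<alpha>)
        = (\<integral>z. \<phi> (est \<alpha> (fst z) (snd z)) \<partial>(gauss n \<mu> ((1 + \<alpha>) * s) \<Otimes>\<^sub>M gauss n \<mu> ((1 + 1 / \<alpha>) * s)))"
    proof (rule integral_randomized_law[OF s \<alpha>(1) N measurable_compose[OF est_meas \<phi>]])
      fix y w :: "nat \<Rightarrow> real"
      define u v where "u = (\<lambda>i\<in>{..<n}. y i + w i)" and "v = (\<lambda>i\<in>{..<n}. y i - w i / \<alpha>)"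
      assume "(\<lambda>i\<in>{..<n}. y i + w i) \<notin> N"
      then have uN: "u \<notin> N" by (simp only: u_def not_False_eq_True)
      have u: "u \<in> Rn n" by (simp add: u_def PiE_iff)
      \<comment> \<open>y = (u + \<alpha> v)/(1 + \<alpha>) holds on the indices below
        \<open>n\<close> only, which are the ones that \<open>mul\<close> reads.\<close>
      have "mul n (h (S u)) y i = mul n (h (S u)) (\<lambda>j. (u j + \<alpha> * v j) / (1 + \<alpha>)) i" for i
        unfolding mul_def
      proof (intro sum.cong refl arg_cong2[where f = "(*)"])
        fix j assume "j \<in> {..<n}"
        then have "u j + \<alpha> * v j = (1 + \<alpha>) * y j" using \<alpha>(1) by (simp add: u_def v_def algebra_simps)
        then show "y j = (u j + \<alpha> * v j) / (1 + \<alpha>)" using \<alpha>(1) by simp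
      qed
      then have "Err_hat n X Mhat s \<alpha> (y, w) = est \<alpha> u v"
        using residual[OF u uN, of v y] SM[OF u uN] H(4)[OF S_in[OF u]]
        by (simp add: Err_hat_def Let_def u_def[symmetric] v_def[symmetric] est_def)
      then show "\<phi> (Err_hat n X Mhat s \<alpha> (y, w))
          = \<phi> (est \<alpha> (fst (\<lambda>i\<in>{..<n}. y i + w i, \<lambda>i\<in>{..<n}. y i - w i / \<alpha>)) (snd (\<lambda>i\<in>{..<n}. y i + w i, \<lambda>i\<in>{..<n}. y i - w i / \<alpha>)))"
        by (simp add: u_def v_def)
    qed
    then show ?thesis by (simp add: rotated_law_def dev_def)
  qed
  have \<tau>: "s \<le> (1 + \<alpha>) * s" "(1 + \<alpha>) * s \<le> (1 + \<delta>) * s" using \<alpha> s by simp_all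
  note R = rotated_law_moments[OF \<alpha>(1) moment[OF \<tau>]]
  interpret R: prob_space "rotated_law \<alpha>" by (rule R(1))
  define m V where "m = (\<integral>z. dev \<alpha> (fst z) (snd z) \<partial>rotated_law \<alpha>)"
    and "V = (\<integral>z. (dev \<alpha> (fst z) (snd z))\<^sup>2 \<partial>rotated_law \<alpha>)"
  have \<Lambda>_le: "\<Lambda> \<le> A * real n" using envelope_le by (simp add: \<Lambda>_def)
  have bias: "\<bar>m - d0\<bar> \<le> bias_const s \<delta> A * real n * \<alpha>"
    unfolding m_def d0_def R(4) bias_const_def Let_def
    by (rule risk_variance_lipschitz[OF _ _ A _ \<Lambda>_le k_le n]) (use \<alpha> moment \<tau> in auto)
  have V: "V \<le> var_const s \<delta> A * (real n / \<alpha>\<^sup>2)"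
    unfolding V_def var_const_def Let_def
    by (rule rotated_second_moment[OF \<alpha>(1) _ A moment[OF \<tau>] \<Lambda>_le k_le n]) (use \<alpha> in auto)
  have N0: "0 < real n" using n by simp
  \<comment> \<open>Bias-variance decomposition around an arbitrary centre: c = m gives the
    variance, c = d0 the mean squared error.\<close>
  have square: "(\<integral>z. ((dev \<alpha> (fst z) (snd z) - c) / real n)\<^sup>2 \<partial>rotated_law \<alpha>) = (V - m\<^sup>2) / (real n)\<^sup>2 + ((m - c) / real n)\<^sup>2" for c
  proof -
    have "(\<integral>z. ((dev \<alpha> (fst z) (snd z) - c) / real n)\<^sup>2 \<partial>rotated_law \<alpha>)
        = (\<integral>z. ((dev \<alpha> (fst z) (snd z))\<^sup>2 - 2 * c * dev \<alpha> (fst z) (snd z) + c\<^sup>2) / (real n)\<^sup>2 \<partial>rotated_law \<alpha>)"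
      by (intro Bochner_Integration.integral_cong refl) (simp add: power_divide power2_diff algebra_simps)
    also have "\<dots> = (V - 2 * c * m + c\<^sup>2) / (real n)\<^sup>2"
      using R(2,3) R.prob_space by (simp add: V_def m_def)
    also have "\<dots> = (V - m\<^sup>2) / (real n)\<^sup>2 + ((m - c) / real n)\<^sup>2"
      by (simp add: power_divide power2_diff add_divide_distrib[symmetric] algebra_simps)
    finally show ?thesis .
  qed
  have Vn: "(V - m\<^sup>2) / (real n)\<^sup>2 \<le> var_const s \<delta> A / (real n * \<alpha>\<^sup>2)"
  proof -
    have "V - m\<^sup>2 \<le> var_const s \<delta> A * (real n / \<alpha>\<^sup>2)"
      using V zero_le_power2[of m] by linarith
    then have "(V - m\<^sup>2) / (real n)\<^sup>2 \<le> var_const s \<delta> A * (real n / \<alpha>\<^sup>2) / (real n)\<^sup>2"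
      by (rule divide_right_mono) simp
    also have "\<dots> = var_const s \<delta> A / (real n * \<alpha>\<^sup>2)" using N0 by (simp add: power2_eq_square)
    finally show ?thesis .
  qed
  have mean: "(\<integral>z. Err_hat n X Mhat s \<alpha> z \<partial>randomized_law n \<mu> s \<alpha>) = m + real n * s"
    using Err_hat[of "\<lambda>x. x"] R(3) R.prob_space by (simp add: m_def)
  have bias_eq: "Bias_scaled n X \<mu> Mhat s \<alpha> = (m - d0) / real n"
    unfolding Bias_scaled_def mean Err by simp
  show B: "\<bar>Bias_scaled n X \<mu> Mhat s \<alpha>\<bar> \<le> bias_const s \<delta> A * \<alpha>"
    unfolding bias_eq using bias N0 by (simp add: divide_le_eq mult.commute mult.left_commute)
  have "Var_scaled n X \<mu> Mhat s \<alpha> = (\<integral>z. (Err_hat n X Mhat s \<alpha> z / real n - (m + real n * s) / real n)\<^sup>2 \<partial>randomized_law n \<mu> s \<alpha>)"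
    unfolding Var_scaled_def by (simp add: mean)
  also have "\<dots> = (\<integral>z. ((dev \<alpha> (fst z) (snd z) - m) / real n)\<^sup>2 \<partial>rotated_law \<alpha>)"
    by (subst Err_hat[of "\<lambda>x. (x / real n - (m + real n * s) / real n)\<^sup>2"]) (simp_all add: diff_divide_distrib add_divide_distrib)
  also have "\<dots> = (V - m\<^sup>2) / (real n)\<^sup>2" by (simp add: square)
  finally show "Var_scaled n X \<mu> Mhat s \<alpha> \<le> var_const s \<delta> A / (real n * \<alpha>\<^sup>2)" using Vn by simp
  have "MSE_scaled n X \<mu> Mhat s \<alpha> = (\<integral>z. ((dev \<alpha> (fst z) (snd z) - d0) / real n)\<^sup>2 \<partial>rotated_law \<alpha>)"
    unfolding MSE_scaled_def
    by (subst Err_hat[of "\<lambda>x. (x - Err n X \<mu> Mhat s)\<^sup>2 / (real n)\<^sup>2"]) (simp_all add: Err power_divide)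
  also have "\<dots> = (V - m\<^sup>2) / (real n)\<^sup>2 + (Bias_scaled n X \<mu> Mhat s \<alpha>)\<^sup>2" by (simp add: square bias_eq)
  also have "\<dots> \<le> var_const s \<delta> A / (real n * \<alpha>\<^sup>2) + (bias_const s \<delta> A * \<alpha>)\<^sup>2"
    using Vn B by (intro add_mono) (metis abs_ge_zero power2_abs power_mono)+
  finally show "MSE_scaled n X \<mu> Mhat s \<alpha> \<le> var_const s \<delta> A / (real n * \<alpha>\<^sup>2) + (bias_const s \<delta> A)\<^sup>2 * \<alpha>\<^sup>2"
    by (simp add: power_mult_distrib)
qed

section \<open>Growth of the model sizes and the asymptotic bounds\<close>

lemma model_size_growth:
  fixes K p :: "nat \<Rightarrow> nat"
  assumes "(\<lambda>n. (real (K n))\<^sup>2 * ln (real (p n))) \<in> O(\<lambda>n. sqrt (real n))"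
  obtains D where "0 \<le> D"
    "\<And>n. 1 \<le> n \<Longrightarrow> (real (min (K n) (p n)))\<^sup>2 * (1 + ln (real (p n) + 1)) \<le> D * sqrt (real n)"
proof -
  define g where "g = (\<lambda>n. (real (min (K n) (p n)))\<^sup>2 * (1 + ln (real (p n) + 1)))"
  have g0: "0 \<le> g n" for n by (simp add: g_def)
  obtain C where C: "0 < C"
    and ev: "eventually (\<lambda>n. norm ((real (K n))\<^sup>2 * ln (real (p n))) \<le> C * norm (sqrt (real n))) sequentially"
    using landau_o.bigE[OF assms] by blast
  then obtain n0 where n0: "\<And>n. n0 \<le> n \<Longrightarrow> \<bar>(real (K n))\<^sup>2 * ln (real (p n))\<bar> \<le> C * sqrt (real n)"
    by (auto simp: eventually_sequentially)
  \<comment> \<open>One summand for each case below: the finitely many n before the O-bound holds, p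
    \<le> 1, and p \<ge> 2.\<close>
  define D where "D = (\<Sum>i<n0. g i) + 2 + 4 * C"
  have S0: "0 \<le> (\<Sum>i<n0. g i)" by (intro sum_nonneg g0)
  have D2: "2 \<le> D" "4 * C \<le> D" "(\<Sum>i<n0. g i) \<le> D" using S0 C by (simp_all add: D_def)
  have "g n \<le> D * sqrt (real n)" if n: "1 \<le> n" for n
  proof -
    have sq: "1 \<le> sqrt (real n)" using n by simp
    \<comment> \<open>For p \<le> 1 the logarithm is 0 (also \<open>ln 0 = 0\<close>), so the
      hypothesis does not restrict K; there the minimum with p bounds the model size by 1.\<close>
    consider "n < n0" | "n0 \<le> n" "p n \<le> 1" | "n0 \<le> n" "2 \<le> p n" by linarith
    then show ?thesis
    proof cases
      case 1
      then have "g n \<le> (\<Sum>i<n0. g i)" using g0 by (intro member_le_sum) auto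
      also have "\<dots> \<le> D * 1" using D2 by simp
      also have "\<dots> \<le> D * sqrt (real n)" using sq D2 by (intro mult_left_mono) auto
      finally show ?thesis .
    next
      case 2
      have "g n \<le> 2"
      proof (cases "p n = 0")
        case True
        then show ?thesis by (simp add: g_def)
      next
        case False
        with 2 have p: "p n = 1" by simp
        have "ln (2::real) \<le> 1" using ln_le_minus_one[of 2] by simp
        moreover have "(real (min (K n) 1))\<^sup>2 \<le> 1" by (simp add: power_le_one)
        ultimately have "(real (min (K n) 1))\<^sup>2 * (1 + ln 2) \<le> 1 * 2" by (intro mult_mono) auto
        then show ?thesis by (simp add: g_def p)
      qed
      also have "\<dots> \<le> D * 1" using D2 by simp
      also have "\<dots> \<le> D * sqrt (real n)" using sq D2 by (intro mult_left_mono) auto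
      finally show ?thesis .
    next
      case 3
      have p: "2 \<le> real (p n)" using 3 by simp
      have "1 / 2 \<le> ln (2::real)" using ln2_ge_two_thirds by simp
      also have "\<dots> \<le> ln (real (p n))" using p by simp
      finally have l: "1 \<le> 2 * ln (real (p n))" by simp
      have "real (p n) + 1 \<le> real (p n) * real (p n)"
        using mult_right_mono[OF p, of "real (p n)"] p by linarith
      then have "ln (real (p n) + 1) \<le> ln (real (p n) * real (p n))" using p by simp
      also have "\<dots> = 2 * ln (real (p n))" using p by (simp add: ln_mult)
      finally have "1 + ln (real (p n) + 1) \<le> 4 * ln (real (p n))" using l by linarith
      then have "g n \<le> (real (K n))\<^sup>2 * (4 * ln (real (p n)))"
        unfolding g_def by (intro mult_mono power_mono) auto
      also have "\<dots> \<le> 4 * (C * sqrt (real n))" using n0[OF 3(1)] by linarith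
      also have "\<dots> \<le> D * sqrt (real n)" using D2 sq by (simp add: mult_right_mono flip: mult.assoc)
      finally show ?thesis .
    qed
  qed
  with that[of D] D2 show thesis by (simp add: g_def)
qed

theorem corollary3p11:
  fixes \<sigma> \<delta> :: real
    and p K :: "nat \<Rightarrow> nat"
    and X :: "nat \<Rightarrow> real mat"
    and \<mu> :: "nat \<Rightarrow> nat \<Rightarrow> real"
    and \<M> :: "nat \<Rightarrow> nat set set"
    and Mhat :: "nat \<Rightarrow> (nat \<Rightarrow> real) \<Rightarrow> nat set"
  assumes "\<sigma> > 0" and "\<delta> > 0"
    and "\<And>n. n \<ge> 1 \<Longrightarrow> X n \<in> carrier_mat n (p n)"
    and "\<And>n. n \<ge> 1 \<Longrightarrow> \<mu> n \<in> Rn n"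
    and "\<And>n. n \<ge> 1 \<Longrightarrow> \<M> n \<subseteq> Pow {..<p n}"
    and "\<And>n. n \<ge> 1 \<Longrightarrow> Mhat n ` Rn n = \<M> n"
    and "\<And>n M. n \<ge> 1 \<Longrightarrow> M \<in> \<M> n \<Longrightarrow>
           Rn_topology n interior_of selection_region n (Mhat n) M \<noteq> {}"
    and "\<And>n M. n \<ge> 1 \<Longrightarrow> M \<in> \<M> n \<Longrightarrow>
           Rn_topology n frontier_of selection_region n (Mhat n) M \<in> null_sets (Rn_lebesgue n)"
    and "\<And>n M. n \<ge> 1 \<Longrightarrow> M \<in> \<M> n \<Longrightarrow>
           invertible_mat (transpose_mat (col_submatrix (X n) M) * col_submatrix (X n) M)"
    and "\<And>n M. n \<ge> 1 \<Longrightarrow> M \<in> \<M> n \<Longrightarrow>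
           vec_space.rank n (hat_matrix (X n) M) \<le> card M \<and> card M \<le> K n"
    and "(\<lambda>n. (real (K n))\<^sup>2 * ln (real (p n))) \<in> O(\<lambda>n. sqrt (real n))"
    and "\<exists>C. \<forall>n\<ge>1. \<forall>\<tau>\<in>{\<sigma>\<^sup>2..(1 + \<delta>) * \<sigma>\<^sup>2}.
           (\<integral>y. (sq_norm2 (Matrix.vec n (\<mu> n)
                   - hat_matrix (X n) (Mhat n y) *\<^sub>v Matrix.vec n (\<mu> n)))\<^sup>2
              \<partial>completion (gauss n (\<mu> n) \<tau>)) \<le> C * real n"
  shows "(\<exists>C. \<forall>n\<ge>1. \<forall>\<alpha>\<in>{0<..<\<delta>}.
            \<bar>Bias_scaled n (X n) (\<mu> n) (Mhat n) (\<sigma>\<^sup>2) \<alpha>\<bar> \<le> C * \<alpha>)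
       \<and> (\<exists>C. \<forall>n\<ge>1. \<forall>\<alpha>\<in>{0<..<\<delta>}.
            Var_scaled n (X n) (\<mu> n) (Mhat n) (\<sigma>\<^sup>2) \<alpha> \<le> C / (real n * \<alpha>\<^sup>2))
       \<and> (\<lambda>n. MSE_scaled n (X n) (\<mu> n) (Mhat n) (\<sigma>\<^sup>2) (real n powr (-1/4)))
            \<in> O(\<lambda>n. real n powr (-1/2))"
proof -
  obtain D where D: "0 \<le> D"
    and growth: "\<And>n. 1 \<le> n \<Longrightarrow> (real (min (K n) (p n)))\<^sup>2 * (1 + ln (real (p n) + 1)) \<le> D * sqrt (real n)"
    using model_size_growth[OF assms(11)] by blast
  obtain C where C: "\<And>n \<tau>. 1 \<le> n \<Longrightarrow> \<tau> \<in> {\<sigma>\<^sup>2..(1 + \<delta>) * \<sigma>\<^sup>2} \<Longrightarrow>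
      (\<integral>y. (sq_norm2 (Matrix.vec n (\<mu> n) - hat_matrix (X n) (Mhat n y) *\<^sub>v Matrix.vec n (\<mu> n)))\<^sup>2
        \<partial>completion (gauss n (\<mu> n) \<tau>)) \<le> C * real n"
    using assms(12) by blast
  \<comment> \<open>The constant 96 = 16 * 6 comes from the envelope: (4 k)^2 times the bound 6 (k
    (1 + l))^2. The absolute value allows for a negative \<open>C\<close>.\<close>
  define A where "A = \<bar>C\<bar> + 96 * D\<^sup>2"
  have A: "0 \<le> A" "C \<le> A" "96 * D\<^sup>2 \<le> A"
    unfolding A_def using zero_le_power2[of D] by linarith+
  have s: "0 < \<sigma>\<^sup>2" using assms(1) by simp
  define b v where "b = bias_const (\<sigma>\<^sup>2) \<delta> A" and "v = var_const (\<sigma>\<^sup>2) \<delta> A"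
  have bounds: "\<bar>Bias_scaled n (X n) (\<mu> n) (Mhat n) (\<sigma>\<^sup>2) \<alpha>\<bar> \<le> b * \<alpha>"
    "Var_scaled n (X n) (\<mu> n) (Mhat n) (\<sigma>\<^sup>2) \<alpha> \<le> v / (real n * \<alpha>\<^sup>2)"
    "MSE_scaled n (X n) (\<mu> n) (Mhat n) (\<sigma>\<^sup>2) \<alpha> \<le> v / (real n * \<alpha>\<^sup>2) + b\<^sup>2 * \<alpha>\<^sup>2"
    if n: "1 \<le> n" and \<alpha>: "0 < \<alpha>" "\<alpha> < \<delta>" for n \<alpha>
  proof -
    define k where "k = min (K n) (p n)"
    define l where "l = ln (real (p n) + 1)"
    have l0: "0 \<le> l" by (simp add: l_def)
    have card: "card M \<le> k" if "M \<in> \<M> n" for M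
      using assms(10)[OF n that] assms(5)[OF n] that card_mono[of "{..<p n}" M] by (auto simp: k_def)
    have "Rn n \<noteq> {}" by (simp add: PiE_eq_empty_iff)
    then have "\<M> n \<noteq> {}" "finite (\<M> n)"
      using assms(5,6)[OF n] by (auto intro: finite_subset)
    then have N1: "1 \<le> card (\<M> n)" by (simp add: Suc_leI card_gt_0_iff)
    have "sqrt 2 * real (card (\<M> n)) \<le> sqrt 2 * (real (p n) + 1) ^ k"
    proof (intro mult_left_mono)
      have "real (card (\<M> n)) \<le> real ((p n + 1) ^ k)"
        using card_bounded_subsets[OF assms(5)[OF n] card] by (simp only: of_nat_le_iff)
      then show "real (card (\<M> n)) \<le> (real (p n) + 1) ^ k" by (simp add: add.commute)
    qed simp
    moreover have "0 < sqrt 2 * real (card (\<M> n))" using N1 by simp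
    ultimately have "ln (sqrt 2 * real (card (\<M> n))) \<le> ln (sqrt 2 * (real (p n) + 1) ^ k)"
      by (subst ln_le_cancel_iff) auto
    also have "\<dots> = ln (sqrt 2) + real k * l" by (simp add: ln_mult ln_realpow l_def)
    also have "ln (sqrt 2) \<le> 1"
      using ln_le_minus_one[of "sqrt 2"] real_sqrt_le_mono[of 2 4] by simp
    finally have ln_le: "ln (sqrt 2 * real (card (\<M> n))) \<le> 1 + real k * l" by simp
    have "1 * 1 \<le> sqrt 2 * real (card (\<M> n))" using N1 by (intro mult_mono) auto
    then have ln_ge: "0 \<le> ln (sqrt 2 * real (card (\<M> n)))" by simp
    have kl: "((real k)\<^sup>2 * (1 + l))\<^sup>2 \<le> D\<^sup>2 * real n"
    proof -
      have "((real k)\<^sup>2 * (1 + l))\<^sup>2 \<le> (D * sqrt (real n))\<^sup>2"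
        using growth[OF n] l0 unfolding k_def l_def by (intro power_mono) auto
      then show ?thesis by (simp add: power_mult_distrib)
    qed
    have DA: "96 * (D\<^sup>2 * real n) \<le> A * real n"
      using mult_right_mono[OF A(3), of "real n"] by simp
    have envelope: "(4 * real k)\<^sup>2 * (2 * (ln (sqrt 2 * card (\<M> n)))\<^sup>2 + 4) \<le> A * real n \<and> (real k)\<^sup>2 \<le> A * real n"
    proof (cases "k = 0")
      case True
      then show ?thesis using A by simp
    next
      case False
      then have k1: "1 \<le> real k" by simp
      \<comment> \<open>For k \<ge> 1 this makes the envelope a multiple of the square of k^2 (1 +
        l), the quantity controlled by the growth condition; for k = 0 the envelope
        vanishes.\<close>
      have "1 + real k * l \<le> real k * (1 + l)" using k1 by (simp add: distrib_left)
      then have "(ln (sqrt 2 * card (\<M> n)))\<^sup>2 \<le> (real k * (1 + l))\<^sup>2"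
        using ln_le ln_ge by (intro power_mono) auto
      moreover have "1\<^sup>2 \<le> (real k * (1 + l))\<^sup>2"
        using mult_mono[OF k1, of 1 "1 + l"] l0 by (intro power_mono) auto
      ultimately have "2 * (ln (sqrt 2 * card (\<M> n)))\<^sup>2 + 4 \<le> 6 * (real k * (1 + l))\<^sup>2" by simp
      then have "(4 * real k)\<^sup>2 * (2 * (ln (sqrt 2 * card (\<M> n)))\<^sup>2 + 4) \<le> (4 * real k)\<^sup>2 * (6 * (real k * (1 + l))\<^sup>2)"
        by (intro mult_left_mono) auto
      also have "\<dots> = 96 * ((real k)\<^sup>2 * (1 + l))\<^sup>2" by (simp add: power_mult_distrib power2_eq_square)
      finally have 1: "(4 * real k)\<^sup>2 * (2 * (ln (sqrt 2 * card (\<M> n)))\<^sup>2 + 4) \<le> A * real n"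
        using kl DA by linarith
      have "(real k)\<^sup>2 * 4 \<le> (4 * real k)\<^sup>2 * (2 * (ln (sqrt 2 * card (\<M> n)))\<^sup>2 + 4)"
        by (intro mult_mono power_mono) auto
      then have "(real k)\<^sup>2 \<le> A * real n" using 1 zero_le_power2[of "real k"] by linarith
      with 1 show ?thesis by simp
    qed
    have acc: "(\<integral>y. (sq_norm2 (Matrix.vec n (\<mu> n) - hat_matrix (X n) (Mhat n y) *\<^sub>v Matrix.vec n (\<mu> n)))\<^sup>2
        \<partial>completion (gauss n (\<mu> n) \<tau>)) \<le> A * real n" if "\<tau> \<in> {\<sigma>\<^sup>2..(1 + \<delta>) * \<sigma>\<^sup>2}" for \<tau>
      using C[OF n that] mult_right_mono[OF A(2), of "real n"] by linarith
    note B = fixed_sample_bounds[OF n s assms(3)[OF n] assms(5)[OF n] assms(6)[OF n] assms(8)[OF n] assms(9)[OF n]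
        card A(1) acc conjunct1[OF envelope] conjunct2[OF envelope] \<alpha>]
    show "\<bar>Bias_scaled n (X n) (\<mu> n) (Mhat n) (\<sigma>\<^sup>2) \<alpha>\<bar> \<le> b * \<alpha>"
      "Var_scaled n (X n) (\<mu> n) (Mhat n) (\<sigma>\<^sup>2) \<alpha> \<le> v / (real n * \<alpha>\<^sup>2)"
      "MSE_scaled n (X n) (\<mu> n) (Mhat n) (\<sigma>\<^sup>2) \<alpha> \<le> v / (real n * \<alpha>\<^sup>2) + b\<^sup>2 * \<alpha>\<^sup>2"
      using B by (simp_all add: b_def v_def)
  qed
  \<comment> \<open>The bounds hold only for \<alpha> below \<delta>, which n^(-1/4) satisfies from
    some n on.\<close>
  have "((\<lambda>n. real n powr (-1/4)) \<longlongrightarrow> 0) sequentially"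
    by (intro tendsto_neg_powr filterlim_real_sequentially) simp
  then have "eventually (\<lambda>n. real n powr (-1/4) < \<delta>) sequentially"
    using assms(2) by (rule order_tendstoD(2))
  then have "eventually (\<lambda>n. norm (MSE_scaled n (X n) (\<mu> n) (Mhat n) (\<sigma>\<^sup>2) (real n powr (-1/4)))
      \<le> (v + b\<^sup>2) * norm (real n powr (-1/2))) sequentially"
    using eventually_ge_at_top[of 1]
  proof eventually_elim
    case (elim n)
    let ?\<alpha> = "real n powr (-1/4)"
    \<comment> \<open>At this \<alpha> both 1/(n \<alpha>^2) and \<alpha>^2 equal n^(-1/2): variance
      and squared bias are balanced.\<close>
    have \<alpha>2: "?\<alpha>\<^sup>2 = real n powr (-1/2)" by (simp add: power2_eq_square powr_add[symmetric])
    have "real n * ?\<alpha>\<^sup>2 = real n powr (1/2)"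
      unfolding \<alpha>2 using elim(2) powr_add[of "real n" 1 "-1/2"] by simp
    then have "v / (real n * ?\<alpha>\<^sup>2) = v * real n powr (-1/2)"
      using powr_minus_divide[of "real n" "1/2"] by simp
    moreover have "MSE_scaled n (X n) (\<mu> n) (Mhat n) (\<sigma>\<^sup>2) ?\<alpha> \<le> v / (real n * ?\<alpha>\<^sup>2) + b\<^sup>2 * ?\<alpha>\<^sup>2"
      using elim by (intro bounds(3)) auto
    moreover have "0 \<le> MSE_scaled n (X n) (\<mu> n) (Mhat n) (\<sigma>\<^sup>2) ?\<alpha>"
      unfolding MSE_scaled_def by simp
    ultimately show ?case unfolding \<alpha>2 by (simp add: distrib_right)
  qed
  then have "(\<lambda>n. MSE_scaled n (X n) (\<mu> n) (Mhat n) (\<sigma>\<^sup>2) (real n powr (-1/4))) \<in> O(\<lambda>n. real n powr (-1/2))"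
    by (rule bigoI)
  then show ?thesis
    using bounds(1,2) by (intro conjI exI[of _ b] exI[of _ v]) auto
qed

end
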